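(* The bisimplicial set $D^\times_+$ of cromulent diagrams of finite sets is a distributive law.
   Context: Bisimplicial sets have two simplicial directions; for simplicial sets $X,Y$ put $(X\boxtimes Y)_{m,n}=X_m\times Y_n$, and let $\Delta^{m,n}=\Delta^m\boxtimes\Delta^n$ and $\Lambda^{m,n}_{b,d}=(\Lambda^m_b\boxtimes\Delta^n)\cup_{\Lambda^m_b\boxtimes\Lambda^n_d}(\Delta^m\boxtimes\Lambda^n_d)\subseteq\Delta^{m,n}$. Here $\Lambda^n_k$ is the union of all faces of $\Delta^n$ except the $k$-th, with the convention $\Lambda^0_0=\emptyset$. A distributive law is a bisimplicial set $D$ such that every map to $D$ from the source of one of the following inclusions extends to the target: (i) $\Lambda^{m,n}_{0,n}\to\Delta^{m,n}$ for all $m,n\ge1$; (ii) $\Lambda^{m,n}_{0,k}\to\Delta^{m,n}$ for all $n>k>0$ and $m\ge0$; (iii) $\Lambda^{m,n}_{k,n}\to\Delta^{m,n}$ for all $n\ge0$ and $m>k>0$. A commutative diagram of finite sets $$\begin{array}{ccccc}A&\leftarrow&B&\rightarrow&C\\ \downarrow&&\downarrow&&\downarrow\\ X&\leftarrow&Y&\rightarrow&Z\end{array}$$ has edge the subdiagram consisting of $A\to X\leftarrow Y\to Z$. The diagram is precromulent if its right-hand square is a pullback, and cromulent if it is terminal among precromulent diagrams with the same edge. Let $C_m$ be the poset of nonempty subintervals $(i,\dots,j)$ of $(0,\dots,m)$ ordered by reverse inclusion (a morphism $I\to J$ exists when $J\subseteq I$); write $ij$ for $(i,\dots,j)$ and $i$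 for $(i)$. The set $(D^\times_+)_{m,n}$ consists of all functors $F:C_m\times[n]\to\mathrm{Fin}$ (with $\mathrm{Fin}$ the category of finite sets and $[n]=\{0<\dots<n\}$) such that: (a) for each $0\le k\le n$ and all intervals $I,J$ with $I\cap J\neq\emptyset$, the square formed by $F(I\cup J,k)\to F(I,k)\to F(I\cap J,k)$ and $F(I\cup J,k)\to F(J,k)\to F(I\cap J,k)$ is a pullback; (b) for all $0\le i\le j\le m$ and $0\le k\le l\le n$, the diagram with top row $F(i,k)\leftarrow F(ij,k)\to F(j,k)$, bottom row $F(i,l)\leftarrow F(ij,l)\to F(j,l)$ and vertical maps induced by $k\le l$ is cromulent. The bisimplicial structure is by precomposition (a monotone $\alpha:[m']\to[m]$ acts via $(i,\dots,j)\mapsto(\alpha(i),\dots,\alpha(j))$). *)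

theory Defs
  imports Main "HOL-Library.FuncSet"
begin

section \<open>Simplicial and bisimplicial sets\<close>

text \<open>The object \<open>[n]\<close> of the simplex category is the set \<open>{0..n}\<close>, and morphisms are extensional
  functions, so that equality of morphisms is equality of functions.\<close>

definition mono_maps :: "nat \<Rightarrow> nat \<Rightarrow> (nat \<Rightarrow> nat) set" where
  "mono_maps m n = {\<alpha> \<in> {0..m} \<rightarrow>\<^sub>E {0..n}. mono_on {0..m} \<alpha>}"

text \<open>\<open>sact X m' m \<alpha>\<close> is the operator from \<open>m\<close>-simplices to \<open>m'\<close>-simplices induced by
  \<open>\<alpha> \<in> mono_maps m' m\<close>; similarly \<open>biact D m' m n' n \<alpha> \<beta>\<close> goes from bidegree \<open>(m, n)\<close>
  to bidegree \<open>(m', n')\<close>.  The values of these operators on other arguments are irrelevant.\<close>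

record 'x sset =
  simplices :: "nat \<Rightarrow> 'x set"
  sact :: "nat \<Rightarrow> nat \<Rightarrow> (nat \<Rightarrow> nat) \<Rightarrow> 'x \<Rightarrow> 'x"

record 'x bisset =
  bisimplices :: "nat \<Rightarrow> nat \<Rightarrow> 'x set"
  biact :: "nat \<Rightarrow> nat \<Rightarrow> nat \<Rightarrow> nat \<Rightarrow> (nat \<Rightarrow> nat) \<Rightarrow> (nat \<Rightarrow> nat) \<Rightarrow> 'x \<Rightarrow> 'x"

definition bisimplicial_set :: "'x bisset \<Rightarrow> bool" where
  "bisimplicial_set D \<longleftrightarrow>
     (\<forall>m' m n' n. \<forall>\<alpha>\<in>mono_maps m' m. \<forall>\<beta>\<in>mono_maps n' n. \<forall>x\<in>bisimplices D m n.
        biact D m' m n' n \<alpha> \<beta> x \<in> bisimplices D m' n') \<and>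
     (\<forall>m n. \<forall>x\<in>bisimplices D m n.
        biact D m m n n (\<lambda>i\<in>{0..m}. i) (\<lambda>i\<in>{0..n}. i) x = x) \<and>
     (\<forall>m'' m' m n'' n' n. \<forall>\<alpha>'\<in>mono_maps m'' m'. \<forall>\<alpha>\<in>mono_maps m' m.
        \<forall>\<beta>'\<in>mono_maps n'' n'. \<forall>\<beta>\<in>mono_maps n' n. \<forall>x\<in>bisimplices D m n.
          biact D m'' m n'' n (compose {0..m''} \<alpha> \<alpha>') (compose {0..n''} \<beta> \<beta>') x =
          biact D m'' m' n'' n' \<alpha>' \<beta>' (biact D m' m n' n \<alpha> \<beta> x))"

definition bisset_map :: "'x bisset \<Rightarrow> 'y bisset \<Rightarrow> (nat \<Rightarrow> nat \<Rightarrow> 'x \<Rightarrow> 'y) \<Rightarrow> bool" where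
  "bisset_map X Y f \<longleftrightarrow>
     (\<forall>m n. f m n \<in> bisimplices X m n \<rightarrow> bisimplices Y m n) \<and>
     (\<forall>m' m n' n. \<forall>\<alpha>\<in>mono_maps m' m. \<forall>\<beta>\<in>mono_maps n' n. \<forall>x\<in>bisimplices X m n.
        f m' n' (biact X m' m n' n \<alpha> \<beta> x) = biact Y m' m n' n \<alpha> \<beta> (f m n x))"

definition box :: "'x sset \<Rightarrow> 'y sset \<Rightarrow> ('x \<times> 'y) bisset" (infixr "\<boxtimes>" 70) where
  "X \<boxtimes> Y = \<lparr>bisimplices = (\<lambda>m n. simplices X m \<times> simplices Y n),
             biact = (\<lambda>m' m n' n \<alpha> \<beta>. map_prod (sact X m' m \<alpha>) (sact Y n' n \<beta>))\<rparr>"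

definition Simplex :: "nat \<Rightarrow> (nat \<Rightarrow> nat) sset" where
  "Simplex n = \<lparr>simplices = (\<lambda>p. mono_maps p n),
                sact = (\<lambda>p' p \<alpha> \<sigma>. compose {0..p'} \<sigma> \<alpha>)\<rparr>"

definition face_simplices :: "nat \<Rightarrow> nat \<Rightarrow> nat \<Rightarrow> (nat \<Rightarrow> nat) set" where
  "face_simplices n j p = {\<sigma> \<in> simplices (Simplex n) p. j \<notin> \<sigma> ` {0..p}}"

text \<open>For \<open>n = k = 0\<close> the union below is empty, which gives the convention that
  \<open>Horn 0 0\<close> is the empty simplicial set.\<close>

definition Horn :: "nat \<Rightarrow> nat \<Rightarrow> (nat \<Rightarrow> nat) sset" where
  "Horn n k = (Simplex n)\<lparr>simplices := (\<lambda>p. \<Union>j\<in>{0..n} - {k}. face_simplices n j p)\<rparr>"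

abbreviation BiSimplex :: "nat \<Rightarrow> nat \<Rightarrow> ((nat \<Rightarrow> nat) \<times> (nat \<Rightarrow> nat)) bisset" where
  "BiSimplex m n \<equiv> Simplex m \<boxtimes> Simplex n"

text \<open>The pushout of the two pieces over their intersection is realised as their union inside the
  bisimplex.\<close>

definition BiHorn ::
    "nat \<Rightarrow> nat \<Rightarrow> nat \<Rightarrow> nat \<Rightarrow> ((nat \<Rightarrow> nat) \<times> (nat \<Rightarrow> nat)) bisset" where
  "BiHorn m n b d = (BiSimplex m n)\<lparr>bisimplices :=
     (\<lambda>p q. bisimplices (Horn m b \<boxtimes> Simplex n) p q \<union> bisimplices (Simplex m \<boxtimes> Horn n d) p q)\<rparr>"

definition all_maps_extend :: "'x bisset \<Rightarrow> 'x bisset \<Rightarrow> 'y bisset \<Rightarrow> bool" where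
  "all_maps_extend S T D \<longleftrightarrow>
     (\<forall>f. bisset_map S D f \<longrightarrow>
        (\<exists>g. bisset_map T D g \<and> (\<forall>m n. \<forall>x\<in>bisimplices S m n. g m n x = f m n x)))"

definition distributive_law :: "'x bisset \<Rightarrow> bool" where
  "distributive_law D \<longleftrightarrow> bisimplicial_set D \<and>
     (\<forall>m n. 1 \<le> m \<longrightarrow> 1 \<le> n \<longrightarrow> all_maps_extend (BiHorn m n 0 n) (BiSimplex m n) D) \<and>
     (\<forall>m n k. 0 < k \<longrightarrow> k < n \<longrightarrow> all_maps_extend (BiHorn m n 0 k) (BiSimplex m n) D) \<and>
     (\<forall>m n k. 0 < k \<longrightarrow> k < m \<longrightarrow> all_maps_extend (BiHorn m n k n) (BiSimplex m n) D)"

section \<open>Diagrams of finite sets\<close>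

text \<open>The category of finite sets is modelled by the finite subsets of a type \<open>'a\<close>, with
  extensional functions as morphisms.  If \<open>'a\<close> is infinite, every finite set is isomorphic to one
  of these objects.\<close>

definition is_pullback ::
    "'a set \<Rightarrow> 'a set \<Rightarrow> 'a set \<Rightarrow> 'a set \<Rightarrow>
     ('a \<Rightarrow> 'a) \<Rightarrow> ('a \<Rightarrow> 'a) \<Rightarrow> ('a \<Rightarrow> 'a) \<Rightarrow> ('a \<Rightarrow> 'a) \<Rightarrow> bool" where
  \<comment> \<open>the square \<open>p : P \<rightarrow> A\<close>, \<open>q : P \<rightarrow> B\<close>, \<open>f : A \<rightarrow> C\<close>, \<open>g : B \<rightarrow> C\<close>\<close>
  "is_pullback P A B C p q f g \<longleftrightarrow>
     compose P f p = compose P g q \<and>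
     (\<forall>T :: 'a set. finite T \<longrightarrow> (\<forall>s\<in>T \<rightarrow>\<^sub>E A. \<forall>t\<in>T \<rightarrow>\<^sub>E B. compose T f s = compose T g t \<longrightarrow>
        (\<exists>!u. u \<in> T \<rightarrow>\<^sub>E P \<and> compose T p u = s \<and> compose T q u = t)))"

text \<open>Diagrams with rows \<open>A \<leftarrow> B \<rightarrow> C\<close> and \<open>X \<leftarrow> Y \<rightarrow> Z\<close> and vertical maps
  \<open>A \<rightarrow> X\<close>, \<open>B \<rightarrow> Y\<close>, \<open>C \<rightarrow> Z\<close>.\<close>

record 'a ladder =
  obA :: "'a set"
  obB :: "'a set"
  obC :: "'a set"
  obX :: "'a set"
  obY :: "'a set"
  obZ :: "'a set"
  mapBA :: "'a \<Rightarrow> 'a"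
  mapBC :: "'a \<Rightarrow> 'a"
  mapYX :: "'a \<Rightarrow> 'a"
  mapYZ :: "'a \<Rightarrow> 'a"
  mapAX :: "'a \<Rightarrow> 'a"
  mapBY :: "'a \<Rightarrow> 'a"
  mapCZ :: "'a \<Rightarrow> 'a"

definition commutative_ladder :: "'a ladder \<Rightarrow> bool" where
  "commutative_ladder L \<longleftrightarrow>
     finite (obA L) \<and> finite (obB L) \<and> finite (obC L) \<and>
     finite (obX L) \<and> finite (obY L) \<and> finite (obZ L) \<and>
     mapBA L \<in> obB L \<rightarrow>\<^sub>E obA L \<and> mapBC L \<in> obB L \<rightarrow>\<^sub>E obC L \<and>
     mapYX L \<in> obY L \<rightarrow>\<^sub>E obX L \<and> mapYZ L \<in> obY L \<rightarrow>\<^sub>E obZ L \<and>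
     mapAX L \<in> obA L \<rightarrow>\<^sub>E obX L \<and> mapBY L \<in> obB L \<rightarrow>\<^sub>E obY L \<and>
     mapCZ L \<in> obC L \<rightarrow>\<^sub>E obZ L \<and>
     compose (obB L) (mapAX L) (mapBA L) = compose (obB L) (mapYX L) (mapBY L) \<and>
     compose (obB L) (mapCZ L) (mapBC L) = compose (obB L) (mapYZ L) (mapBY L)"

definition same_edge :: "'a ladder \<Rightarrow> 'a ladder \<Rightarrow> bool" where
  "same_edge L L' \<longleftrightarrow>
     obA L = obA L' \<and> obX L = obX L' \<and> obY L = obY L' \<and> obZ L = obZ L' \<and>
     mapAX L = mapAX L' \<and> mapYX L = mapYX L' \<and> mapYZ L = mapYZ L'"

definition precromulent :: "'a ladder \<Rightarrow> bool" where
  "precromulent L \<longleftrightarrow> commutative_ladder L \<and>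
     is_pullback (obB L) (obC L) (obY L) (obZ L) (mapBC L) (mapBY L) (mapCZ L) (mapYZ L)"

text \<open>A morphism between ladders with the same edge is a natural transformation that is the
  identity on the edge, hence is given by its components \<open>u\<close> at \<open>B\<close> and \<open>v\<close> at \<open>C\<close>.\<close>

definition ladder_hom :: "'a ladder \<Rightarrow> 'a ladder \<Rightarrow> (('a \<Rightarrow> 'a) \<times> ('a \<Rightarrow> 'a)) set" where
  "ladder_hom L L' = {(u, v).
     u \<in> obB L \<rightarrow>\<^sub>E obB L' \<and> v \<in> obC L \<rightarrow>\<^sub>E obC L' \<and>
     compose (obB L) (mapBA L') u = mapBA L \<and>
     compose (obB L) (mapBY L') u = mapBY L \<and>
     compose (obB L) (mapBC L') u = compose (obB L) v (mapBC L) \<and>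
     compose (obC L) (mapCZ L') v = mapCZ L}"

definition cromulent :: "'a ladder \<Rightarrow> bool" where
  "cromulent L \<longleftrightarrow> precromulent L \<and>
     (\<forall>L'. precromulent L' \<longrightarrow> same_edge L' L \<longrightarrow> (\<exists>!h. h \<in> ladder_hom L' L))"

section \<open>The bisimplicial set of cromulent diagrams\<close>

definition intervals :: "nat \<Rightarrow> nat set set" where
  "intervals m = {{i..j} | i j. i \<le> j \<and> j \<le> m}"

definition shape :: "nat \<Rightarrow> nat \<Rightarrow> (nat set \<times> nat) set" where
  "shape m n = intervals m \<times> {0..n}"

fun shape_le :: "nat set \<times> nat \<Rightarrow> nat set \<times> nat \<Rightarrow> bool" where
  "shape_le (I, k) (J, l) \<longleftrightarrow> J \<subseteq> I \<and> k \<le> l"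

record 'a fin_diagram =
  ob :: "nat set \<times> nat \<Rightarrow> 'a set"
  ar :: "nat set \<times> nat \<Rightarrow> nat set \<times> nat \<Rightarrow> 'a \<Rightarrow> 'a"

text \<open>The last two conditions fix the values outside the indexing poset, so that functors are
  equal exactly when they agree on objects and morphisms.\<close>

definition is_functor :: "nat \<Rightarrow> nat \<Rightarrow> 'a fin_diagram \<Rightarrow> bool" where
  "is_functor m n F \<longleftrightarrow>
     (\<forall>p\<in>shape m n. finite (ob F p)) \<and>
     (\<forall>p\<in>shape m n. \<forall>q\<in>shape m n. shape_le p q \<longrightarrow> ar F p q \<in> ob F p \<rightarrow>\<^sub>E ob F q) \<and>
     (\<forall>p\<in>shape m n. ar F p p = (\<lambda>x\<in>ob F p. x)) \<and>
     (\<forall>p\<in>shape m n. \<forall>q\<in>shape m n. \<forall>r\<in>shape m n. shape_le p q \<longrightarrow> shape_le q r \<longrightarrow>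
        ar F p r = compose (ob F p) (ar F q r) (ar F p q)) \<and>
     (\<forall>p. p \<notin> shape m n \<longrightarrow> ob F p = {}) \<and>
     (\<forall>p q. \<not> (p \<in> shape m n \<and> q \<in> shape m n \<and> shape_le p q) \<longrightarrow> ar F p q = (\<lambda>_. undefined))"

definition ladder_of :: "'a fin_diagram \<Rightarrow> nat \<Rightarrow> nat \<Rightarrow> nat \<Rightarrow> nat \<Rightarrow> 'a ladder" where
  "ladder_of F i j k l =
     \<lparr>obA = ob F ({i}, k), obB = ob F ({i..j}, k), obC = ob F ({j}, k),
      obX = ob F ({i}, l), obY = ob F ({i..j}, l), obZ = ob F ({j}, l),
      mapBA = ar F ({i..j}, k) ({i}, k), mapBC = ar F ({i..j}, k) ({j}, k),
      mapYX = ar F ({i..j}, l) ({i}, l), mapYZ = ar F ({i..j}, l) ({j}, l),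
      mapAX = ar F ({i}, k) ({i}, l), mapBY = ar F ({i..j}, k) ({i..j}, l),
      mapCZ = ar F ({j}, k) ({j}, l)\<rparr>"

definition cromulent_functors :: "nat \<Rightarrow> nat \<Rightarrow> 'a fin_diagram set" where
  "cromulent_functors m n = {F. is_functor m n F \<and>
     (\<forall>k\<le>n. \<forall>I\<in>intervals m. \<forall>J\<in>intervals m. I \<inter> J \<noteq> {} \<longrightarrow>
        is_pullback (ob F (I \<union> J, k)) (ob F (I, k)) (ob F (J, k)) (ob F (I \<inter> J, k))
          (ar F (I \<union> J, k) (I, k)) (ar F (I \<union> J, k) (J, k))
          (ar F (I, k) (I \<inter> J, k)) (ar F (J, k) (I \<inter> J, k))) \<and>
     (\<forall>i j k l. i \<le> j \<longrightarrow> j \<le> m \<longrightarrow> k \<le> l \<longrightarrow> l \<le> n \<longrightarrow> cromulent (ladder_of F i j k l))}"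

fun shape_map :: "(nat \<Rightarrow> nat) \<Rightarrow> (nat \<Rightarrow> nat) \<Rightarrow> nat set \<times> nat \<Rightarrow> nat set \<times> nat" where
  "shape_map \<alpha> \<beta> (I, k) = ({\<alpha> (Min I)..\<alpha> (Max I)}, \<beta> k)"

definition precompose ::
    "nat \<Rightarrow> nat \<Rightarrow> (nat \<Rightarrow> nat) \<Rightarrow> (nat \<Rightarrow> nat) \<Rightarrow> 'a fin_diagram \<Rightarrow> 'a fin_diagram" where
  "precompose m' n' \<alpha> \<beta> F =
     \<lparr>ob = (\<lambda>p. if p \<in> shape m' n' then ob F (shape_map \<alpha> \<beta> p) else {}),
      ar = (\<lambda>p q. if p \<in> shape m' n' \<and> q \<in> shape m' n' \<and> shape_le p q
                  then ar F (shape_map \<alpha> \<beta> p) (shape_map \<alpha> \<beta> q) else (\<lambda>_. undefined))\<rparr>"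

definition D_times_plus :: "'a fin_diagram bisset" where
  "D_times_plus = \<lparr>bisimplices = cromulent_functors,
                   biact = (\<lambda>m' m n' n \<alpha> \<beta>. precompose m' n' \<alpha> \<beta>)\<rparr>"

end

theory Submission
  imports Defs
begin

text \<open>Terminality in the definition of a cromulent diagram says that its upper right corner is a dependent
product (\<open>cromulent_iff\<close>).  Consequently a cromulent functor can be described by elements
(\<open>cromulent_functors_iff\<close>): elements over \<open>[a,e]\<close> are matching pairs of elements over \<open>[a,c]\<close> and \<open>[c,e]\<close>;
elements over \<open>[i,j]\<close> at level \<open>k\<close> are pairs of an element of \<open>F(j,k)\<close> and one of \<open>F(ij,l)\<close> with the same image in
\<open>F(j,l)\<close>; and \<open>F(j,k)\<close> is the product, along the span \<open>F(i,l) \<leftarrow> F(ij,l) \<rightarrow> F(j,l)\<close>, of \<open>F(i,k)\<close> over \<open>F(i,l)\<close>.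

By naturality and the Yoneda lemma, a map from the horn with missing faces \<open>b\<close> and \<open>d\<close> is a partial
diagram.  It is defined on the objects and arrows that avoid some vertex \<open>v \<noteq> b\<close> as an endpoint or some level
\<open>w \<noteq> d\<close>, and it agrees with a cromulent functor on each of these parts; an extension of the map is a
cromulent functor that extends the partial diagram (\<open>all_maps_extend_if_horn_fillable\<close>).  It suffices to construct
a cromulent diagram that is naturally isomorphic to the partial one where the latter is defined: the
structure can be transported, and as \<open>'a\<close> is infinite there is room for the missing objects
(\<open>extend_partial\<close>).

The construction exploits that no part of the horn omits the vertex \<open>b\<close> or the level \<open>d\<close>.  Hence every object of
the horn can be compared, inside the horn, with the column over \<open>b\<close> and the row at level \<open>d\<close>.

\<^item> If \<open>d\<close> is inner, the two halves of the grid below and above level \<open>d\<close> lie in the horn.  Compose them through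
level \<open>d\<close>; cromulent squares can be stacked.

\<^item> If \<open>b\<close> is inner, the two halves to the left and right of \<open>b\<close> lie in the horn.  Compose the spans through \<open>b\<close> by
pullback; cromulent squares can be pasted side by side.

\<^item> If \<open>b = 0\<close> and \<open>d = n\<close>, the column over \<open>0\<close> and the row at level \<open>n\<close> lie in the horn.  Build all other objects as
dependent products of the column along the row.  Every cromulent diagram with this column and row is
canonically isomorphic to the result.

The size of the grid enters only through the set of indices at which the comparison isomorphism is defined.\<close>

section \<open>Cromulent ladders in terms of elements\<close>

text \<open>The universal property is only tested on finite sets \<open>T\<close> inside the type \<open>'a\<close>.  A one-element set
\<open>T\<close> already detects the elements of a pullback, and a map out of an arbitrary \<open>T\<close> is assembled
pointwise.\<close>

lemma is_pullback_iff:
  assumes p: "p \<in> P \<rightarrow> A" and q: "q \<in> P \<rightarrow> B"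
  shows "is_pullback P A B C p q f g \<longleftrightarrow>
    (\<forall>x\<in>P. f (p x) = g (q x)) \<and>
    (\<forall>a\<in>A. \<forall>b\<in>B. f a = g b \<longrightarrow> (\<exists>!x. x \<in> P \<and> p x = a \<and> q x = b))"
    (is "?L \<longleftrightarrow> ?comm \<and> ?lift")
proof
  assume L: ?L
  have comm: ?comm
  proof
    fix x assume "x \<in> P"
    moreover have "compose P f p = compose P g q"
      using L by (simp add: is_pullback_def)
    ultimately show "f (p x) = g (q x)"
      by (metis compose_eq)
  qed
  moreover have ?lift
  proof (intro ballI impI)
    fix a b assume ab: "a \<in> A" "b \<in> B" "f a = g b"
    let ?T = "{undefined :: 'a}"
    have "\<exists>!u. u \<in> ?T \<rightarrow>\<^sub>E P \<and> compose ?T p u = (\<lambda>_\<in>?T. a) \<and> compose ?T q u = (\<lambda>_\<in>?T. b)"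
    proof -
      have "finite ?T" "(\<lambda>_\<in>?T. a) \<in> ?T \<rightarrow>\<^sub>E A" "(\<lambda>_\<in>?T. b) \<in> ?T \<rightarrow>\<^sub>E B"
        "compose ?T f (\<lambda>_\<in>?T. a) = compose ?T g (\<lambda>_\<in>?T. b)"
        using ab by (auto simp: compose_def)
      then show ?thesis using L unfolding is_pullback_def by blast
    qed
    then obtain u where u: "u \<in> ?T \<rightarrow>\<^sub>E P" "compose ?T p u = (\<lambda>_\<in>?T. a)" "compose ?T q u = (\<lambda>_\<in>?T. b)"
      and uniq: "\<And>u'. u' \<in> ?T \<rightarrow>\<^sub>E P \<Longrightarrow> compose ?T p u' = (\<lambda>_\<in>?T. a) \<Longrightarrow>
        compose ?T q u' = (\<lambda>_\<in>?T. b) \<Longrightarrow> u' = u" by blast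
    show "\<exists>!x. x \<in> P \<and> p x = a \<and> q x = b"
    proof (rule ex1I[of _ "u undefined"])
      show "u undefined \<in> P \<and> p (u undefined) = a \<and> q (u undefined) = b"
        using u(1) fun_cong[OF u(2), of undefined] fun_cong[OF u(3), of undefined]
        by (auto simp: compose_def)
    next
      fix x assume x: "x \<in> P \<and> p x = a \<and> q x = b"
      have "(\<lambda>_\<in>?T. x) = u"
        by (rule uniq) (use x in \<open>auto simp: compose_def\<close>)
      from fun_cong[OF this, of undefined] show "x = u undefined" by simp
    qed
  qed
  ultimately show "?comm \<and> ?lift" ..
next
  assume R: "?comm \<and> ?lift"
  show ?L unfolding is_pullback_def
  proof (intro conjI allI impI ballI)
    show "compose P f p = compose P g q" using R by (auto simp: compose_def)
  next
    fix T :: "'a set" and s t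
    assume s: "s \<in> T \<rightarrow>\<^sub>E A" and t: "t \<in> T \<rightarrow>\<^sub>E B" and st: "compose T f s = compose T g t"
    have ex: "\<exists>!x. x \<in> P \<and> p x = s w \<and> q x = t w" if "w \<in> T" for w
      using R s t that fun_cong[OF st, of w] by (auto simp: compose_def PiE_iff)
    define u where "u = (\<lambda>w\<in>T. THE x. x \<in> P \<and> p x = s w \<and> q x = t w)"
    have u: "u w \<in> P \<and> p (u w) = s w \<and> q (u w) = t w" if "w \<in> T" for w
      using theI'[OF ex[OF that]] that by (simp add: u_def)
    show "\<exists>!u. u \<in> T \<rightarrow>\<^sub>E P \<and> compose T p u = s \<and> compose T q u = t"
    proof (rule ex1I[of _ u])
      show "u \<in> T \<rightarrow>\<^sub>E P \<and> compose T p u = s \<and> compose T q u = t"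
      proof (intro conjI)
        show "u \<in> T \<rightarrow>\<^sub>E P" using u by (auto simp: u_def)
        show "compose T p u = s" "compose T q u = t"
          by (rule extensionalityI[of _ T], use u s t in \<open>auto simp: compose_def PiE_iff\<close>)+
      qed
    next
      fix u' assume u': "u' \<in> T \<rightarrow>\<^sub>E P \<and> compose T p u' = s \<and> compose T q u' = t"
      show "u' = u"
      proof (rule extensionalityI[of _ T])
        show "u' \<in> extensional T" "u \<in> extensional T" using u' by (auto simp: u_def PiE_iff)
        fix w assume w: "w \<in> T"
        then have "u' w \<in> P \<and> p (u' w) = s w \<and> q (u' w) = t w"
          using u' compose_eq[of w T p u'] compose_eq[of w T q u'] by auto
        then show "u' w = u w" using ex[OF w] u[OF w] by blast
      qed
    qed
  qed
qed

lemma precromulent_iff: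
  "precromulent L \<longleftrightarrow> commutative_ladder L \<and>
    (\<forall>c\<in>obC L. \<forall>y\<in>obY L. mapCZ L c = mapYZ L y \<longrightarrow>
      (\<exists>!b. b \<in> obB L \<and> mapBC L b = c \<and> mapBY L b = y))"
proof -
  have "is_pullback (obB L) (obC L) (obY L) (obZ L) (mapBC L) (mapBY L) (mapCZ L) (mapYZ L) \<longleftrightarrow>
    (\<forall>b\<in>obB L. mapCZ L (mapBC L b) = mapYZ L (mapBY L b)) \<and>
    (\<forall>c\<in>obC L. \<forall>y\<in>obY L. mapCZ L c = mapYZ L y \<longrightarrow>
      (\<exists>!b. b \<in> obB L \<and> mapBC L b = c \<and> mapBY L b = y))" if "commutative_ladder L"
    by (rule is_pullback_iff) (use that in \<open>auto simp: commutative_ladder_def PiE_iff\<close>)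
  moreover have "\<forall>b\<in>obB L. mapCZ L (mapBC L b) = mapYZ L (mapBY L b)" if "commutative_ladder L"
    using that unfolding commutative_ladder_def by (metis compose_eq)
  ultimately show ?thesis unfolding precromulent_def by blast
qed

text \<open>A precromulent diagram with the edge of \<open>L\<close> is a map \<open>C' \<rightarrow> Z\<close> together with, for every point of
\<open>C'\<close> over \<open>z\<close>, a section \<open>s\<close> that assigns to each \<open>y\<close> in the fibre of \<open>Y \<rightarrow> Z\<close> over \<open>z\<close> an element of
\<open>A\<close> over the image of \<open>y\<close> in \<open>X\<close>.  The terminal such diagram has the set of all sections as its
fibre over \<open>z\<close>, that is, \<open>C\<close> is a dependent product.  To extract this from terminality, test against
the diagram in which \<open>C'\<close> is a single point over \<open>z\<close> and \<open>B'\<close> is the fibre of \<open>Y\<close> over \<open>z\<close>: its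
morphisms to \<open>L\<close> are the elements of \<open>C\<close> that induce \<open>s\<close>.\<close>

lemma cromulent_iff:
  "cromulent L \<longleftrightarrow> precromulent L \<and>
    (\<forall>z\<in>obZ L. \<forall>s. (\<forall>y\<in>obY L. mapYZ L y = z \<longrightarrow> s y \<in> obA L \<and> mapAX L (s y) = mapYX L y) \<longrightarrow>
       (\<exists>!c. c \<in> obC L \<and> mapCZ L c = z \<and>
             (\<forall>b\<in>obB L. mapBC L b = c \<longrightarrow> mapBA L b = s (mapBY L b))))"
    (is "_ \<longleftrightarrow> _ \<and> ?sec")
proof (cases "precromulent L")
  case False
  then show ?thesis by (simp add: cromulent_def)
next
  case pre: True
  then have cl: "commutative_ladder L" by (simp add: precromulent_def)
  then have commR: "mapCZ L (mapBC L b) = mapYZ L (mapBY L b)" if "b \<in> obB L" for b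
    using that unfolding commutative_ladder_def by (metis compose_eq)
  have lift: "\<And>c y. c \<in> obC L \<Longrightarrow> y \<in> obY L \<Longrightarrow> mapCZ L c = mapYZ L y \<Longrightarrow>
      \<exists>!b. b \<in> obB L \<and> mapBC L b = c \<and> mapBY L b = y"
    using pre by (simp add: precromulent_iff)
  have maps: "\<And>b. b \<in> obB L \<Longrightarrow> mapBA L b \<in> obA L" "\<And>b. b \<in> obB L \<Longrightarrow> mapBC L b \<in> obC L"
    "\<And>b. b \<in> obB L \<Longrightarrow> mapBY L b \<in> obY L" "\<And>c. c \<in> obC L \<Longrightarrow> mapCZ L c \<in> obZ L"
    using cl by (auto simp: commutative_ladder_def)
  have "(\<forall>L'. precromulent L' \<longrightarrow> same_edge L' L \<longrightarrow> (\<exists>!h. h \<in> ladder_hom L' L)) \<longleftrightarrow> ?sec"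
  proof
    assume terminal: "\<forall>L'. precromulent L' \<longrightarrow> same_edge L' L \<longrightarrow> (\<exists>!h. h \<in> ladder_hom L' L)"
    show ?sec
    proof (intro ballI allI impI)
      fix z s
      assume z: "z \<in> obZ L"
        and s: "\<forall>y\<in>obY L. mapYZ L y = z \<longrightarrow> s y \<in> obA L \<and> mapAX L (s y) = mapYX L y"
      let ?pt = "undefined :: 'a" and ?B = "{y \<in> obY L. mapYZ L y = z}"
      \<comment> \<open>The point can be any element of the type; only its image in \<open>Z\<close> and the section matter.\<close>
      define L' where "L' = L\<lparr>obB := ?B, obC := {?pt}, mapBA := (\<lambda>y\<in>?B. s y),
        mapBC := (\<lambda>y\<in>?B. ?pt), mapBY := (\<lambda>y\<in>?B. y), mapCZ := (\<lambda>c\<in>{?pt}. z)\<rparr>"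
      have same: "same_edge L' L" by (simp add: same_edge_def L'_def)
      have "commutative_ladder L'"
        using cl s z unfolding commutative_ladder_def
        by (simp add: L'_def compose_def) (auto simp: compose_def)
      then have "precromulent L'" by (auto simp: precromulent_iff L'_def)
      then have hom: "\<exists>!h. h \<in> ladder_hom L' L" using terminal same by blast
      then obtain u v where uv: "(u, v) \<in> ladder_hom L' L" by (metis surj_pair)
      have u: "u y \<in> obB L" "mapBA L (u y) = s y" "mapBY L (u y) = y" "mapBC L (u y) = v ?pt"
        if "y \<in> ?B" for y
      proof -
        have *: "compose ?B (mapBA L) u = (\<lambda>y\<in>?B. s y)" "compose ?B (mapBY L) u = (\<lambda>y\<in>?B. y)"
          "compose ?B (mapBC L) u = compose ?B v (\<lambda>y\<in>?B. ?pt)" "u \<in> ?B \<rightarrow>\<^sub>E obB L"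
          using uv by (auto simp: ladder_hom_def L'_def)
        show "u y \<in> obB L" using *(4) that by blast
        show "mapBA L (u y) = s y" "mapBY L (u y) = y" "mapBC L (u y) = v ?pt"
          using fun_cong[OF *(1), of y] fun_cong[OF *(2), of y] fun_cong[OF *(3), of y] that
          by (auto simp: compose_def)
      qed
      have v1: "compose {?pt} (mapCZ L) v = (\<lambda>c\<in>{?pt}. z)" and v2: "v \<in> {?pt} \<rightarrow>\<^sub>E obC L"
        using uv by (auto simp: ladder_hom_def L'_def)
      have v: "v ?pt \<in> obC L" "mapCZ L (v ?pt) = z"
        using fun_cong[OF v1, of ?pt] v2 by (auto simp: compose_def)
      show "\<exists>!c. c \<in> obC L \<and> mapCZ L c = z \<and> (\<forall>b\<in>obB L. mapBC L b = c \<longrightarrow> mapBA L b = s (mapBY L b))"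
      proof (rule ex1I[of _ "v ?pt"], intro conjI ballI impI)
        fix b assume b: "b \<in> obB L" "mapBC L b = v ?pt"
        then have y: "mapBY L b \<in> ?B" using commR[OF b(1)] v maps by auto
        have "b = u (mapBY L b)"
          using lift[of "v ?pt" "mapBY L b"] u[OF y] b v y by auto
        then show "mapBA L b = s (mapBY L b)" using u[OF y] by simp
      next
        fix c assume c: "c \<in> obC L \<and> mapCZ L c = z \<and>
          (\<forall>b\<in>obB L. mapBC L b = c \<longrightarrow> mapBA L b = s (mapBY L b))"
        have ex: "\<exists>!b. b \<in> obB L \<and> mapBC L b = c \<and> mapBY L b = y" if "y \<in> ?B" for y
          using lift[of c y] c that by auto
        define u' where "u' = (\<lambda>y\<in>?B. THE b. b \<in> obB L \<and> mapBC L b = c \<and> mapBY L b = y)"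
        have u': "u' y \<in> obB L \<and> mapBC L (u' y) = c \<and> mapBY L (u' y) = y" if "y \<in> ?B" for y
          using theI'[OF ex[OF that]] that by (simp add: u'_def)
        have ext: "u' \<in> extensional ?B" by (simp add: u'_def)
        have "(u', \<lambda>_\<in>{?pt}. c) \<in> ladder_hom L' L"
          unfolding ladder_hom_def L'_def using c u' ext by (auto simp: compose_def PiE_iff)
        with uv hom have "(\<lambda>_\<in>{?pt}. c) = v" by blast
        then show "c = v ?pt" by (metis restrict_apply' singletonI)
      qed (use v in auto)
    qed
  next
    assume sec: ?sec
    show "\<forall>L'. precromulent L' \<longrightarrow> same_edge L' L \<longrightarrow> (\<exists>!h. h \<in> ladder_hom L' L)"
    proof (intro allI impI)
      fix L' assume pre': "precromulent L'" and same: "same_edge L' L"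
      have edge: "obA L' = obA L" "obX L' = obX L" "obY L' = obY L" "obZ L' = obZ L"
        "mapAX L' = mapAX L" "mapYX L' = mapYX L" "mapYZ L' = mapYZ L"
        using same by (auto simp: same_edge_def)
      from pre' have cl': "commutative_ladder L'" by (simp add: precromulent_def)
      then have commR': "mapCZ L' (mapBC L' b) = mapYZ L (mapBY L' b)"
        and commL': "mapAX L (mapBA L' b) = mapYX L (mapBY L' b)" if "b \<in> obB L'" for b
        using that edge unfolding commutative_ladder_def by (metis compose_eq)+
      have lift': "\<And>c y. c \<in> obC L' \<Longrightarrow> y \<in> obY L \<Longrightarrow> mapCZ L' c = mapYZ L y \<Longrightarrow>
          \<exists>!b. b \<in> obB L' \<and> mapBC L' b = c \<and> mapBY L' b = y"
        using pre' edge by (simp add: precromulent_iff)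
      have maps': "\<And>b. b \<in> obB L' \<Longrightarrow> mapBA L' b \<in> obA L" "\<And>b. b \<in> obB L' \<Longrightarrow> mapBC L' b \<in> obC L'"
        "\<And>b. b \<in> obB L' \<Longrightarrow> mapBY L' b \<in> obY L" "\<And>c. c \<in> obC L' \<Longrightarrow> mapCZ L' c \<in> obZ L"
        using cl' by (auto simp: commutative_ladder_def edge)
      have ext': "mapBA L' \<in> extensional (obB L')" "mapBY L' \<in> extensional (obB L')"
        "mapCZ L' \<in> extensional (obC L')"
        using cl' by (auto simp: commutative_ladder_def PiE_iff)
      define e where "e = (\<lambda>c y. THE b. b \<in> obB L' \<and> mapBC L' b = c \<and> mapBY L' b = y)"
      have e: "e c y \<in> obB L' \<and> mapBC L' (e c y) = c \<and> mapBY L' (e c y) = y"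
        if "c \<in> obC L'" "y \<in> obY L" "mapCZ L' c = mapYZ L y" for c y
        using theI'[OF lift'[OF that]] by (simp add: e_def)
      have e_eq: "e (mapBC L' b) (mapBY L' b) = b" if "b \<in> obB L'" for b
        using that lift'[of "mapBC L' b" "mapBY L' b"] maps' commR' e[of "mapBC L' b" "mapBY L' b"]
        by metis
      have ex_v: "\<exists>!d. d \<in> obC L \<and> mapCZ L d = mapCZ L' c \<and>
          (\<forall>b\<in>obB L. mapBC L b = d \<longrightarrow> mapBA L b = mapBA L' (e c (mapBY L b)))" if c: "c \<in> obC L'" for c
      proof -
        have "\<forall>y\<in>obY L. mapYZ L y = mapCZ L' c \<longrightarrow>
          mapBA L' (e c y) \<in> obA L \<and> mapAX L (mapBA L' (e c y)) = mapYX L y"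
          using e[OF c] maps' commL' by metis
        with sec maps'(4)[OF c] show ?thesis by (rule_tac sec[rule_format]) auto
      qed
      define v where "v = (\<lambda>c\<in>obC L'. THE d. d \<in> obC L \<and> mapCZ L d = mapCZ L' c \<and>
          (\<forall>b\<in>obB L. mapBC L b = d \<longrightarrow> mapBA L b = mapBA L' (e c (mapBY L b))))"
      have v: "v c \<in> obC L \<and> mapCZ L (v c) = mapCZ L' c \<and>
          (\<forall>b\<in>obB L. mapBC L b = v c \<longrightarrow> mapBA L b = mapBA L' (e c (mapBY L b)))" if "c \<in> obC L'" for c
        using theI'[OF ex_v[OF that]] that by (simp add: v_def)
      have ex_u: "\<exists>!b. b \<in> obB L \<and> mapBC L b = v (mapBC L' b') \<and> mapBY L b = mapBY L' b'"
        if "b' \<in> obB L'" for b'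
        using lift[of "v (mapBC L' b')" "mapBY L' b'"] v[OF maps'(2)[OF that]] maps'(3)[OF that]
          commR'[OF that] by simp
      define u where "u = (\<lambda>b'\<in>obB L'. THE b. b \<in> obB L \<and> mapBC L b = v (mapBC L' b') \<and> mapBY L b = mapBY L' b')"
      have u: "u b' \<in> obB L \<and> mapBC L (u b') = v (mapBC L' b') \<and> mapBY L (u b') = mapBY L' b'"
        if "b' \<in> obB L'" for b'
        using theI'[OF ex_u[OF that]] that by (simp add: u_def)
      have uA: "mapBA L (u b') = mapBA L' b'" if "b' \<in> obB L'" for b'
        using u[OF that] v[OF maps'(2)[OF that]] e_eq[OF that] by metis
      show "\<exists>!h. h \<in> ladder_hom L' L"
      proof (rule ex1I[of _ "(u, v)"])
        have "compose (obB L') (mapBA L) u = mapBA L'"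
          by (rule extensionalityI[OF compose_extensional ext'(1)]) (simp add: compose_eq uA)
        moreover have "compose (obB L') (mapBY L) u = mapBY L'"
          by (rule extensionalityI[OF compose_extensional ext'(2)]) (simp add: compose_eq u)
        moreover have "compose (obC L') (mapCZ L) v = mapCZ L'"
          by (rule extensionalityI[OF compose_extensional ext'(3)]) (simp add: compose_eq v)
        moreover have "compose (obB L') (mapBC L) u = compose (obB L') v (mapBC L')"
          by (rule extensionalityI[OF compose_extensional compose_extensional]) (simp add: compose_eq u)
        moreover have "u \<in> obB L' \<rightarrow>\<^sub>E obB L" "v \<in> obC L' \<rightarrow>\<^sub>E obC L"
          using u v by (auto simp: u_def v_def)
        ultimately show "(u, v) \<in> ladder_hom L' L" by (simp add: ladder_hom_def)
      next
        fix h assume "h \<in> ladder_hom L' L"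
        then obtain u2 v2 where h: "h = (u2, v2)" and hom2: "(u2, v2) \<in> ladder_hom L' L"
          by (metis surj_pair)
        have u2: "u2 \<in> obB L' \<rightarrow>\<^sub>E obB L" and v2: "v2 \<in> obC L' \<rightarrow>\<^sub>E obC L"
          using hom2 by (auto simp: ladder_hom_def)
        have eq2: "mapBA L (u2 b) = mapBA L' b" "mapBY L (u2 b) = mapBY L' b"
          "mapBC L (u2 b) = v2 (mapBC L' b)" if "b \<in> obB L'" for b
          using hom2 that unfolding ladder_hom_def by (auto simp: compose_eq dest!: fun_cong[where x = b])
        have eqZ: "mapCZ L (v2 c) = mapCZ L' c" if "c \<in> obC L'" for c
          using hom2 that unfolding ladder_hom_def by (auto simp: compose_eq dest!: fun_cong[where x = c])
        have vv: "v2 c = v c" if c: "c \<in> obC L'" for c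
        proof -
          have "mapBA L b = mapBA L' (e c (mapBY L b))" if b: "b \<in> obB L" "mapBC L b = v2 c" for b
          proof -
            have eb: "e c (mapBY L b) \<in> obB L' \<and> mapBC L' (e c (mapBY L b)) = c \<and>
                mapBY L' (e c (mapBY L b)) = mapBY L b"
              using e[OF c, of "mapBY L b"] maps b commR[OF b(1)] eqZ[OF c] by auto
            then have "u2 (e c (mapBY L b)) = b"
              using lift[of "v2 c" "mapBY L b"] b maps u2 eq2[of "e c (mapBY L b)"] v2 c
                commR[OF b(1)] by (metis PiE_mem)
            then show ?thesis using eq2 eb by metis
          qed
          then show ?thesis using ex_v[OF c] v[OF c] v2 c eqZ[OF c] by blast
        qed
        have "v2 = v"
          by (rule extensionalityI[of _ "obC L'"]) (use v2 vv in \<open>auto simp: v_def PiE_iff\<close>)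
        moreover have "u2 = u"
        proof (rule extensionalityI[of _ "obB L'"])
          show "u2 b = u b" if "b \<in> obB L'" for b
            using ex_u[OF that] u[OF that] eq2[OF that] u2 that vv[OF maps'(2)[OF that]]
            by (metis PiE_mem)
        qed (use u2 in \<open>auto simp: u_def PiE_iff\<close>)
        ultimately show "h = (u, v)" using h by simp
      qed
    qed
  qed
  with pre show ?thesis by (simp add: cromulent_def)
qed

section \<open>Diagrams indexed by intervals and levels\<close>

text \<open>The triple \<open>(i,j,k)\<close> stands for the interval \<open>{i..j}\<close> at level \<open>k\<close>.  A diagram is a family of sets \<open>X\<close>
with restriction maps \<open>r p q\<close>.  Unlike functors, diagrams may live on any type and are
unconstrained outside the index set; both freedoms are needed for the auxiliary diagrams below.\<close>

type_synonym idx = "nat \<times> nat \<times> nat"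

definition idx :: "nat \<Rightarrow> nat \<Rightarrow> idx set" where
  "idx m n = {(i,j,k). i \<le> j \<and> j \<le> m \<and> k \<le> n}"

fun idx_le :: "idx \<Rightarrow> idx \<Rightarrow> bool" (infix "\<sqsubseteq>" 50) where
  "(i,j,k) \<sqsubseteq> (i',j',l) \<longleftrightarrow> i \<le> i' \<and> j' \<le> j \<and> k \<le> l"

lemma idx_iff [simp]: "(i,j,k) \<in> idx m n \<longleftrightarrow> i \<le> j \<and> j \<le> m \<and> k \<le> n"
  by (simp add: idx_def)

lemma idx_le_refl [simp]: "p \<sqsubseteq> p"
  by (cases p) simp

lemma idx_le_trans: "p \<sqsubseteq> q \<Longrightarrow> q \<sqsubseteq> s \<Longrightarrow> p \<sqsubseteq> s"
  by (cases p; cases q; cases s) auto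

text \<open>The conditions of a cromulent functor in terms of elements: an element over \<open>[a,e]\<close> is a
matching pair of elements over \<open>[a,c]\<close> and \<open>[c,e]\<close>; an element over \<open>[i,j]\<close> at level \<open>k\<close> is its end
at \<open>j\<close> together with its image at level \<open>l\<close>; and \<open>X (j,j,k)\<close> is the dependent product, along the span
\<open>[i,j]\<close> at level \<open>l\<close>, of \<open>X (i,i,k)\<close>.  In the last condition \<open>s\<close> is a section over the elements of
\<open>X (i,j,l)\<close> that end at \<open>z\<close>, and \<open>c\<close> is its transpose.\<close>

definition glues :: "(idx \<Rightarrow> 'b set) \<Rightarrow> (idx \<Rightarrow> idx \<Rightarrow> 'b \<Rightarrow> 'b) \<Rightarrow> nat \<Rightarrow> nat \<Rightarrow> nat \<Rightarrow> nat \<Rightarrow> bool" where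
  "glues X r a c e k \<longleftrightarrow> (\<forall>x\<in>X (a,c,k). \<forall>y\<in>X (c,e,k).
     r (a,c,k) (c,c,k) x = r (c,e,k) (c,c,k) y \<longrightarrow>
     (\<exists>!z. z \<in> X (a,e,k) \<and> r (a,e,k) (a,c,k) z = x \<and> r (a,e,k) (c,e,k) z = y))"

definition lifts :: "(idx \<Rightarrow> 'b set) \<Rightarrow> (idx \<Rightarrow> idx \<Rightarrow> 'b \<Rightarrow> 'b) \<Rightarrow> nat \<Rightarrow> nat \<Rightarrow> nat \<Rightarrow> nat \<Rightarrow> bool" where
  "lifts X r i j k l \<longleftrightarrow> (\<forall>c\<in>X (j,j,k). \<forall>y\<in>X (i,j,l).
     r (j,j,k) (j,j,l) c = r (i,j,l) (j,j,l) y \<longrightarrow>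
     (\<exists>!x. x \<in> X (i,j,k) \<and> r (i,j,k) (j,j,k) x = c \<and> r (i,j,k) (i,j,l) x = y))"

definition transposes :: "(idx \<Rightarrow> 'b set) \<Rightarrow> (idx \<Rightarrow> idx \<Rightarrow> 'b \<Rightarrow> 'b) \<Rightarrow> nat \<Rightarrow> nat \<Rightarrow> nat \<Rightarrow> nat \<Rightarrow> bool" where
  "transposes X r i j k l \<longleftrightarrow> (\<forall>z\<in>X (j,j,l). \<forall>s.
     (\<forall>y\<in>X (i,j,l). r (i,j,l) (j,j,l) y = z \<longrightarrow>
        s y \<in> X (i,i,k) \<and> r (i,i,k) (i,i,l) (s y) = r (i,j,l) (i,i,l) y) \<longrightarrow>
     (\<exists>!c. c \<in> X (j,j,k) \<and> r (j,j,k) (j,j,l) c = z \<and>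
        (\<forall>x\<in>X (i,j,k). r (i,j,k) (j,j,k) x = c \<longrightarrow>
           r (i,j,k) (i,i,k) x = s (r (i,j,k) (i,j,l) x))))"

locale finset_diagram =
  fixes m n :: nat and X :: "idx \<Rightarrow> 'b set" and r :: "idx \<Rightarrow> idx \<Rightarrow> 'b \<Rightarrow> 'b"
  assumes fin: "p \<in> idx m n \<Longrightarrow> finite (X p)"
    and res: "p \<in> idx m n \<Longrightarrow> q \<in> idx m n \<Longrightarrow> p \<sqsubseteq> q \<Longrightarrow> x \<in> X p \<Longrightarrow> r p q x \<in> X q"
    and res_id: "p \<in> idx m n \<Longrightarrow> x \<in> X p \<Longrightarrow> r p p x = x"
    and res_res: "p \<in> idx m n \<Longrightarrow> q \<in> idx m n \<Longrightarrow> s \<in> idx m n \<Longrightarrow> p \<sqsubseteq> q \<Longrightarrow> q \<sqsubseteq> s \<Longrightarrow> x \<in> X p \<Longrightarrow>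
      r q s (r p q x) = r p s x"

locale crom_diagram = finset_diagram +
  assumes glue: "a \<le> c \<Longrightarrow> c \<le> e \<Longrightarrow> e \<le> m \<Longrightarrow> k \<le> n \<Longrightarrow> glues X r a c e k"
    and lift: "i \<le> j \<Longrightarrow> j \<le> m \<Longrightarrow> k \<le> l \<Longrightarrow> l \<le> n \<Longrightarrow> lifts X r i j k l"
    and transpose: "i \<le> j \<Longrightarrow> j \<le> m \<Longrightarrow> k \<le> l \<Longrightarrow> l \<le> n \<Longrightarrow> transposes X r i j k l"

lemma gluesD:
  assumes "glues X r a c e k" "x \<in> X (a,c,k)" "y \<in> X (c,e,k)"
    "r (a,c,k) (c,c,k) x = r (c,e,k) (c,c,k) y"
  shows "\<exists>!z. z \<in> X (a,e,k) \<and> r (a,e,k) (a,c,k) z = x \<and> r (a,e,k) (c,e,k) z = y"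
  using assms by (simp add: glues_def)

lemma liftsD:
  assumes "lifts X r i j k l" "c \<in> X (j,j,k)" "y \<in> X (i,j,l)"
    "r (j,j,k) (j,j,l) c = r (i,j,l) (j,j,l) y"
  shows "\<exists>!x. x \<in> X (i,j,k) \<and> r (i,j,k) (j,j,k) x = c \<and> r (i,j,k) (i,j,l) x = y"
  using assms by (simp add: lifts_def)

lemma transposesD:
  assumes "transposes X r i j k l" "z \<in> X (j,j,l)"
    "\<And>y. y \<in> X (i,j,l) \<Longrightarrow> r (i,j,l) (j,j,l) y = z \<Longrightarrow>
        s y \<in> X (i,i,k) \<and> r (i,i,k) (i,i,l) (s y) = r (i,j,l) (i,i,l) y"
  shows "\<exists>!c. c \<in> X (j,j,k) \<and> r (j,j,k) (j,j,l) c = z \<and>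
        (\<forall>x\<in>X (i,j,k). r (i,j,k) (j,j,k) x = c \<longrightarrow>
           r (i,j,k) (i,i,k) x = s (r (i,j,k) (i,j,l) x))"
  using assms unfolding transposes_def by blast

context finset_diagram
begin

lemma glues_eqI:
  assumes "glues X r a c e k" "a \<le> c" "c \<le> e" "e \<le> m" "k \<le> n" "z \<in> X (a,e,k)" "z' \<in> X (a,e,k)"
    "r (a,e,k) (a,c,k) z = r (a,e,k) (a,c,k) z'" "r (a,e,k) (c,e,k) z = r (a,e,k) (c,e,k) z'"
  shows "z = z'"
proof -
  have "r (a,c,k) (c,c,k) (r (a,e,k) (a,c,k) z') = r (c,e,k) (c,c,k) (r (a,e,k) (c,e,k) z')"
    using assms(2-7) by (simp add: res_res)
  moreover have "r (a,e,k) (a,c,k) z' \<in> X (a,c,k)" "r (a,e,k) (c,e,k) z' \<in> X (c,e,k)"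
    using assms(2-7) by (simp_all add: res)
  ultimately have "\<exists>!w. w \<in> X (a,e,k) \<and> r (a,e,k) (a,c,k) w = r (a,e,k) (a,c,k) z' \<and>
      r (a,e,k) (c,e,k) w = r (a,e,k) (c,e,k) z'"
    by (intro gluesD assms(1))
  then show ?thesis using assms(6-9) by blast
qed

lemma lifts_eqI:
  assumes "lifts X r i j k l" "i \<le> j" "j \<le> m" "k \<le> l" "l \<le> n" "x \<in> X (i,j,k)" "x' \<in> X (i,j,k)"
    "r (i,j,k) (j,j,k) x = r (i,j,k) (j,j,k) x'" "r (i,j,k) (i,j,l) x = r (i,j,k) (i,j,l) x'"
  shows "x = x'"
proof -
  have "r (j,j,k) (j,j,l) (r (i,j,k) (j,j,k) x') = r (i,j,l) (j,j,l) (r (i,j,k) (i,j,l) x')"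
    using assms(2-7) by (simp add: res_res)
  moreover have "r (i,j,k) (j,j,k) x' \<in> X (j,j,k)" "r (i,j,k) (i,j,l) x' \<in> X (i,j,l)"
    using assms(2-7) by (simp_all add: res)
  ultimately have "\<exists>!w. w \<in> X (i,j,k) \<and> r (i,j,k) (j,j,k) w = r (i,j,k) (j,j,k) x' \<and>
      r (i,j,k) (i,j,l) w = r (i,j,k) (i,j,l) x'"
    by (intro liftsD assms(1))
  then show ?thesis using assms(6-9) by blast
qed

end

section \<open>Cromulent functors as diagrams\<close>

fun to_shape :: "idx \<Rightarrow> nat set \<times> nat" where
  "to_shape (i,j,k) = ({i..j}, k)"

fun of_shape :: "nat set \<times> nat \<Rightarrow> idx" where
  "of_shape (I, k) = (Min I, Max I, k)"

lemma Min_Max_interval [simp]: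
  "i \<le> j \<Longrightarrow> Min {i..j} = i" "i \<le> j \<Longrightarrow> Max {i..j} = (j :: nat)"
  by (auto intro: Min_eqI Max_eqI)

lemma to_shape_of_shape [simp]: "p \<in> shape m n \<Longrightarrow> to_shape (of_shape p) = p"
  by (cases p) (auto simp: shape_def intervals_def)

lemma of_shape_to_shape [simp]: "p \<in> idx m n \<Longrightarrow> of_shape (to_shape p) = p"
  by (cases p) auto

lemma to_shape_in [simp]: "p \<in> idx m n \<Longrightarrow> to_shape p \<in> shape m n"
  by (cases p) (auto simp: shape_def intervals_def)

lemma of_shape_in [simp]: "p \<in> shape m n \<Longrightarrow> of_shape p \<in> idx m n"
  by (cases p) (auto simp: shape_def intervals_def)

lemma shape_le_to_shape: "p \<in> idx m n \<Longrightarrow> q \<in> idx m n \<Longrightarrow> shape_le (to_shape p) (to_shape q) \<longleftrightarrow> p \<sqsubseteq> q"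
  by (cases p; cases q) auto

lemma shape_le_of_shape: "p \<in> shape m n \<Longrightarrow> q \<in> shape m n \<Longrightarrow> of_shape p \<sqsubseteq> of_shape q \<longleftrightarrow> shape_le p q"
  by (metis of_shape_in shape_le_to_shape to_shape_of_shape)

definition obj :: "'a fin_diagram \<Rightarrow> idx \<Rightarrow> 'a set" where
  "obj F p = ob F (to_shape p)"

definition arr :: "'a fin_diagram \<Rightarrow> idx \<Rightarrow> idx \<Rightarrow> 'a \<Rightarrow> 'a" where
  "arr F p q = ar F (to_shape p) (to_shape q)"

definition diagram_of :: "nat \<Rightarrow> nat \<Rightarrow> (idx \<Rightarrow> 'a set) \<Rightarrow> (idx \<Rightarrow> idx \<Rightarrow> 'a \<Rightarrow> 'a) \<Rightarrow> 'a fin_diagram" where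
  "diagram_of m n X r =
     \<lparr>ob = (\<lambda>p. if p \<in> shape m n then X (of_shape p) else {}),
      ar = (\<lambda>p q. if p \<in> shape m n \<and> q \<in> shape m n \<and> shape_le p q
                  then restrict (r (of_shape p) (of_shape q)) (X (of_shape p)) else (\<lambda>_. undefined))\<rparr>"

lemma obj_diagram_of [simp]: "p \<in> idx m n \<Longrightarrow> obj (diagram_of m n X r) p = X p"
  by (simp add: obj_def diagram_of_def)

lemma arr_diagram_of [simp]:
  "p \<in> idx m n \<Longrightarrow> q \<in> idx m n \<Longrightarrow> p \<sqsubseteq> q \<Longrightarrow> arr (diagram_of m n X r) p q = restrict (r p q) (X p)"
  by (simp add: arr_def diagram_of_def shape_le_to_shape)

lemma is_functor_diagram:
  assumes "is_functor m n F" shows "finset_diagram m n (obj F) (arr F)"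
proof
  have F: "\<forall>p\<in>shape m n. finite (ob F p)"
     "\<forall>p\<in>shape m n. \<forall>q\<in>shape m n. shape_le p q \<longrightarrow> ar F p q \<in> ob F p \<rightarrow>\<^sub>E ob F q"
     "\<forall>p\<in>shape m n. ar F p p = (\<lambda>x\<in>ob F p. x)"
     "\<forall>p\<in>shape m n. \<forall>q\<in>shape m n. \<forall>r\<in>shape m n. shape_le p q \<longrightarrow> shape_le q r \<longrightarrow>
        ar F p r = compose (ob F p) (ar F q r) (ar F p q)"
    using assms unfolding is_functor_def by blast+
  fix p assume p: "p \<in> idx m n"
  show "finite (obj F p)" using F(1) p by (simp add: obj_def)
  show "arr F p p x = x" if "x \<in> obj F p" for x using F(3) p that by (simp add: obj_def arr_def)
  fix q assume q: "q \<in> idx m n" "p \<sqsubseteq> q"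
  fix x assume x: "x \<in> obj F p"
  have pq: "shape_le (to_shape p) (to_shape q)" using p q shape_le_to_shape by blast
  show "arr F p q x \<in> obj F q"
    using F(2)[rule_format, OF to_shape_in[OF p] to_shape_in[OF q(1)] pq] x by (auto simp: arr_def obj_def)
  fix s assume s: "s \<in> idx m n" "q \<sqsubseteq> s"
  have qs: "shape_le (to_shape q) (to_shape s)" using q s shape_le_to_shape by blast
  show "arr F q s (arr F p q x) = arr F p s x"
    using F(4)[rule_format, OF to_shape_in[OF p] to_shape_in[OF q(1)] to_shape_in[OF s(1)] pq qs] x
    by (simp add: arr_def obj_def compose_eq)
qed

lemma is_functor_arr:
  "is_functor m n F \<Longrightarrow> p \<in> idx m n \<Longrightarrow> q \<in> idx m n \<Longrightarrow> p \<sqsubseteq> q \<Longrightarrow> arr F p q \<in> obj F p \<rightarrow>\<^sub>E obj F q"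
  using shape_le_to_shape[of p m n q] to_shape_in[of p m n] to_shape_in[of q m n]
  unfolding is_functor_def arr_def obj_def by blast

lemma is_functor_diagram_of:
  assumes "finset_diagram m n X r" shows "is_functor m n (diagram_of m n X r)"
proof -
  interpret finset_diagram m n X r by fact
  let ?F = "diagram_of m n X r"
  have le: "of_shape p \<sqsubseteq> of_shape q" if "p \<in> shape m n" "q \<in> shape m n" "shape_le p q" for p q
    using that shape_le_of_shape by blast
  have trans: "shape_le p s" if "shape_le p q" "shape_le q s" for p q s
    using that by (cases p; cases q; cases s) auto
  have refl: "shape_le p p" for p by (cases p) auto
  show ?thesis unfolding is_functor_def
  proof (intro conjI ballI allI impI)
    fix p q s assume *: "p \<in> shape m n" "q \<in> shape m n" "s \<in> shape m n" "shape_le p q" "shape_le q s"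
    show "ar ?F p s = compose (ob ?F p) (ar ?F q s) (ar ?F p q)"
    proof
      fix x
      show "ar ?F p s x = compose (ob ?F p) (ar ?F q s) (ar ?F p q) x"
        using * trans[OF *(4,5)] le[OF *(1,2,4)] le[OF *(2,3,5)]
        by (simp add: diagram_of_def compose_def restrict_def res res_res)
    qed
  next
    fix p q assume *: "p \<in> shape m n" "q \<in> shape m n" "shape_le p q"
    show "ar ?F p q \<in> ob ?F p \<rightarrow>\<^sub>E ob ?F q"
      using * le[OF *] by (auto simp: diagram_of_def res)
  next
    fix p assume p: "p \<in> shape m n"
    show "ar ?F p p = (\<lambda>x\<in>ob ?F p. x)"
      using p res_id[OF of_shape_in[OF p]] by (auto simp: diagram_of_def refl restrict_def)
  next
    fix p assume p: "p \<in> shape m n"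
    show "finite (ob ?F p)"
      using p fin[OF of_shape_in[OF p]] by (simp add: diagram_of_def)
  qed (auto simp: diagram_of_def)
qed

lemma commutative_ladder_of:
  assumes F: "is_functor m n F" and ij: "i \<le> j" "j \<le> m" and kl: "k \<le> l" "l \<le> n"
  shows "commutative_ladder (ladder_of F i j k l)"
proof -
  interpret finset_diagram m n "obj F" "arr F" by (rule is_functor_diagram[OF F])
  have E: "arr F p q \<in> obj F p \<rightarrow>\<^sub>E obj F q" if "p \<in> idx m n" "q \<in> idx m n" "p \<sqsubseteq> q" for p q
    using is_functor_arr[OF F that] .
  have "obA (ladder_of F i j k l) = obj F (i,i,k)" "obB (ladder_of F i j k l) = obj F (i,j,k)"
    "obC (ladder_of F i j k l) = obj F (j,j,k)" "obX (ladder_of F i j k l) = obj F (i,i,l)"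
    "obY (ladder_of F i j k l) = obj F (i,j,l)" "obZ (ladder_of F i j k l) = obj F (j,j,l)"
    "mapBA (ladder_of F i j k l) = arr F (i,j,k) (i,i,k)"
    "mapBC (ladder_of F i j k l) = arr F (i,j,k) (j,j,k)"
    "mapYX (ladder_of F i j k l) = arr F (i,j,l) (i,i,l)"
    "mapYZ (ladder_of F i j k l) = arr F (i,j,l) (j,j,l)"
    "mapAX (ladder_of F i j k l) = arr F (i,i,k) (i,i,l)"
    "mapBY (ladder_of F i j k l) = arr F (i,j,k) (i,j,l)"
    "mapCZ (ladder_of F i j k l) = arr F (j,j,k) (j,j,l)"
    by (auto simp: ladder_of_def obj_def arr_def)
  note L = this
  show ?thesis unfolding commutative_ladder_def L
    by (intro conjI E fin) (use ij kl in \<open>auto simp: compose_def restrict_def res_res\<close>)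
qed

lemma cromulent_ladder_of_iff:
  assumes F: "is_functor m n F" and ij: "i \<le> j" "j \<le> m" and kl: "k \<le> l" "l \<le> n"
  shows "cromulent (ladder_of F i j k l) \<longleftrightarrow>
    lifts (obj F) (arr F) i j k l \<and> transposes (obj F) (arr F) i j k l"
  using commutative_ladder_of[OF assms]
  unfolding cromulent_iff precromulent_iff lifts_def transposes_def
  by (simp add: ladder_of_def obj_def arr_def)

text \<open>Glueing along a single vertex suffices: join \<open>x\<close> to the part of \<open>y\<close> over \<open>[b,d]\<close>.  The result restricts
to \<open>y\<close> on \<open>[c,d]\<close> because it does so on \<open>[c,b]\<close> and on \<open>[b,d]\<close>.\<close>

lemma overlap_pullback:
  assumes "crom_diagram m n X r" and abcd: "a \<le> c" "c \<le> b" "b \<le> d" "d \<le> m" and k: "k \<le> n"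
    and x: "x \<in> X (a,b,k)" and y: "y \<in> X (c,d,k)"
    and eq: "r (a,b,k) (c,b,k) x = r (c,d,k) (c,b,k) y"
  shows "\<exists>!z. z \<in> X (a,d,k) \<and> r (a,d,k) (a,b,k) z = x \<and> r (a,d,k) (c,d,k) z = y"
proof -
  interpret crom_diagram m n X r by fact
  let ?y = "r (c,d,k) (b,d,k) y"
  have "r (a,b,k) (b,b,k) x = r (c,b,k) (b,b,k) (r (a,b,k) (c,b,k) x)"
    using abcd k x by (simp add: res_res)
  then have "r (a,b,k) (b,b,k) x = r (b,d,k) (b,b,k) ?y"
    using abcd k x y by (simp add: eq res_res)
  then have ex: "\<exists>!z. z \<in> X (a,d,k) \<and> r (a,d,k) (a,b,k) z = x \<and> r (a,d,k) (b,d,k) z = ?y"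
    using abcd k x y by (intro gluesD glue) (simp_all add: res)
  then obtain z where z: "z \<in> X (a,d,k)" "r (a,d,k) (a,b,k) z = x" "r (a,d,k) (b,d,k) z = ?y"
    by blast
  have "r (a,d,k) (c,d,k) z = y"
  proof (rule glues_eqI[of c b d k])
    have "r (c,d,k) (c,b,k) (r (a,d,k) (c,d,k) z) = r (a,b,k) (c,b,k) (r (a,d,k) (a,b,k) z)"
      using abcd k z(1) by (simp add: res_res)
    then show "r (c,d,k) (c,b,k) (r (a,d,k) (c,d,k) z) = r (c,d,k) (c,b,k) y"
      using z eq by simp
    show "r (c,d,k) (b,d,k) (r (a,d,k) (c,d,k) z) = r (c,d,k) (b,d,k) y"
      using abcd k z by (simp add: res_res)
  qed (use abcd k z y in \<open>auto simp: res intro: glue\<close>)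
  moreover have "r (a,d,k) (b,d,k) z' = ?y" if "z' \<in> X (a,d,k)" "r (a,d,k) (c,d,k) z' = y" for z'
  proof -
    have "r (a,d,k) (b,d,k) z' = r (c,d,k) (b,d,k) (r (a,d,k) (c,d,k) z')"
      using abcd k that(1) by (simp add: res_res)
    then show ?thesis using that by simp
  qed
  ultimately show ?thesis using z ex by blast
qed

lemma interval_pullback:
  assumes "crom_diagram m n X r" and ab: "a \<le> b" "b \<le> m" and cd: "c \<le> d" "d \<le> m" and k: "k \<le> n"
    and meet: "max a c \<le> min b d"
    and x: "x \<in> X (a,b,k)" and y: "y \<in> X (c,d,k)"
    and eq: "r (a,b,k) (max a c, min b d, k) x = r (c,d,k) (max a c, min b d, k) y"
  shows "\<exists>!z. z \<in> X (min a c, max b d, k) \<and> r (min a c, max b d, k) (a,b,k) z = x \<and>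
    r (min a c, max b d, k) (c,d,k) z = y"
proof -
  interpret crom_diagram m n X r by fact
  consider "a \<le> c" "b \<le> d" | "c \<le> a" "d \<le> b" | "a \<le> c" "d \<le> b" | "c \<le> a" "b \<le> d" by linarith
  then show ?thesis
  proof cases
    case 1
    then have m: "min a c = a" "max b d = d" "max a c = c" "min b d = b" by auto
    show ?thesis
      unfolding m using overlap_pullback[OF assms(1) _ _ _ _ k x y eq[unfolded m]] 1 meet cd by auto
  next
    case 2
    then have m: "min a c = c" "max b d = b" "max a c = a" "min b d = d" by auto
    have "\<exists>!z. z \<in> X (c,b,k) \<and> r (c,b,k) (c,d,k) z = y \<and> r (c,b,k) (a,b,k) z = x"
      by (rule overlap_pullback[OF assms(1) _ _ _ _ k y x eq[unfolded m, symmetric]]) (use 2 meet ab in auto)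
    then show ?thesis unfolding m by blast
  next
    case 3
    then have m: "min a c = a" "max b d = b" "max a c = c" "min b d = d" by auto
    have "r (c,d,k) (c,d,k) y = y" "r (a,b,k) (a,b,k) z = z" if "z \<in> X (a,b,k)" for z
      using ab cd k y that by (simp_all add: res_id)
    then show ?thesis
      unfolding m using x eq[unfolded m] by (intro ex1I[of _ x]) (simp, metis)
  next
    case 4
    then have m: "min a c = c" "max b d = d" "max a c = a" "min b d = b" by auto
    have "r (a,b,k) (a,b,k) x = x" "r (c,d,k) (c,d,k) z = z" if "z \<in> X (c,d,k)" for z
      using ab cd k x that by (simp_all add: res_id)
    then show ?thesis
      unfolding m using y eq[unfolded m] by (intro ex1I[of _ y]) (simp, metis)
  qed
qed

lemma interval_operations:
  assumes "a \<le> b" "c \<le> d" "{a..b} \<inter> {c..d} \<noteq> {}"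
  shows "max a c \<le> min b d" "{a..b} \<inter> {c..d} = {max a c..min b d}"
    "{a..b} \<union> {c..d} = {min a c..max b d :: nat}"
  using assms by auto

text \<open>Intervals that meet are either nested, when the square is trivially a pullback, or overlap as in
the previous lemmas; so the pullback condition for all of them follows from \<open>glues\<close>.\<close>

lemma cromulent_functors_iff:
  "F \<in> cromulent_functors m n \<longleftrightarrow> is_functor m n F \<and> crom_diagram m n (obj F) (arr F)"
proof (cases "is_functor m n F")
  case False
  then show ?thesis by (simp add: cromulent_functors_def)
next
  case F: True
  interpret finset_diagram m n "obj F" "arr F" by (rule is_functor_diagram[OF F])
  define seg where "seg = (\<forall>k\<le>n. \<forall>I\<in>intervals m. \<forall>J\<in>intervals m. I \<inter> J \<noteq> {} \<longrightarrow>
        is_pullback (ob F (I \<union> J, k)) (ob F (I, k)) (ob F (J, k)) (ob F (I \<inter> J, k))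
          (ar F (I \<union> J, k) (I, k)) (ar F (I \<union> J, k) (J, k))
          (ar F (I, k) (I \<inter> J, k)) (ar F (J, k) (I \<inter> J, k)))"
  have pb: "is_pullback (ob F ({a..b} \<union> {c..d}, k)) (ob F ({a..b}, k)) (ob F ({c..d}, k)) (ob F ({a..b} \<inter> {c..d}, k))
          (ar F ({a..b} \<union> {c..d}, k) ({a..b}, k)) (ar F ({a..b} \<union> {c..d}, k) ({c..d}, k))
          (ar F ({a..b}, k) ({a..b} \<inter> {c..d}, k)) (ar F ({c..d}, k) ({a..b} \<inter> {c..d}, k)) \<longleftrightarrow>
     (\<forall>x\<in>obj F (a,b,k). \<forall>y\<in>obj F (c,d,k).
        arr F (a,b,k) (max a c, min b d, k) x = arr F (c,d,k) (max a c, min b d, k) y \<longrightarrow>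
        (\<exists>!z. z \<in> obj F (min a c, max b d, k) \<and> arr F (min a c, max b d, k) (a,b,k) z = x \<and>
              arr F (min a c, max b d, k) (c,d,k) z = y))"
    if *: "a \<le> b" "b \<le> m" "c \<le> d" "d \<le> m" "k \<le> n" "{a..b} \<inter> {c..d} \<noteq> {}" for a b c d k
  proof -
    note i = interval_operations[OF *(1,3,6)]
    have "ar F ({min a c..max b d}, k) ({a..b}, k) \<in> ob F ({min a c..max b d}, k) \<rightarrow> ob F ({a..b}, k)"
      "ar F ({min a c..max b d}, k) ({c..d}, k) \<in> ob F ({min a c..max b d}, k) \<rightarrow> ob F ({c..d}, k)"
      using res[of "(min a c, max b d, k)" "(a,b,k)"] res[of "(min a c, max b d, k)" "(c,d,k)"] *(1-5)
      by (simp_all add: obj_def arr_def Pi_I min.coboundedI1 min.coboundedI2 max.coboundedI1 max.coboundedI2)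
    moreover have "ar F ({a..b}, k) ({max a c..min b d}, k) (ar F ({min a c..max b d}, k) ({a..b}, k) x) =
       ar F ({c..d}, k) ({max a c..min b d}, k) (ar F ({min a c..max b d}, k) ({c..d}, k) x)"
      if "x \<in> ob F ({min a c..max b d}, k)" for x
      using res_res[of "(min a c, max b d, k)" "(a,b,k)" "(max a c, min b d, k)" x]
        res_res[of "(min a c, max b d, k)" "(c,d,k)" "(max a c, min b d, k)" x] *(1-5) i(1) that
      by (simp add: obj_def arr_def del: max.bounded_iff min.bounded_iff
          add: min.coboundedI1 min.coboundedI2 max.coboundedI1 max.coboundedI2)
    ultimately show ?thesis unfolding i(2,3)
      by (subst is_pullback_iff) (auto simp: obj_def arr_def)
  qed
  have crom: "cromulent (ladder_of F i j k l) \<longleftrightarrow>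
      lifts (obj F) (arr F) i j k l \<and> transposes (obj F) (arr F) i j k l"
    if "i \<le> j" "j \<le> m" "k \<le> l" "l \<le> n" for i j k l
    by (rule cromulent_ladder_of_iff[OF F that])
  have cromulents: "(\<forall>i j k l. i \<le> j \<longrightarrow> j \<le> m \<longrightarrow> k \<le> l \<longrightarrow> l \<le> n \<longrightarrow> cromulent (ladder_of F i j k l)) \<longleftrightarrow>
    (\<forall>i j k l. i \<le> j \<longrightarrow> j \<le> m \<longrightarrow> k \<le> l \<longrightarrow> l \<le> n \<longrightarrow>
       lifts (obj F) (arr F) i j k l \<and> transposes (obj F) (arr F) i j k l)"
    by (rule iff_allI)+ (rule imp_cong[OF refl], rule imp_cong[OF refl], rule imp_cong[OF refl],
        rule imp_cong[OF refl], rule crom; assumption)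
  have *: "F \<in> cromulent_functors m n \<longleftrightarrow> seg \<and>
    (\<forall>i j k l. i \<le> j \<longrightarrow> j \<le> m \<longrightarrow> k \<le> l \<longrightarrow> l \<le> n \<longrightarrow>
       lifts (obj F) (arr F) i j k l \<and> transposes (obj F) (arr F) i j k l)"
    unfolding cromulent_functors_def seg_def[symmetric] mem_Collect_eq cromulents by (simp only: F simp_thms)
  have **: "crom_diagram m n (obj F) (arr F) \<longleftrightarrow>
    (\<forall>a c e k. a \<le> c \<longrightarrow> c \<le> e \<longrightarrow> e \<le> m \<longrightarrow> k \<le> n \<longrightarrow> glues (obj F) (arr F) a c e k) \<and>
    (\<forall>i j k l. i \<le> j \<longrightarrow> j \<le> m \<longrightarrow> k \<le> l \<longrightarrow> l \<le> n \<longrightarrow>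
       lifts (obj F) (arr F) i j k l \<and> transposes (obj F) (arr F) i j k l)"
    (is "_ \<longleftrightarrow> ?glues \<and> ?ladders")
  proof (intro iffI conjI)
    assume "crom_diagram m n (obj F) (arr F)"
    then interpret crom_diagram m n "obj F" "arr F" .
    show ?glues ?ladders using glue lift transpose by auto
  next
    assume "?glues \<and> ?ladders"
    then show "crom_diagram m n (obj F) (arr F)"
      by (intro crom_diagram.intro crom_diagram_axioms.intro finset_diagram_axioms) auto
  qed
  have "glues (obj F) (arr F) a c e k" if "seg" "a \<le> c" "c \<le> e" "e \<le> m" "k \<le> n" for a c e k
  proof -
    have "{a..c} \<in> intervals m" "{c..e} \<in> intervals m" "{a..c} \<inter> {c..e} \<noteq> {}"
      using that by (auto simp: intervals_def)
    then have "is_pullback (ob F ({a..c} \<union> {c..e}, k)) (ob F ({a..c}, k)) (ob F ({c..e}, k)) (ob F ({a..c} \<inter> {c..e}, k))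
          (ar F ({a..c} \<union> {c..e}, k) ({a..c}, k)) (ar F ({a..c} \<union> {c..e}, k) ({c..e}, k))
          (ar F ({a..c}, k) ({a..c} \<inter> {c..e}, k)) (ar F ({c..e}, k) ({a..c} \<inter> {c..e}, k))"
      using that(1,5) unfolding seg_def by blast
    then have "\<forall>x\<in>obj F (a,c,k). \<forall>y\<in>obj F (c,e,k).
        arr F (a,c,k) (max a c, min c e, k) x = arr F (c,e,k) (max a c, min c e, k) y \<longrightarrow>
        (\<exists>!z. z \<in> obj F (min a c, max c e, k) \<and> arr F (min a c, max c e, k) (a,c,k) z = x \<and>
              arr F (min a c, max c e, k) (c,e,k) z = y)"
      using that by (subst (asm) pb) simp_all
    moreover have "max a c = c" "min c e = c" "min a c = a" "max c e = e" using that by auto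
    ultimately show ?thesis by (simp only: glues_def)
  qed
  moreover have seg if "crom_diagram m n (obj F) (arr F)"
    unfolding seg_def
  proof (intro allI impI ballI)
    fix k I J assume kIJ: "k \<le> n" "I \<in> intervals m" "J \<in> intervals m" "I \<inter> J \<noteq> {}"
    then obtain a b c d where IJ: "I = {a..b}" "J = {c..d}" and abcd: "a \<le> b" "b \<le> m" "c \<le> d" "d \<le> m"
      by (auto simp: intervals_def)
    have meet: "{a..b} \<inter> {c..d} \<noteq> {}" using kIJ IJ by simp
    show "is_pullback (ob F (I \<union> J, k)) (ob F (I, k)) (ob F (J, k)) (ob F (I \<inter> J, k))
          (ar F (I \<union> J, k) (I, k)) (ar F (I \<union> J, k) (J, k))
          (ar F (I, k) (I \<inter> J, k)) (ar F (J, k) (I \<inter> J, k))"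
      unfolding IJ pb[OF abcd kIJ(1) meet]
      using interval_pullback[OF that abcd kIJ(1) interval_operations(1)[OF abcd(1,3) meet]] by blast
  qed
  ultimately show ?thesis using F * ** by blast
qed

section \<open>The bisimplicial structure\<close>

fun reindex :: "(nat \<Rightarrow> nat) \<Rightarrow> (nat \<Rightarrow> nat) \<Rightarrow> idx \<Rightarrow> idx" where
  "reindex \<alpha> \<beta> (i,j,k) = (\<alpha> i, \<alpha> j, \<beta> k)"

lemma mono_mapsD:
  assumes "\<alpha> \<in> mono_maps m' m"
  shows "x \<le> m' \<Longrightarrow> \<alpha> x \<le> m" and "x \<le> y \<Longrightarrow> y \<le> m' \<Longrightarrow> \<alpha> x \<le> \<alpha> y"
    and "\<alpha> \<in> extensional {0..m'}"
  using assms by (auto simp: mono_maps_def PiE_iff mono_on_def)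

lemma mono_mapsI:
  assumes "\<And>x. x \<le> m' \<Longrightarrow> \<alpha> x \<le> m" "\<And>x y. x \<le> y \<Longrightarrow> y \<le> m' \<Longrightarrow> \<alpha> x \<le> \<alpha> y"
    "\<alpha> \<in> extensional {0..m'}"
  shows "\<alpha> \<in> mono_maps m' m"
  using assms by (auto simp: mono_maps_def PiE_iff mono_on_def)

lemma reindex_in:
  "\<alpha> \<in> mono_maps m' m \<Longrightarrow> \<beta> \<in> mono_maps n' n \<Longrightarrow> p \<in> idx m' n' \<Longrightarrow> reindex \<alpha> \<beta> p \<in> idx m n"
  by (cases p) (auto intro: mono_mapsD)

lemma reindex_le:
  "\<alpha> \<in> mono_maps m' m \<Longrightarrow> \<beta> \<in> mono_maps n' n \<Longrightarrow> p \<in> idx m' n' \<Longrightarrow> q \<in> idx m' n' \<Longrightarrow> p \<sqsubseteq> q \<Longrightarrow>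
   reindex \<alpha> \<beta> p \<sqsubseteq> reindex \<alpha> \<beta> q"
  by (cases p; cases q) (auto intro: mono_mapsD)

lemma shape_map_to_shape: "p \<in> idx m' n' \<Longrightarrow> shape_map \<alpha> \<beta> (to_shape p) = to_shape (reindex \<alpha> \<beta> p)"
  by (cases p) simp

lemma obj_precompose: "p \<in> idx m' n' \<Longrightarrow> obj (precompose m' n' \<alpha> \<beta> F) p = obj F (reindex \<alpha> \<beta> p)"
  using shape_map_to_shape[of p m' n' \<alpha> \<beta>] by (simp add: obj_def precompose_def)

lemma arr_precompose:
  "p \<in> idx m' n' \<Longrightarrow> q \<in> idx m' n' \<Longrightarrow> p \<sqsubseteq> q \<Longrightarrow>
   arr (precompose m' n' \<alpha> \<beta> F) p q = arr F (reindex \<alpha> \<beta> p) (reindex \<alpha> \<beta> q)"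
  using shape_map_to_shape[of p m' n' \<alpha> \<beta>] shape_map_to_shape[of q m' n' \<alpha> \<beta>]
  by (simp add: arr_def precompose_def shape_le_to_shape)

lemma is_functor_outside:
  assumes "is_functor m n F"
  shows "p \<notin> shape m n \<Longrightarrow> ob F p = {}"
    and "\<not> (p \<in> shape m n \<and> q \<in> shape m n \<and> shape_le p q) \<Longrightarrow> ar F p q = (\<lambda>_. undefined)"
proof -
  note * = assms[unfolded is_functor_def, THEN conjunct2, THEN conjunct2, THEN conjunct2, THEN conjunct2]
  show "p \<notin> shape m n \<Longrightarrow> ob F p = {}"
    by (rule *[THEN conjunct1, rule_format])
  show "\<not> (p \<in> shape m n \<and> q \<in> shape m n \<and> shape_le p q) \<Longrightarrow> ar F p q = (\<lambda>_. undefined)"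
    by (rule *[THEN conjunct2, THEN spec, THEN spec, THEN mp])
qed

lemma functor_eqI:
  assumes F: "is_functor m n F" and G: "is_functor m n G"
    and ob: "\<And>p. p \<in> idx m n \<Longrightarrow> obj F p = obj G p"
    and ar: "\<And>p q. p \<in> idx m n \<Longrightarrow> q \<in> idx m n \<Longrightarrow> p \<sqsubseteq> q \<Longrightarrow> arr F p q = arr G p q"
  shows "F = G"
proof (rule fin_diagram.equality)
  show "ob F = ob G"
  proof
    fix p show "ob F p = ob G p"
    proof (cases "p \<in> shape m n")
      case True
      then show ?thesis using ob[of "of_shape p"] by (simp add: obj_def)
    next
      case False
      then show ?thesis by (simp add: is_functor_outside[OF F] is_functor_outside[OF G])
    qed
  qed
  show "ar F = ar G"
  proof (intro ext)
    fix p q x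
    show "ar F p q x = ar G p q x"
    proof (cases "p \<in> shape m n \<and> q \<in> shape m n \<and> shape_le p q")
      case True
      then have pq: "p \<in> shape m n" "q \<in> shape m n" and le: "shape_le p q" by auto
      have "of_shape p \<sqsubseteq> of_shape q" using le shape_le_of_shape[OF pq] by simp
      from ar[OF of_shape_in[OF pq(1)] of_shape_in[OF pq(2)] this]
      have "ar F p q = ar G p q" by (simp add: arr_def to_shape_of_shape[OF pq(1)] to_shape_of_shape[OF pq(2)])
      then show ?thesis by simp
    next
      case False
      show ?thesis by (simp only: is_functor_outside(2)[OF F False] is_functor_outside(2)[OF G False])
    qed
  qed
qed simp

text \<open>The conditions on a diagram concern only its indices, so they are visibly stable under
\<open>reindex\<close>; the following description of \<open>precompose\<close> turns this into closure of the cromulent functors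
under simplicial operators.\<close>

lemma precompose_eq_diagram_of:
  assumes F: "is_functor m n F" and \<alpha>: "\<alpha> \<in> mono_maps m' m" and \<beta>: "\<beta> \<in> mono_maps n' n"
  shows "precompose m' n' \<alpha> \<beta> F =
    diagram_of m' n' (\<lambda>p. obj F (reindex \<alpha> \<beta> p)) (\<lambda>p q. arr F (reindex \<alpha> \<beta> p) (reindex \<alpha> \<beta> q))"
proof -
  have ar_eq: "ar F (shape_map \<alpha> \<beta> p) (shape_map \<alpha> \<beta> q) =
    restrict (arr F (reindex \<alpha> \<beta> (of_shape p)) (reindex \<alpha> \<beta> (of_shape q))) (obj F (reindex \<alpha> \<beta> (of_shape p)))"
    if "p \<in> shape m' n'" "q \<in> shape m' n'" "shape_le p q" for p q
  proof -
    have "reindex \<alpha> \<beta> (of_shape p) \<in> idx m n" "reindex \<alpha> \<beta> (of_shape q) \<in> idx m n"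
      "reindex \<alpha> \<beta> (of_shape p) \<sqsubseteq> reindex \<alpha> \<beta> (of_shape q)"
      using that shape_le_of_shape[of p m' n' q] by (auto intro: reindex_in[OF \<alpha> \<beta>] reindex_le[OF \<alpha> \<beta>])
    then have "arr F (reindex \<alpha> \<beta> (of_shape p)) (reindex \<alpha> \<beta> (of_shape q)) \<in>
        obj F (reindex \<alpha> \<beta> (of_shape p)) \<rightarrow>\<^sub>E obj F (reindex \<alpha> \<beta> (of_shape q))"
      by (rule is_functor_arr[OF F])
    then show ?thesis
      using that shape_map_to_shape[of "of_shape p" m' n' \<alpha> \<beta>] shape_map_to_shape[of "of_shape q" m' n' \<alpha> \<beta>]
      by (auto simp: arr_def obj_def PiE_iff extensional_restrict)
  qed
  have ob_eq: "ob F (shape_map \<alpha> \<beta> p) = obj F (reindex \<alpha> \<beta> (of_shape p))" if "p \<in> shape m' n'" for p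
    using that shape_map_to_shape[of "of_shape p" m' n' \<alpha> \<beta>] by (simp add: obj_def)
  have "(\<lambda>p. if p \<in> shape m' n' then ob F (shape_map \<alpha> \<beta> p) else {}) =
      (\<lambda>p. if p \<in> shape m' n' then obj F (reindex \<alpha> \<beta> (of_shape p)) else {})"
    by (rule ext) (simp add: ob_eq cong: if_cong)
  moreover have "(\<lambda>p q. if p \<in> shape m' n' \<and> q \<in> shape m' n' \<and> shape_le p q
        then ar F (shape_map \<alpha> \<beta> p) (shape_map \<alpha> \<beta> q) else (\<lambda>_. undefined)) =
      (\<lambda>p q. if p \<in> shape m' n' \<and> q \<in> shape m' n' \<and> shape_le p q
        then restrict (arr F (reindex \<alpha> \<beta> (of_shape p)) (reindex \<alpha> \<beta> (of_shape q))) (obj F (reindex \<alpha> \<beta> (of_shape p)))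
        else (\<lambda>_. undefined))"
    by (rule ext, rule ext) (simp add: ar_eq cong: if_cong)
  ultimately show ?thesis
    by (simp only: precompose_def diagram_of_def)
qed

lemma crom_diagram_reindex:
  assumes "crom_diagram m n X r" and \<alpha>: "\<alpha> \<in> mono_maps m' m" and \<beta>: "\<beta> \<in> mono_maps n' n"
  shows "crom_diagram m' n' (\<lambda>p. X (reindex \<alpha> \<beta> p)) (\<lambda>p q. r (reindex \<alpha> \<beta> p) (reindex \<alpha> \<beta> q))"
proof -
  interpret crom_diagram m n X r by fact
  note [simp] = reindex_in[OF \<alpha> \<beta>] reindex_le[OF \<alpha> \<beta>]
  show ?thesis
  proof
    fix a c e k assume "a \<le> c" "c \<le> e" "e \<le> m'" "k \<le> n'"
    then have "glues X r (\<alpha> a) (\<alpha> c) (\<alpha> e) (\<beta> k)"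
      by (intro glue) (auto intro: mono_mapsD[OF \<alpha>] mono_mapsD[OF \<beta>])
    then show "glues (\<lambda>p. X (reindex \<alpha> \<beta> p)) (\<lambda>p q. r (reindex \<alpha> \<beta> p) (reindex \<alpha> \<beta> q)) a c e k"
      by (simp add: glues_def)
  next
    fix i j k l assume "i \<le> j" "j \<le> m'" "k \<le> l" "l \<le> n'"
    then have "lifts X r (\<alpha> i) (\<alpha> j) (\<beta> k) (\<beta> l)" "transposes X r (\<alpha> i) (\<alpha> j) (\<beta> k) (\<beta> l)"
      by (intro lift transpose; auto intro: mono_mapsD[OF \<alpha>] mono_mapsD[OF \<beta>])+
    then show "lifts (\<lambda>p. X (reindex \<alpha> \<beta> p)) (\<lambda>p q. r (reindex \<alpha> \<beta> p) (reindex \<alpha> \<beta> q)) i j k l"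
      "transposes (\<lambda>p. X (reindex \<alpha> \<beta> p)) (\<lambda>p q. r (reindex \<alpha> \<beta> p) (reindex \<alpha> \<beta> q)) i j k l"
      by (simp_all add: lifts_def transposes_def)
  qed (auto simp: fin res res_id res_res)
qed

lemma crom_diagram_cong:
  assumes "crom_diagram m n X r" and X: "\<And>p. p \<in> idx m n \<Longrightarrow> X' p = X p"
    and r: "\<And>p q x. p \<in> idx m n \<Longrightarrow> q \<in> idx m n \<Longrightarrow> p \<sqsubseteq> q \<Longrightarrow> x \<in> X p \<Longrightarrow> r' p q x = r p q x"
  shows "crom_diagram m n X' r'"
proof -
  interpret crom_diagram m n X r by fact
  show ?thesis
  proof
    fix a c e k assume *: "a \<le> c" "c \<le> e" "e \<le> m" "k \<le> n"
    have "glues X r a c e k" by (rule glue[OF *])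
    then show "glues X' r' a c e k"
      using * by (simp add: glues_def X r cong: conj_cong)
  next
    fix i j k l assume *: "i \<le> j" "j \<le> m" "k \<le> l" "l \<le> n"
    have "lifts X r i j k l" "transposes X r i j k l"
      by (rule lift[OF *] transpose[OF *])+
    then show "lifts X' r' i j k l" "transposes X' r' i j k l"
      using * by (simp_all add: lifts_def transposes_def X r cong: conj_cong)
  next
    fix p q s x assume "p \<in> idx m n" "q \<in> idx m n" "s \<in> idx m n" "p \<sqsubseteq> q" "q \<sqsubseteq> s" "x \<in> X' p"
    then show "r' q s (r' p q x) = r' p s x"
      using res[of p q x] res_res[of p q s x] idx_le_trans[of p q s] by (simp add: X r)
  qed (simp_all add: X r fin res res_id)
qed

lemma diagram_of_cromulent:
  assumes "crom_diagram m n X r"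
  shows "diagram_of m n X r \<in> cromulent_functors m n"
  unfolding cromulent_functors_iff
proof
  interpret crom_diagram m n X r by fact
  show "is_functor m n (diagram_of m n X r)"
    by (rule is_functor_diagram_of) (rule finset_diagram_axioms)
  show "crom_diagram m n (obj (diagram_of m n X r)) (arr (diagram_of m n X r))"
    by (rule crom_diagram_cong[OF assms]) simp_all
qed

lemma precompose_cromulent:
  assumes "F \<in> cromulent_functors m n" "\<alpha> \<in> mono_maps m' m" "\<beta> \<in> mono_maps n' n"
  shows "precompose m' n' \<alpha> \<beta> F \<in> cromulent_functors m' n'"
proof -
  have F: "is_functor m n F" "crom_diagram m n (obj F) (arr F)"
    using assms(1) by (simp_all add: cromulent_functors_iff)
  show ?thesis
    unfolding precompose_eq_diagram_of[OF F(1) assms(2,3)]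
    by (intro diagram_of_cromulent crom_diagram_reindex[OF F(2) assms(2,3)])
qed

lemma compose_mono_maps:
  assumes "\<alpha>' \<in> mono_maps m'' m'" "\<alpha> \<in> mono_maps m' m"
  shows "compose {0..m''} \<alpha> \<alpha>' \<in> mono_maps m'' m"
  using assms by (intro mono_mapsI) (auto simp: compose_def intro: mono_mapsD)

lemma id_mono_maps: "(\<lambda>i\<in>{0..m}. i) \<in> mono_maps m m"
  by (rule mono_mapsI) auto

lemma bisimplicial_set_D_times_plus: "bisimplicial_set D_times_plus"
  unfolding bisimplicial_set_def D_times_plus_def bisset.simps
proof (intro conjI allI ballI)
  fix m n and F :: "'a fin_diagram" assume F: "F \<in> cromulent_functors m n"
  let ?G = "precompose m n (\<lambda>i\<in>{0..m}. i) (\<lambda>i\<in>{0..n}. i) F"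
  have id: "reindex (\<lambda>i\<in>{0..m}. i) (\<lambda>i\<in>{0..n}. i) p = p" if "p \<in> idx m n" for p
    using that by (cases p) simp
  have "?G \<in> cromulent_functors m n"
    by (rule precompose_cromulent[OF F id_mono_maps id_mono_maps])
  then show "?G = F"
    using F by (intro functor_eqI) (auto simp: cromulent_functors_iff obj_precompose arr_precompose id)
next
  fix m'' m' m n'' n' n \<alpha>' \<alpha> \<beta>' \<beta> and F :: "'a fin_diagram"
  assume \<alpha>: "\<alpha>' \<in> mono_maps m'' m'" "\<alpha> \<in> mono_maps m' m"
    and \<beta>: "\<beta>' \<in> mono_maps n'' n'" "\<beta> \<in> mono_maps n' n" and F: "F \<in> cromulent_functors m n"
  have reindex: "reindex (compose {0..m''} \<alpha> \<alpha>') (compose {0..n''} \<beta> \<beta>') p = reindex \<alpha> \<beta> (reindex \<alpha>' \<beta>' p)"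
    if "p \<in> idx m'' n''" for p
    using that by (cases p) (simp add: compose_eq)
  have "precompose m'' n'' (compose {0..m''} \<alpha> \<alpha>') (compose {0..n''} \<beta> \<beta>') F \<in> cromulent_functors m'' n''"
    "precompose m'' n'' \<alpha>' \<beta>' (precompose m' n' \<alpha> \<beta> F) \<in> cromulent_functors m'' n''"
    using F \<alpha> \<beta> by (auto intro!: precompose_cromulent compose_mono_maps)
  then have "is_functor m'' n'' (precompose m'' n'' (compose {0..m''} \<alpha> \<alpha>') (compose {0..n''} \<beta> \<beta>') F)"
    "is_functor m'' n'' (precompose m'' n'' \<alpha>' \<beta>' (precompose m' n' \<alpha> \<beta> F))"
    by (simp_all add: cromulent_functors_iff)
  then show "precompose m'' n'' (compose {0..m''} \<alpha> \<alpha>') (compose {0..n''} \<beta> \<beta>') F =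
      precompose m'' n'' \<alpha>' \<beta>' (precompose m' n' \<alpha> \<beta> F)"
  proof (rule functor_eqI)
    fix p assume p: "p \<in> idx m'' n''"
    note p' = reindex_in[OF \<alpha>(1) \<beta>(1) p]
    show "obj (precompose m'' n'' (compose {0..m''} \<alpha> \<alpha>') (compose {0..n''} \<beta> \<beta>') F) p =
        obj (precompose m'' n'' \<alpha>' \<beta>' (precompose m' n' \<alpha> \<beta> F)) p"
      by (simp only: obj_precompose[OF p] obj_precompose[OF p'] reindex[OF p])
    fix q assume q: "q \<in> idx m'' n''" "p \<sqsubseteq> q"
    note q' = reindex_in[OF \<alpha>(1) \<beta>(1) q(1)] reindex_le[OF \<alpha>(1) \<beta>(1) p q]
    show "arr (precompose m'' n'' (compose {0..m''} \<alpha> \<alpha>') (compose {0..n''} \<beta> \<beta>') F) p q =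
        arr (precompose m'' n'' \<alpha>' \<beta>' (precompose m' n' \<alpha> \<beta> F)) p q"
      by (simp only: arr_precompose[OF p q] arr_precompose[OF p' q'] reindex[OF p] reindex[OF q(1)])
  qed
qed (rule precompose_cromulent)

section \<open>Maps out of horns as partial diagrams\<close>

definition within :: "nat set \<Rightarrow> nat set \<Rightarrow> idx set" where
  "within A B = {(i,j,k). i \<in> A \<and> j \<in> A \<and> k \<in> B}"

lemma within_iff [simp]: "(i,j,k) \<in> within A B \<longleftrightarrow> i \<in> A \<and> j \<in> A \<and> k \<in> B"
  by (simp add: within_def)

text \<open>A bisimplex lies in the horn exactly when its first coordinate misses some vertex \<open>v \<noteq> b\<close> or
its second coordinate misses some \<open>w \<noteq> d\<close>.  Accordingly the horn is covered by the parts spanned by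
the vertex sets \<open>(A, B)\<close> listed here.\<close>

definition horn_cover :: "nat \<Rightarrow> nat \<Rightarrow> nat \<Rightarrow> nat \<Rightarrow> (nat set \<times> nat set) set" where
  "horn_cover m n b d =
     {({0..m} - {v}, {0..n}) | v. v \<le> m \<and> v \<noteq> b} \<union> {({0..m}, {0..n} - {w}) | w. w \<le> n \<and> w \<noteq> d}"

definition agrees_on :: "idx set \<Rightarrow> (idx \<Rightarrow> 'a set) \<Rightarrow> (idx \<Rightarrow> idx \<Rightarrow> 'a \<Rightarrow> 'a) \<Rightarrow> 'a fin_diagram \<Rightarrow> bool" where
  "agrees_on Q X r F \<longleftrightarrow> (\<forall>p\<in>Q. obj F p = X p) \<and> (\<forall>p\<in>Q. \<forall>q\<in>Q. p \<sqsubseteq> q \<longrightarrow> arr F p q = r p q)"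

text \<open>Here \<open>(X, r)\<close> is a diagram that is only meaningful on the parts of the horn, where it agrees with
cromulent functors.  These functors may differ from part to part away from the horn.\<close>

definition horn_fillable :: "'a itself \<Rightarrow> nat \<Rightarrow> nat \<Rightarrow> nat \<Rightarrow> nat \<Rightarrow> bool" where
  "horn_fillable _ m n b d \<longleftrightarrow> (\<forall>X (r :: idx \<Rightarrow> idx \<Rightarrow> 'a \<Rightarrow> 'a).
     (\<forall>(A, B)\<in>horn_cover m n b d. \<exists>F\<in>cromulent_functors m n. agrees_on (idx m n \<inter> within A B) X r F) \<longrightarrow>
     (\<exists>F\<in>cromulent_functors m n. \<forall>(A, B)\<in>horn_cover m n b d. agrees_on (idx m n \<inter> within A B) X r F))"

lemma horn_cover_iff:
  assumes "S \<subseteq> {0..m}" "T \<subseteq> {0..n}"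
  shows "(\<exists>(A, B)\<in>horn_cover m n b d. S \<subseteq> A \<and> T \<subseteq> B) \<longleftrightarrow>
    (\<exists>v\<le>m. v \<noteq> b \<and> v \<notin> S) \<or> (\<exists>w\<le>n. w \<noteq> d \<and> w \<notin> T)"
proof
  assume "\<exists>(A, B)\<in>horn_cover m n b d. S \<subseteq> A \<and> T \<subseteq> B"
  then show "(\<exists>v\<le>m. v \<noteq> b \<and> v \<notin> S) \<or> (\<exists>w\<le>n. w \<noteq> d \<and> w \<notin> T)"
    unfolding horn_cover_def by auto
next
  assume "(\<exists>v\<le>m. v \<noteq> b \<and> v \<notin> S) \<or> (\<exists>w\<le>n. w \<noteq> d \<and> w \<notin> T)"
  then show "\<exists>(A, B)\<in>horn_cover m n b d. S \<subseteq> A \<and> T \<subseteq> B"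
  proof (elim disjE exE conjE)
    fix v assume "v \<le> m" "v \<noteq> b" "v \<notin> S"
    then have "({0..m} - {v}, {0..n}) \<in> horn_cover m n b d" "S \<subseteq> {0..m} - {v}"
      using assms by (auto simp: horn_cover_def)
    then show ?thesis using assms(2) by blast
  next
    fix w assume "w \<le> n" "w \<noteq> d" "w \<notin> T"
    then have "({0..m}, {0..n} - {w}) \<in> horn_cover m n b d" "T \<subseteq> {0..n} - {w}"
      using assms by (auto simp: horn_cover_def)
    then show ?thesis using assms(1) by blast
  qed
qed

lemma in_BiHorn_iff:
  "(\<sigma>, \<tau>) \<in> bisimplices (BiHorn m n b d) p q \<longleftrightarrow>
     \<sigma> \<in> mono_maps p m \<and> \<tau> \<in> mono_maps q n \<and>
     (\<exists>(A, B)\<in>horn_cover m n b d. \<sigma> ` {0..p} \<subseteq> A \<and> \<tau> ` {0..q} \<subseteq> B)" (is "?L \<longleftrightarrow> ?R")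
proof -
  have "\<sigma> ` {0..p} \<subseteq> {0..m}" if "\<sigma> \<in> mono_maps p m" for \<sigma> p m
    using that by (auto simp: mono_maps_def PiE_iff)
  note im = this
  have "?L \<longleftrightarrow> \<sigma> \<in> mono_maps p m \<and> \<tau> \<in> mono_maps q n \<and>
    ((\<exists>v\<le>m. v \<noteq> b \<and> v \<notin> \<sigma> ` {0..p}) \<or> (\<exists>w\<le>n. w \<noteq> d \<and> w \<notin> \<tau> ` {0..q}))"
    by (auto simp: BiHorn_def box_def Horn_def Simplex_def face_simplices_def)
  then show ?thesis
    using horn_cover_iff[OF im im, of \<sigma> p m \<tau> q n b d] by (simp cong: conj_cong)
qed

lemma biact_BiHorn:
  "biact (BiHorn m n b d) p' p q' q \<alpha> \<beta> (\<sigma>, \<tau>) = (compose {0..p'} \<sigma> \<alpha>, compose {0..q'} \<tau> \<beta>)"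
  by (simp add: BiHorn_def box_def Simplex_def)

text \<open>An arrow of the shape, from \<open>[i,j]\<close> to \<open>[i',j']\<close>, involves at most four vertices in the first
direction and two in the second.  So the value of a functor on it can be read off from the
restriction to a bisimplex of bidegree \<open>(3, 1)\<close>, at the arrow from \<open>[0,3]\<close> to \<open>[1,2]\<close>.\<close>

definition quad :: "nat \<Rightarrow> nat \<Rightarrow> nat \<Rightarrow> nat \<Rightarrow> nat \<Rightarrow> nat" where
  "quad i i' j' j = (\<lambda>v\<in>{0..3}. if v = 0 then i else if v = 1 then i' else if v = 2 then j' else j)"

definition pair :: "nat \<Rightarrow> nat \<Rightarrow> nat \<Rightarrow> nat" where
  "pair k l = (\<lambda>v\<in>{0..1}. if v = 0 then k else l)"

lemma quad_mono: "i \<le> i' \<Longrightarrow> i' \<le> j' \<Longrightarrow> j' \<le> j \<Longrightarrow> j \<le> m \<Longrightarrow> quad i i' j' j \<in> mono_maps 3 m"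
  by (rule mono_mapsI) (auto simp: quad_def)

lemma pair_mono: "k \<le> l \<Longrightarrow> l \<le> n \<Longrightarrow> pair k l \<in> mono_maps 1 n"
  by (rule mono_mapsI) (auto simp: pair_def)

text \<open>A monotone retraction of \<open>[m]\<close> onto the complement of \<open>v\<close>: a neighbour of \<open>v\<close> takes its place.\<close>

definition collapse :: "nat \<Rightarrow> nat \<Rightarrow> nat \<Rightarrow> nat" where
  "collapse m v = (\<lambda>x\<in>{0..m}. if x = v then (if v = 0 then 1 else v - 1) else x)"

lemma collapse:
  assumes "v \<le> m" "b \<le> m" "v \<noteq> b"
  shows "collapse m v \<in> mono_maps m m" "collapse m v ` {0..m} \<subseteq> {0..m} - {v}"
    "x \<in> {0..m} - {v} \<Longrightarrow> collapse m v x = x"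
proof -
  show "collapse m v \<in> mono_maps m m"
    using assms by (intro mono_mapsI) (auto simp: collapse_def)
  show "collapse m v ` {0..m} \<subseteq> {0..m} - {v}" using assms by (auto simp: collapse_def)
  show "x \<in> {0..m} - {v} \<Longrightarrow> collapse m v x = x" by (auto simp: collapse_def)
qed

text \<open>Naturality of \<open>f\<close> makes the value read off at an arrow independent of the bisimplex of the horn in
which the arrow is found, so \<open>f\<close> amounts to a partial diagram \<open>(X, r)\<close>.  It agrees on the part \<open>(A, B)\<close>
with the value of \<open>f\<close> at the pair of retractions onto \<open>A\<close> and \<open>B\<close>, a bisimplex of the horn of full
bidegree.  By the Yoneda lemma a cromulent functor that extends \<open>(X, r)\<close> is an extension of \<open>f\<close>.\<close>

lemma all_maps_extend_if_horn_fillable: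
  assumes fill: "horn_fillable TYPE('a) m n b d" and b: "b \<le> m" and d: "d \<le> n"
  shows "all_maps_extend (BiHorn m n b d) (BiSimplex m n) (D_times_plus :: 'a fin_diagram bisset)"
  unfolding all_maps_extend_def
proof (intro allI impI)
  let ?D = "D_times_plus :: 'a fin_diagram bisset"
  fix f assume f: "bisset_map (BiHorn m n b d) ?D f"
  have f_in: "f p q x \<in> cromulent_functors p q" if "x \<in> bisimplices (BiHorn m n b d) p q" for p q x
    using f that by (auto simp: bisset_map_def D_times_plus_def)
  have f_nat: "f p' q' (compose {0..p'} \<sigma> \<alpha>, compose {0..q'} \<tau> \<beta>) = precompose p' q' \<alpha> \<beta> (f p q (\<sigma>, \<tau>))"
    if "(\<sigma>, \<tau>) \<in> bisimplices (BiHorn m n b d) p q" "\<alpha> \<in> mono_maps p' p" "\<beta> \<in> mono_maps q' q" for p q p' q' \<alpha> \<beta> \<sigma> \<tau>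
  proof -
    have "f p' q' (biact (BiHorn m n b d) p' p q' q \<alpha> \<beta> (\<sigma>, \<tau>)) = biact ?D p' p q' q \<alpha> \<beta> (f p q (\<sigma>, \<tau>))"
      using f that unfolding bisset_map_def by blast
    then show ?thesis by (simp add: biact_BiHorn D_times_plus_def)
  qed
  define r where "r = (\<lambda>(i,j,k) (i',j',l). arr (f 3 1 (quad i i' j' j, pair k l)) (0,3,0) (1,2,1))"
  define X where "X = (\<lambda>(i,j,k). obj (f 3 1 (quad i i j j, pair k k)) (0,3,0))"
  have local_eq: "obj (f p q (\<sigma>, \<tau>)) P = X (reindex \<sigma> \<tau> P)" "P \<sqsubseteq> Q \<Longrightarrow> arr (f p q (\<sigma>, \<tau>)) P Q = r (reindex \<sigma> \<tau> P) (reindex \<sigma> \<tau> Q)"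
    if st: "(\<sigma>, \<tau>) \<in> bisimplices (BiHorn m n b d) p q" and P: "P \<in> idx p q" and Q: "Q \<in> idx p q" for p q \<sigma> \<tau> P Q
  proof -
    obtain i j k i' j' l where PQ: "P = (i,j,k)" "Q = (i',j',l)" by (cases P; cases Q)
    have comp: "compose {0..3} \<sigma> (quad i i' j' j) = quad (\<sigma> i) (\<sigma> i') (\<sigma> j') (\<sigma> j)"
      "compose {0..1} \<tau> (pair k l) = pair (\<tau> k) (\<tau> l)" for i i' j' j k l
      by (auto simp: compose_def quad_def pair_def restrict_def)
    have nat: "f 3 1 (quad (\<sigma> i) (\<sigma> i') (\<sigma> j') (\<sigma> j), pair (\<tau> k) (\<tau> l)) =
        precompose 3 1 (quad i i' j' j) (pair k l) (f p q (\<sigma>, \<tau>))"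
      if "i \<le> i'" "i' \<le> j'" "j' \<le> j" "j \<le> p" "k \<le> l" "l \<le> q" for i i' j' j k l
      using f_nat[OF st quad_mono[OF that(1-4)] pair_mono[OF that(5,6)]] unfolding comp .
    have "X (reindex \<sigma> \<tau> P) = obj (precompose 3 1 (quad i i j j) (pair k k) (f p q (\<sigma>, \<tau>))) (0,3,0)"
      using P by (simp add: X_def PQ nat del: One_nat_def)
    then show "obj (f p q (\<sigma>, \<tau>)) P = X (reindex \<sigma> \<tau> P)"
      by (simp add: PQ obj_precompose quad_def pair_def)
    assume le: "P \<sqsubseteq> Q"
    have "r (reindex \<sigma> \<tau> P) (reindex \<sigma> \<tau> Q) =
        arr (precompose 3 1 (quad i i' j' j) (pair k l) (f p q (\<sigma>, \<tau>))) (0,3,0) (1,2,1)"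
      using P Q le by (simp add: r_def PQ nat del: One_nat_def)
    then show "arr (f p q (\<sigma>, \<tau>)) P Q = r (reindex \<sigma> \<tau> P) (reindex \<sigma> \<tau> Q)"
      by (simp add: PQ arr_precompose quad_def pair_def)
  qed
  have "\<exists>F\<in>cromulent_functors m n. agrees_on (idx m n \<inter> within A B) X r F" if AB: "(A, B) \<in> horn_cover m n b d" for A B
  proof -
    have "\<exists>\<sigma> \<tau>. \<sigma> \<in> mono_maps m m \<and> \<tau> \<in> mono_maps n n \<and> \<sigma> ` {0..m} \<subseteq> A \<and> \<tau> ` {0..n} \<subseteq> B \<and>
        (\<forall>x\<in>A. \<sigma> x = x) \<and> (\<forall>x\<in>B. \<tau> x = x)"
      using AB unfolding horn_cover_def
    proof (elim UnE CollectE exE conjE)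
      fix v assume v: "(A, B) = ({0..m} - {v}, {0..n})" "v \<le> m" "v \<noteq> b"
      show ?thesis
        by (rule exI[of _ "collapse m v"], rule exI[of _ "\<lambda>x\<in>{0..n}. x"])
          (use collapse[OF v(2) b v(3)] id_mono_maps v(1) in auto)
    next
      fix w assume w: "(A, B) = ({0..m}, {0..n} - {w})" "w \<le> n" "w \<noteq> d"
      show ?thesis
        by (rule exI[of _ "\<lambda>x\<in>{0..m}. x"], rule exI[of _ "collapse n w"])
          (use collapse[OF w(2) d w(3)] id_mono_maps w(1) in auto)
    qed
    then obtain \<sigma> \<tau> where st: "\<sigma> \<in> mono_maps m m" "\<tau> \<in> mono_maps n n" "\<sigma> ` {0..m} \<subseteq> A" "\<tau> ` {0..n} \<subseteq> B"
      and fix_A: "\<forall>x\<in>A. \<sigma> x = x" and fix_B: "\<forall>x\<in>B. \<tau> x = x" by blast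
    have horn: "(\<sigma>, \<tau>) \<in> bisimplices (BiHorn m n b d) m n"
      unfolding in_BiHorn_iff using st AB by blast
    have "reindex \<sigma> \<tau> p = p" if "p \<in> within A B" for p
      using that fix_A fix_B by (cases p) auto
    then have "agrees_on (idx m n \<inter> within A B) X r (f m n (\<sigma>, \<tau>))"
      unfolding agrees_on_def using local_eq[OF horn] by auto
    with f_in[OF horn] show ?thesis by blast
  qed
  with fill obtain F where F: "F \<in> cromulent_functors m n"
    and agree: "\<And>A B. (A, B) \<in> horn_cover m n b d \<Longrightarrow> agrees_on (idx m n \<inter> within A B) X r F"
    unfolding horn_fillable_def by (metis (no_types, lifting) case_prodI2 case_prodD)
  define g where "g = (\<lambda>p q (\<sigma>, \<tau>). precompose p q \<sigma> \<tau> F)"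
  have "bisset_map (BiSimplex m n) ?D g"
    unfolding bisset_map_def
  proof (intro conjI allI ballI)
    show "g p q \<in> bisimplices (BiSimplex m n) p q \<rightarrow> bisimplices ?D p q" for p q
      using precompose_cromulent[OF F] by (auto simp: g_def box_def Simplex_def D_times_plus_def)
  next
    fix p' p q' q \<alpha> \<beta> x
    assume \<alpha>: "\<alpha> \<in> mono_maps p' p" and \<beta>: "\<beta> \<in> mono_maps q' q" and x: "x \<in> bisimplices (BiSimplex m n) p q"
    obtain \<sigma> \<tau> where st: "x = (\<sigma>, \<tau>)" "\<sigma> \<in> mono_maps p m" "\<tau> \<in> mono_maps q n"
      using x by (auto simp: box_def Simplex_def)
    have "biact ?D p' m q' n (compose {0..p'} \<sigma> \<alpha>) (compose {0..q'} \<tau> \<beta>) F =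
        biact ?D p' p q' q \<alpha> \<beta> (biact ?D p m q n \<sigma> \<tau> F)"
    proof -
      have "F \<in> bisimplices ?D m n" using F by (simp add: D_times_plus_def)
      then show ?thesis
        using bisimplicial_set_D_times_plus \<alpha> \<beta> st(2,3) unfolding bisimplicial_set_def by blast
    qed
    then show "g p' q' (biact (BiSimplex m n) p' p q' q \<alpha> \<beta> x) = biact ?D p' p q' q \<alpha> \<beta> (g p q x)"
      by (simp add: st(1) g_def box_def Simplex_def D_times_plus_def)
  qed
  moreover have "g p q x = f p q x" if x: "x \<in> bisimplices (BiHorn m n b d) p q" for p q x
  proof -
    obtain \<sigma> \<tau> where st: "x = (\<sigma>, \<tau>)" by (cases x)
    have mono: "\<sigma> \<in> mono_maps p m" "\<tau> \<in> mono_maps q n"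
      and "\<exists>(A, B)\<in>horn_cover m n b d. \<sigma> ` {0..p} \<subseteq> A \<and> \<tau> ` {0..q} \<subseteq> B"
      using x unfolding st in_BiHorn_iff by simp_all
    then obtain A B where AB: "(A, B) \<in> horn_cover m n b d" "\<sigma> ` {0..p} \<subseteq> A" "\<tau> ` {0..q} \<subseteq> B"
      by blast
    have reindex: "reindex \<sigma> \<tau> P \<in> idx m n \<inter> within A B" if "P \<in> idx p q" for P
      using reindex_in[OF mono that] AB that by (cases P) (auto simp: image_subset_iff)
    have "is_functor p q (g p q x)" "is_functor p q (f p q x)"
      using precompose_cromulent[OF F mono] f_in[OF x] by (auto simp: g_def st cromulent_functors_iff)
    then show ?thesis
    proof (rule functor_eqI)
      fix P assume P: "P \<in> idx p q"
      show "obj (g p q x) P = obj (f p q x) P"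
        using agree[OF AB(1)] reindex[OF P] local_eq(1)[OF x[unfolded st] P P]
        by (simp add: g_def st obj_precompose P agrees_on_def)
      fix Q assume Q: "Q \<in> idx p q" "P \<sqsubseteq> Q"
      show "arr (g p q x) P Q = arr (f p q x) P Q"
        using agree[OF AB(1)] reindex[OF P] reindex[OF Q(1)] local_eq(2)[OF x[unfolded st] P Q] reindex_le[OF mono P Q]
        by (simp add: g_def st arr_precompose P Q agrees_on_def)
    qed
  qed
  ultimately show "\<exists>g. bisset_map (BiSimplex m n) ?D g \<and> (\<forall>p q. \<forall>x\<in>bisimplices (BiHorn m n b d) p q. g p q x = f p q x)"
    by blast
qed

section \<open>Transport along isomorphisms\<close>

lemma bij_betw_Ex1:
  assumes "bij_betw f A B"
  shows "(\<exists>!x. x \<in> A \<and> P (f x)) \<longleftrightarrow> (\<exists>!y. y \<in> B \<and> P y)"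
proof -
  have "B = f ` A" "\<And>x y. x \<in> A \<Longrightarrow> y \<in> A \<Longrightarrow> f x = f y \<Longrightarrow> x = y"
    using assms by (auto simp: bij_betw_def inj_on_def)
  then show ?thesis by (auto simp: Ex1_def)
qed

text \<open>Each of the three conditions involves only a few indices, so it can be transported along a natural
bijection that is defined just on a set \<open>Q\<close> of indices.\<close>

locale diagram_iso =
  fixes Q :: "idx set" and Y :: "idx \<Rightarrow> 'a set" and r :: "idx \<Rightarrow> idx \<Rightarrow> 'a \<Rightarrow> 'a"
    and G :: "idx \<Rightarrow> 'b set" and g :: "idx \<Rightarrow> idx \<Rightarrow> 'b \<Rightarrow> 'b" and \<kappa> :: "idx \<Rightarrow> 'a \<Rightarrow> 'b"
  assumes bij: "p \<in> Q \<Longrightarrow> bij_betw (\<kappa> p) (Y p) (G p)"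
    and r_in: "p \<in> Q \<Longrightarrow> q \<in> Q \<Longrightarrow> p \<sqsubseteq> q \<Longrightarrow> x \<in> Y p \<Longrightarrow> r p q x \<in> Y q"
    and nat: "p \<in> Q \<Longrightarrow> q \<in> Q \<Longrightarrow> p \<sqsubseteq> q \<Longrightarrow> x \<in> Y p \<Longrightarrow> \<kappa> q (r p q x) = g p q (\<kappa> p x)"
begin

lemma kappa_in: "p \<in> Q \<Longrightarrow> x \<in> Y p \<Longrightarrow> \<kappa> p x \<in> G p"
  using bij by (rule bij_betwE[rule_format])

lemma kappa_eq_iff: "p \<in> Q \<Longrightarrow> x \<in> Y p \<Longrightarrow> y \<in> Y p \<Longrightarrow> \<kappa> p x = \<kappa> p y \<longleftrightarrow> x = y"
  by (rule inj_on_eq_iff[OF bij_betw_imp_inj_on[OF bij]])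

lemma transfer:
  assumes p: "p \<in> Q" and ex: "\<exists>!y. y \<in> G p \<and> P y"
    and iff: "\<And>x. x \<in> Y p \<Longrightarrow> P (\<kappa> p x) \<longleftrightarrow> P' x"
  shows "\<exists>!x. x \<in> Y p \<and> P' x"
proof -
  have "\<exists>!x. x \<in> Y p \<and> P (\<kappa> p x)"
    by (rule iffD2[OF bij_betw_Ex1[OF bij[OF p]] ex])
  then show ?thesis by (simp only: iff cong: conj_cong)
qed

lemma glues_transfer:
  assumes G: "glues G g a c e k"
    and *: "a \<le> c" "c \<le> e" "(a,c,k) \<in> Q" "(c,e,k) \<in> Q" "(c,c,k) \<in> Q" "(a,e,k) \<in> Q"
  shows "glues Y r a c e k" unfolding glues_def
proof (intro ballI impI)
  fix x y assume xy: "x \<in> Y (a,c,k)" "y \<in> Y (c,e,k)"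
    and eq: "r (a,c,k) (c,c,k) x = r (c,e,k) (c,c,k) y"
  have "g (a,c,k) (c,c,k) (\<kappa> (a,c,k) x) = \<kappa> (c,c,k) (r (a,c,k) (c,c,k) x)"
    "g (c,e,k) (c,c,k) (\<kappa> (c,e,k) y) = \<kappa> (c,c,k) (r (c,e,k) (c,c,k) y)"
    using * xy by (simp_all add: nat)
  then have eq': "g (a,c,k) (c,c,k) (\<kappa> (a,c,k) x) = g (c,e,k) (c,c,k) (\<kappa> (c,e,k) y)"
    using eq by simp
  have "\<exists>!w. w \<in> G (a,e,k) \<and> g (a,e,k) (a,c,k) w = \<kappa> (a,c,k) x \<and> g (a,e,k) (c,e,k) w = \<kappa> (c,e,k) y"
    using * xy by (intro gluesD[OF G] eq') (simp_all add: kappa_in)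
  then show "\<exists>!z. z \<in> Y (a,e,k) \<and> r (a,e,k) (a,c,k) z = x \<and> r (a,e,k) (c,e,k) z = y"
    by (rule transfer[rotated]) (use * xy in \<open>simp_all add: nat[symmetric] kappa_eq_iff r_in\<close>)
qed

lemma lifts_transfer:
  assumes G: "lifts G g i j k l"
    and *: "i \<le> j" "k \<le> l" "(i,j,k) \<in> Q" "(j,j,k) \<in> Q" "(i,j,l) \<in> Q" "(j,j,l) \<in> Q"
  shows "lifts Y r i j k l" unfolding lifts_def
proof (intro ballI impI)
  fix c y assume cy: "c \<in> Y (j,j,k)" "y \<in> Y (i,j,l)"
    and eq: "r (j,j,k) (j,j,l) c = r (i,j,l) (j,j,l) y"
  have "g (j,j,k) (j,j,l) (\<kappa> (j,j,k) c) = \<kappa> (j,j,l) (r (j,j,k) (j,j,l) c)"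
    "g (i,j,l) (j,j,l) (\<kappa> (i,j,l) y) = \<kappa> (j,j,l) (r (i,j,l) (j,j,l) y)"
    using * cy by (simp_all add: nat)
  then have eq': "g (j,j,k) (j,j,l) (\<kappa> (j,j,k) c) = g (i,j,l) (j,j,l) (\<kappa> (i,j,l) y)"
    using eq by simp
  have "\<exists>!w. w \<in> G (i,j,k) \<and> g (i,j,k) (j,j,k) w = \<kappa> (j,j,k) c \<and> g (i,j,k) (i,j,l) w = \<kappa> (i,j,l) y"
    using * cy by (intro liftsD[OF G] eq') (simp_all add: kappa_in)
  then show "\<exists>!x. x \<in> Y (i,j,k) \<and> r (i,j,k) (j,j,k) x = c \<and> r (i,j,k) (i,j,l) x = y"
    by (rule transfer[rotated]) (use * cy in \<open>simp_all add: nat[symmetric] kappa_eq_iff r_in\<close>)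
qed

lemma transposes_transfer:
  assumes G: "transposes G g i j k l"
    and *: "i \<le> j" "k \<le> l" "(i,j,k) \<in> Q" "(i,i,k) \<in> Q" "(j,j,k) \<in> Q"
      "(i,j,l) \<in> Q" "(i,i,l) \<in> Q" "(j,j,l) \<in> Q"
    and square: "\<And>x. x \<in> G (i,j,k) \<Longrightarrow>
      g (i,j,l) (j,j,l) (g (i,j,k) (i,j,l) x) = g (j,j,k) (j,j,l) (g (i,j,k) (j,j,k) x)"
  shows "transposes Y r i j k l" unfolding transposes_def
proof (intro ballI allI impI)
  fix z s
  assume z: "z \<in> Y (j,j,l)" and s: "\<forall>y\<in>Y (i,j,l). r (i,j,l) (j,j,l) y = z \<longrightarrow>
    s y \<in> Y (i,i,k) \<and> r (i,i,k) (i,i,l) (s y) = r (i,j,l) (i,i,l) y"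
  have im: "G p = \<kappa> p ` Y p" if "p \<in> Q" for p
    using bij[OF that] by (simp add: bij_betw_def)
  let ?inv = "inv_into (Y (i,j,l)) (\<kappa> (i,j,l))"
  have inv: "?inv (\<kappa> (i,j,l) y) = y" if "y \<in> Y (i,j,l)" for y
    using bij[of "(i,j,l)"] * that by (simp add: bij_betw_def)
  have "\<exists>!c. c \<in> G (j,j,k) \<and> g (j,j,k) (j,j,l) c = \<kappa> (j,j,l) z \<and>
    (\<forall>x\<in>G (i,j,k). g (i,j,k) (j,j,k) x = c \<longrightarrow>
       g (i,j,k) (i,i,k) x = \<kappa> (i,i,k) (s (?inv (g (i,j,k) (i,j,l) x))))"
  proof (rule transposesD[OF G])
    show "\<kappa> (j,j,l) z \<in> G (j,j,l)" using * z by (simp add: kappa_in)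
    fix y assume "y \<in> G (i,j,l)" and yz: "g (i,j,l) (j,j,l) y = \<kappa> (j,j,l) z"
    then obtain y0 where y0: "y = \<kappa> (i,j,l) y0" "y0 \<in> Y (i,j,l)" using im[of "(i,j,l)"] * by auto
    then have "r (i,j,l) (j,j,l) y0 = z"
      using yz * z nat[of "(i,j,l)" "(j,j,l)" y0, symmetric] by (simp add: kappa_eq_iff r_in)
    then have sy: "s y0 \<in> Y (i,i,k)" "r (i,i,k) (i,i,l) (s y0) = r (i,j,l) (i,i,l) y0"
      using s y0 by auto
    have "g (i,i,k) (i,i,l) (\<kappa> (i,i,k) (s y0)) = \<kappa> (i,i,l) (r (i,i,k) (i,i,l) (s y0))"
      using sy(1) * by (simp add: nat)
    also have "\<dots> = g (i,j,l) (i,i,l) y" using * y0 unfolding sy(2) by (simp add: nat)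
    finally show "\<kappa> (i,i,k) (s (?inv y)) \<in> G (i,i,k) \<and>
        g (i,i,k) (i,i,l) (\<kappa> (i,i,k) (s (?inv y))) = g (i,j,l) (i,i,l) y"
      using sy(1) * y0 by (simp add: inv kappa_in)
  qed
  then show "\<exists>!c. c \<in> Y (j,j,k) \<and> r (j,j,k) (j,j,l) c = z \<and>
    (\<forall>x\<in>Y (i,j,k). r (i,j,k) (j,j,k) x = c \<longrightarrow> r (i,j,k) (i,i,k) x = s (r (i,j,k) (i,j,l) x))"
  proof (rule transfer[rotated])
    fix c assume c: "c \<in> Y (j,j,k)"
    have 1: "g (j,j,k) (j,j,l) (\<kappa> (j,j,k) c) = \<kappa> (j,j,l) z \<longleftrightarrow> r (j,j,k) (j,j,l) c = z"
      using * c z by (simp add: nat[symmetric] kappa_eq_iff r_in)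
    have 2: "(g (i,j,k) (j,j,k) (\<kappa> (i,j,k) x) = \<kappa> (j,j,k) c \<longrightarrow> g (i,j,k) (i,i,k) (\<kappa> (i,j,k) x) =
        \<kappa> (i,i,k) (s (?inv (g (i,j,k) (i,j,l) (\<kappa> (i,j,k) x))))) \<longleftrightarrow>
      (r (i,j,k) (j,j,k) x = c \<longrightarrow> r (i,j,k) (i,i,k) x = s (r (i,j,k) (i,j,l) x))"
      if zc: "r (j,j,k) (j,j,l) c = z" and x: "x \<in> Y (i,j,k)" for x
    proof (cases "r (i,j,k) (j,j,k) x = c")
      case False
      then show ?thesis using * x c by (simp add: nat[symmetric] kappa_eq_iff r_in)
    next
      case True
      have "\<kappa> (j,j,l) (r (i,j,l) (j,j,l) (r (i,j,k) (i,j,l) x)) =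
        \<kappa> (j,j,l) (r (j,j,k) (j,j,l) (r (i,j,k) (j,j,k) x))"
        using * x by (simp add: nat square kappa_in r_in)
      then have "r (i,j,l) (j,j,l) (r (i,j,k) (i,j,l) x) = z"
        using * x c z zc True by (simp add: kappa_eq_iff r_in)
      then have "s (r (i,j,k) (i,j,l) x) \<in> Y (i,i,k)" using s * x by (simp add: r_in)
      then show ?thesis using * x c by (simp add: nat[symmetric] kappa_eq_iff r_in inv)
    qed
    show "(g (j,j,k) (j,j,l) (\<kappa> (j,j,k) c) = \<kappa> (j,j,l) z \<and>
      (\<forall>x\<in>G (i,j,k). g (i,j,k) (j,j,k) x = \<kappa> (j,j,k) c \<longrightarrow>
         g (i,j,k) (i,i,k) x = \<kappa> (i,i,k) (s (?inv (g (i,j,k) (i,j,l) x))))) \<longleftrightarrow>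
      (r (j,j,k) (j,j,l) c = z \<and>
      (\<forall>x\<in>Y (i,j,k). r (i,j,k) (j,j,k) x = c \<longrightarrow> r (i,j,k) (i,i,k) x = s (r (i,j,k) (i,j,l) x)))"
      unfolding 1 using im[of "(i,j,k)"] * 2 by auto
  qed (use * in simp)
qed

end

lemma crom_diagram_iso:
  fixes Y :: "idx \<Rightarrow> 'a set" and G :: "idx \<Rightarrow> 'b set"
  assumes "crom_diagram m n G g" and "diagram_iso (idx m n) Y r G g \<kappa>"
  shows "crom_diagram m n Y r"
proof -
  interpret crom_diagram m n G g by fact
  interpret iso: diagram_iso "idx m n" Y r G g \<kappa> by fact
  show ?thesis
  proof
    fix p assume p: "p \<in> idx m n"
    show "finite (Y p)" using iso.bij[OF p] fin[OF p] bij_betw_finite by blast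
    fix x assume x: "x \<in> Y p"
    have "\<kappa> p (r p p x) = \<kappa> p x" using p x by (simp add: iso.nat res_id iso.kappa_in)
    then show "r p p x = x" using p x by (simp add: iso.kappa_eq_iff iso.r_in)
    fix q s assume *: "q \<in> idx m n" "s \<in> idx m n" "p \<sqsubseteq> q" "q \<sqsubseteq> s"
    have "\<kappa> s (r q s (r p q x)) = \<kappa> s (r p s x)"
      using p x * idx_le_trans[OF *(3,4)] by (simp add: iso.nat res_res iso.kappa_in iso.r_in)
    then show "r q s (r p q x) = r p s x"
      using p x * idx_le_trans[OF *(3,4)] by (simp add: iso.kappa_eq_iff iso.r_in)
  next
    fix a c e k assume *: "a \<le> c" "c \<le> e" "e \<le> m" "k \<le> n"
    then show "glues Y r a c e k" by (intro iso.glues_transfer glue) simp_all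
  next
    fix i j k l assume *: "i \<le> j" "j \<le> m" "k \<le> l" "l \<le> n"
    then show "lifts Y r i j k l" by (intro iso.lifts_transfer lift) simp_all
    show "transposes Y r i j k l"
      using * by (intro iso.transposes_transfer transpose) (simp_all add: res_res)
  qed (rule iso.r_in)
qed

text \<open>Suppose that a complete cromulent diagram \<open>G\<close>, on any type, is isomorphic to the partial diagram
wherever the latter is defined.  Transporting the structure of \<open>G\<close> to the sets \<open>X p\<close> turns the
isomorphism into an equality.  The remaining indices need a finite set of the right size in \<open>'a\<close>,
which exists because \<open>'a\<close> is infinite.\<close>

lemma extend_partial:
  fixes X :: "idx \<Rightarrow> 'a set" and G :: "idx \<Rightarrow> 'b set"
  assumes inf: "infinite (UNIV :: 'a set)" and G: "crom_diagram m n G g"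
    and Q_idx: "\<And>Q. Q \<in> \<Q> \<Longrightarrow> Q \<subseteq> idx m n"
    and local: "\<And>Q. Q \<in> \<Q> \<Longrightarrow> \<exists>F\<in>cromulent_functors m n. agrees_on Q X r F"
    and iso: "\<And>Q. Q \<in> \<Q> \<Longrightarrow> diagram_iso Q X r G g \<kappa>"
  shows "\<exists>F\<in>cromulent_functors m n. \<forall>Q\<in>\<Q>. agrees_on Q X r F"
proof -
  interpret crom_diagram m n G g by fact
  have "\<exists>Y \<kappa>'. bij_betw \<kappa>' Y (G p) \<and> (p \<in> \<Union>\<Q> \<longrightarrow> Y = X p \<and> \<kappa>' = \<kappa> p)" if p: "p \<in> idx m n" for p
  proof (cases "p \<in> \<Union>\<Q>")
    case True
    then show ?thesis using diagram_iso.bij[OF iso] by blast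
  next
    case False
    obtain Y :: "'a set" where "finite Y" "card Y = card (G p)"
      using infinite_arbitrarily_large[OF inf] by blast
    then obtain \<kappa>' where "bij_betw \<kappa>' Y (G p)" using fin[OF p] finite_same_card_bij by blast
    then show ?thesis using False by blast
  qed
  then obtain Y \<kappa>' where Y: "\<And>p. p \<in> idx m n \<Longrightarrow> bij_betw (\<kappa>' p) (Y p) (G p)"
    and YX: "\<And>p. p \<in> idx m n \<Longrightarrow> p \<in> \<Union>\<Q> \<Longrightarrow> Y p = X p \<and> \<kappa>' p = \<kappa> p"
    by metis
  define r' where "r' = (\<lambda>p q x. inv_into (Y q) (\<kappa>' q) (g p q (\<kappa>' p x)))"
  have r': "r' p q x \<in> Y q \<and> \<kappa>' q (r' p q x) = g p q (\<kappa>' p x)"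
    if "p \<in> idx m n" "q \<in> idx m n" "p \<sqsubseteq> q" "x \<in> Y p" for p q x
  proof -
    have "g p q (\<kappa>' p x) \<in> \<kappa>' q ` Y q"
      using that Y[OF that(1)] Y[OF that(2)] res[OF that(1-3)] by (auto simp: bij_betw_def)
    then show ?thesis by (simp add: r'_def inv_into_into f_inv_into_f)
  qed
  then have "diagram_iso (idx m n) Y r' G g \<kappa>'"
    using Y by (intro diagram_iso.intro) simp_all
  then have "crom_diagram m n Y r'" by (rule crom_diagram_iso[OF G])
  then have F: "diagram_of m n Y r' \<in> cromulent_functors m n" by (rule diagram_of_cromulent)
  moreover have "agrees_on Q X r (diagram_of m n Y r')" if Q: "Q \<in> \<Q>" for Q
    unfolding agrees_on_def
  proof (intro conjI ballI impI)
    fix p assume p: "p \<in> Q"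
    have p': "p \<in> idx m n" "Y p = X p" "\<kappa>' p = \<kappa> p" using Q_idx[OF Q] YX[of p] p Q by auto
    show "obj (diagram_of m n Y r') p = X p" using p' by simp
    fix q assume q: "q \<in> Q" and pq: "p \<sqsubseteq> q"
    have q': "q \<in> idx m n" "Y q = X q" "\<kappa>' q = \<kappa> q" using Q_idx[OF Q] YX[of q] q Q by auto
    obtain F where F: "F \<in> cromulent_functors m n" "agrees_on Q X r F" using local[OF Q] by blast
    then have "arr F p q \<in> obj F p \<rightarrow>\<^sub>E obj F q"
      using p' q' pq by (intro is_functor_arr) (auto simp: cromulent_functors_iff)
    then have r: "r p q \<in> X p \<rightarrow>\<^sub>E X q" using F(2) p q pq by (simp add: agrees_on_def)
    have "r' p q x = r p q x" if x: "x \<in> X p" for x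
    proof -
      have "\<kappa> q (r' p q x) = \<kappa> q (r p q x)" "r' p q x \<in> X q" "r p q x \<in> X q"
        using r'[OF p'(1) q'(1) pq, of x] diagram_iso.nat[OF iso[OF Q] p q pq x] p' q' x r by auto
      then show ?thesis using diagram_iso.kappa_eq_iff[OF iso[OF Q] q] by blast
    qed
    then show "arr (diagram_of m n Y r') p q = r p q"
      using p' q' pq r by (auto simp: PiE_iff intro!: extensionalityI[of _ "X p"])
  qed
  ultimately show ?thesis by blast
qed

definition locally_cromulent :: "nat \<Rightarrow> nat \<Rightarrow> (idx \<Rightarrow> 'a set) \<Rightarrow> (idx \<Rightarrow> idx \<Rightarrow> 'a \<Rightarrow> 'a) \<Rightarrow> nat set \<Rightarrow> nat set \<Rightarrow> bool" where
  "locally_cromulent m n X r A B \<longleftrightarrow>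
     (\<exists>F\<in>cromulent_functors m n. agrees_on (idx m n \<inter> within A B) X r F)"

lemma locally_cromulentE:
  assumes "locally_cromulent m n X r A B"
  obtains X' r' where "crom_diagram m n X' r'"
    "\<And>p. p \<in> idx m n \<Longrightarrow> p \<in> within A B \<Longrightarrow> X' p = X p"
    "\<And>p q. p \<in> idx m n \<Longrightarrow> q \<in> idx m n \<Longrightarrow> p \<in> within A B \<Longrightarrow> q \<in> within A B \<Longrightarrow> p \<sqsubseteq> q \<Longrightarrow> r' p q = r p q"
proof -
  obtain F where "F \<in> cromulent_functors m n" and agree: "agrees_on (idx m n \<inter> within A B) X r F"
    using assms unfolding locally_cromulent_def by blast
  then have "crom_diagram m n (obj F) (arr F)" by (simp add: cromulent_functors_iff)
  then show thesis using agree unfolding agrees_on_def by (intro that[of "obj F" "arr F"]) auto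
qed

lemma locally_cromulent:
  assumes "locally_cromulent m n X r A B"
  shows local_fin: "p \<in> idx m n \<Longrightarrow> p \<in> within A B \<Longrightarrow> finite (X p)"
    and local_res: "p \<in> idx m n \<Longrightarrow> q \<in> idx m n \<Longrightarrow> p \<in> within A B \<Longrightarrow> q \<in> within A B \<Longrightarrow>
      p \<sqsubseteq> q \<Longrightarrow> x \<in> X p \<Longrightarrow> r p q x \<in> X q"
    and local_id: "p \<in> idx m n \<Longrightarrow> p \<in> within A B \<Longrightarrow> x \<in> X p \<Longrightarrow> r p p x = x"
    and local_res_res: "p \<in> idx m n \<Longrightarrow> q \<in> idx m n \<Longrightarrow> s \<in> idx m n \<Longrightarrow>
      p \<in> within A B \<Longrightarrow> q \<in> within A B \<Longrightarrow> s \<in> within A B \<Longrightarrow> p \<sqsubseteq> q \<Longrightarrow> q \<sqsubseteq> s \<Longrightarrow> x \<in> X p \<Longrightarrow>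
      r q s (r p q x) = r p s x"
    and local_glue: "a \<le> c \<Longrightarrow> c \<le> e \<Longrightarrow> e \<le> m \<Longrightarrow> k \<le> n \<Longrightarrow> a \<in> A \<Longrightarrow> c \<in> A \<Longrightarrow> e \<in> A \<Longrightarrow> k \<in> B \<Longrightarrow>
      glues X r a c e k"
    and local_lift: "i \<le> j \<Longrightarrow> j \<le> m \<Longrightarrow> k \<le> l \<Longrightarrow> l \<le> n \<Longrightarrow> i \<in> A \<Longrightarrow> j \<in> A \<Longrightarrow> k \<in> B \<Longrightarrow> l \<in> B \<Longrightarrow>
      lifts X r i j k l"
    and local_transpose: "i \<le> j \<Longrightarrow> j \<le> m \<Longrightarrow> k \<le> l \<Longrightarrow> l \<le> n \<Longrightarrow> i \<in> A \<Longrightarrow> j \<in> A \<Longrightarrow> k \<in> B \<Longrightarrow> l \<in> B \<Longrightarrow>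
      transposes X r i j k l"
proof -
  obtain X' r' where "crom_diagram m n X' r'"
    and X: "\<And>p. p \<in> idx m n \<Longrightarrow> p \<in> within A B \<Longrightarrow> X' p = X p"
    and r: "\<And>p q. p \<in> idx m n \<Longrightarrow> q \<in> idx m n \<Longrightarrow> p \<in> within A B \<Longrightarrow> q \<in> within A B \<Longrightarrow> p \<sqsubseteq> q \<Longrightarrow> r' p q = r p q"
    using locally_cromulentE[OF assms] by blast
  interpret crom_diagram m n X' r' by fact
  show "p \<in> idx m n \<Longrightarrow> p \<in> within A B \<Longrightarrow> finite (X p)"
    using fin X by metis
  show "p \<in> idx m n \<Longrightarrow> q \<in> idx m n \<Longrightarrow> p \<in> within A B \<Longrightarrow> q \<in> within A B \<Longrightarrow>
      p \<sqsubseteq> q \<Longrightarrow> x \<in> X p \<Longrightarrow> r p q x \<in> X q"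
    using res X r by metis
  show "p \<in> idx m n \<Longrightarrow> p \<in> within A B \<Longrightarrow> x \<in> X p \<Longrightarrow> r p p x = x"
    using res_id[of p x] X[of p] r[of p p] by simp
  show "p \<in> idx m n \<Longrightarrow> q \<in> idx m n \<Longrightarrow> s \<in> idx m n \<Longrightarrow>
      p \<in> within A B \<Longrightarrow> q \<in> within A B \<Longrightarrow> s \<in> within A B \<Longrightarrow> p \<sqsubseteq> q \<Longrightarrow> q \<sqsubseteq> s \<Longrightarrow> x \<in> X p \<Longrightarrow>
      r q s (r p q x) = r p s x"
    using res_res[of p q s x] X[of p] r[of p q] r[of q s] r[of p s] idx_le_trans[of p q s] by simp
  show "glues X r a c e k" if *: "a \<le> c" "c \<le> e" "e \<le> m" "k \<le> n" and "a \<in> A" "c \<in> A" "e \<in> A" "k \<in> B"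
    using glue[OF *] that by (simp add: glues_def X r)
  show "lifts X r i j k l"
    if *: "i \<le> j" "j \<le> m" "k \<le> l" "l \<le> n" and "i \<in> A" "j \<in> A" "k \<in> B" "l \<in> B"
    using lift[OF *] that by (simp add: lifts_def X r)
  show "transposes X r i j k l"
    if *: "i \<le> j" "j \<le> m" "k \<le> l" "l \<le> n" and "i \<in> A" "j \<in> A" "k \<in> B" "l \<in> B"
    using transpose[OF *] that by (simp add: transposes_def X r)
qed

text \<open>The form in which the three kinds of horns are treated: construct a cromulent diagram \<open>G\<close> and one
family \<open>\<kappa>\<close> of bijections that is natural on every part of the horn.\<close>

lemma horn_fillableI:
  assumes inf: "infinite (UNIV :: 'a set)"
    and fill: "\<And>X (r :: idx \<Rightarrow> idx \<Rightarrow> 'a \<Rightarrow> 'a).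
      (\<And>A B. (A, B) \<in> horn_cover m n b d \<Longrightarrow> locally_cromulent m n X r A B) \<Longrightarrow>
      \<exists>(G :: idx \<Rightarrow> 'b set) g \<kappa>. crom_diagram m n G g \<and>
        (\<forall>A B. (A, B) \<in> horn_cover m n b d \<longrightarrow> diagram_iso (idx m n \<inter> within A B) X r G g \<kappa>)"
  shows "horn_fillable TYPE('a) m n b d"
  unfolding horn_fillable_def
proof (intro allI impI)
  fix X and r :: "idx \<Rightarrow> idx \<Rightarrow> 'a \<Rightarrow> 'a"
  assume loc: "\<forall>(A, B)\<in>horn_cover m n b d. \<exists>F\<in>cromulent_functors m n. agrees_on (idx m n \<inter> within A B) X r F"
  then have "locally_cromulent m n X r A B" if "(A, B) \<in> horn_cover m n b d" for A B
    using that by (auto simp: locally_cromulent_def)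
  from fill[OF this] obtain G :: "idx \<Rightarrow> 'b set" and g \<kappa> where G: "crom_diagram m n G g"
    and iso: "\<And>A B. (A, B) \<in> horn_cover m n b d \<Longrightarrow> diagram_iso (idx m n \<inter> within A B) X r G g \<kappa>"
    by blast
  let ?Q = "(\<lambda>(A, B). idx m n \<inter> within A B) ` horn_cover m n b d"
  have "\<exists>F\<in>cromulent_functors m n. \<forall>Q\<in>?Q. agrees_on Q X r F"
  proof (rule extend_partial[OF inf G])
    fix Q assume "Q \<in> ?Q"
    then obtain A B where AB: "(A, B) \<in> horn_cover m n b d" "Q = idx m n \<inter> within A B" by auto
    show "Q \<subseteq> idx m n" using AB by simp
    show "\<exists>F\<in>cromulent_functors m n. agrees_on Q X r F" using loc AB by blast
    show "diagram_iso Q X r G g \<kappa>" using iso AB by simp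
  qed
  then show "\<exists>F\<in>cromulent_functors m n. \<forall>(A, B)\<in>horn_cover m n b d. agrees_on (idx m n \<inter> within A B) X r F"
    by fastforce
qed

section \<open>Pasting cromulent squares\<close>

text \<open>Cromulent squares compose in both directions.  For dependent products this says that a product over
a composite is an iterated product, and that a product of products along two consecutive spans is
a product along their composite.\<close>

context finset_diagram
begin

lemma lifts_vertical_paste:
  assumes ij: "i \<le> j" "j \<le> m" and kl: "k \<le> d" "d \<le> l" "l \<le> n"
    and L1: "lifts X r i j k d" and L2: "lifts X r i j d l"
  shows "lifts X r i j k l"
  unfolding lifts_def
proof (intro ballI impI)
  fix c y assume c: "c \<in> X (j,j,k)" and y: "y \<in> X (i,j,l)"
    and eq: "r (j,j,k) (j,j,l) c = r (i,j,l) (j,j,l) y"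
  have sq: "r (i,j,d) (j,j,d) (r (i,j,k) (i,j,d) x) = r (j,j,k) (j,j,d) (r (i,j,k) (j,j,k) x)"
    and vv: "r (i,j,d) (i,j,l) (r (i,j,k) (i,j,d) x) = r (i,j,k) (i,j,l) x"
    and inn: "r (i,j,k) (i,j,d) x \<in> X (i,j,d)"
    if "x \<in> X (i,j,k)" for x
    using ij kl that by (simp_all add: res_res res)
  have c': "r (j,j,k) (j,j,d) c \<in> X (j,j,d)" using ij kl c by (simp add: res)
  have "r (j,j,d) (j,j,l) (r (j,j,k) (j,j,d) c) = r (i,j,l) (j,j,l) y"
    using ij kl c eq by (simp add: res_res)
  from liftsD[OF L2 c' y this] obtain e1 where e1: "e1 \<in> X (i,j,d)"
    "r (i,j,d) (j,j,d) e1 = r (j,j,k) (j,j,d) c" "r (i,j,d) (i,j,l) e1 = y" by blast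
  from liftsD[OF L1 c e1(1) e1(2)[symmetric]] obtain e where e: "e \<in> X (i,j,k)"
    "r (i,j,k) (j,j,k) e = c" "r (i,j,k) (i,j,d) e = e1" by blast
  show "\<exists>!x. x \<in> X (i,j,k) \<and> r (i,j,k) (j,j,k) x = c \<and> r (i,j,k) (i,j,l) x = y"
  proof (rule ex1I[of _ e])
    show "e \<in> X (i,j,k) \<and> r (i,j,k) (j,j,k) e = c \<and> r (i,j,k) (i,j,l) e = y"
      using e e1 vv[OF e(1)] by simp
  next
    fix x assume x: "x \<in> X (i,j,k) \<and> r (i,j,k) (j,j,k) x = c \<and> r (i,j,k) (i,j,l) x = y"
    then have xX: "x \<in> X (i,j,k)" by simp
    have "r (i,j,k) (i,j,d) x = e1"
      by (rule lifts_eqI[OF L2]) (use ij kl e1 sq[OF xX] vv[OF xX] inn[OF xX] x in simp_all)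
    then show "x = e" by - (rule lifts_eqI[OF L1], use ij kl e x in simp_all)
  qed
qed

text \<open>Transpose twice: push the section \<open>s\<close> down to level \<open>d\<close> and transpose it to \<open>c1\<close>; over \<open>c1\<close>, the
section \<open>s\<close> itself is a section at level \<open>k\<close>, and its transpose is \<open>c\<close>.\<close>

lemma transposes_vertical_paste:
  assumes ij: "i \<le> j" "j \<le> m" and kl: "k \<le> d" "d \<le> l" "l \<le> n"
    and L1: "lifts X r i j k d" and T1: "transposes X r i j k d" and T2: "transposes X r i j d l"
  shows "transposes X r i j k l"
  unfolding transposes_def
proof (intro ballI allI impI)
  fix z s assume z: "z \<in> X (j,j,l)" and s: "\<forall>y\<in>X (i,j,l). r (i,j,l) (j,j,l) y = z \<longrightarrow>
    s y \<in> X (i,i,k) \<and> r (i,i,k) (i,i,l) (s y) = r (i,j,l) (i,i,l) y"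
  have ex1: "\<exists>!c. c \<in> X (j,j,d) \<and> r (j,j,d) (j,j,l) c = z \<and>
        (\<forall>x\<in>X (i,j,d). r (i,j,d) (j,j,d) x = c \<longrightarrow>
           r (i,j,d) (i,i,d) x = r (i,i,k) (i,i,d) (s (r (i,j,d) (i,j,l) x)))"
    (is "\<exists>!c. ?P1 c")
  proof (rule transposesD[OF T2 z])
    fix y assume "y \<in> X (i,j,l)" "r (i,j,l) (j,j,l) y = z"
    then have "s y \<in> X (i,i,k)" "r (i,i,k) (i,i,l) (s y) = r (i,j,l) (i,i,l) y" using s by auto
    then show "r (i,i,k) (i,i,d) (s y) \<in> X (i,i,d) \<and>
        r (i,i,d) (i,i,l) (r (i,i,k) (i,i,d) (s y)) = r (i,j,l) (i,i,l) y"
      using ij kl by (simp add: res res_res)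
  qed
  then obtain c1 where c1: "?P1 c1" by blast
  have ex2: "\<exists>!c. c \<in> X (j,j,k) \<and> r (j,j,k) (j,j,d) c = c1 \<and>
        (\<forall>x\<in>X (i,j,k). r (i,j,k) (j,j,k) x = c \<longrightarrow>
           r (i,j,k) (i,i,k) x = s (r (i,j,d) (i,j,l) (r (i,j,k) (i,j,d) x)))"
    (is "\<exists>!c. ?P2 c")
  proof (rule transposesD[OF T1])
    show "c1 \<in> X (j,j,d)" using c1 by blast
    fix e assume e: "e \<in> X (i,j,d)" "r (i,j,d) (j,j,d) e = c1"
    have "r (i,j,l) (j,j,l) (r (i,j,d) (i,j,l) e) = r (j,j,d) (j,j,l) (r (i,j,d) (j,j,d) e)"
      using ij kl e(1) by (simp add: res_res)
    then have "r (i,j,l) (j,j,l) (r (i,j,d) (i,j,l) e) = z" using e c1 by simp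
    then have "s (r (i,j,d) (i,j,l) e) \<in> X (i,i,k)" using s ij kl e(1) by (simp add: res)
    then show "s (r (i,j,d) (i,j,l) e) \<in> X (i,i,k) \<and>
        r (i,i,k) (i,i,d) (s (r (i,j,d) (i,j,l) e)) = r (i,j,d) (i,i,d) e"
      using c1 e by simp
  qed
  then obtain c where c: "?P2 c" by blast
  have vv: "r (i,j,d) (i,j,l) (r (i,j,k) (i,j,d) x) = r (i,j,k) (i,j,l) x"
    "r (i,j,k) (i,j,d) x \<in> X (i,j,d)"
    "r (i,j,d) (j,j,d) (r (i,j,k) (i,j,d) x) = r (j,j,k) (j,j,d) (r (i,j,k) (j,j,k) x)"
    "r (i,j,d) (i,i,d) (r (i,j,k) (i,j,d) x) = r (i,i,k) (i,i,d) (r (i,j,k) (i,i,k) x)"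
    if "x \<in> X (i,j,k)" for x
    using ij kl that by (simp_all add: res_res res)
  show "\<exists>!c. c \<in> X (j,j,k) \<and> r (j,j,k) (j,j,l) c = z \<and>
        (\<forall>x\<in>X (i,j,k). r (i,j,k) (j,j,k) x = c \<longrightarrow> r (i,j,k) (i,i,k) x = s (r (i,j,k) (i,j,l) x))"
  proof (rule ex1I[of _ c])
    have "r (j,j,k) (j,j,l) c = r (j,j,d) (j,j,l) (r (j,j,k) (j,j,d) c)"
      using ij kl conjunct1[OF c] by (simp add: res_res)
    then show "c \<in> X (j,j,k) \<and> r (j,j,k) (j,j,l) c = z \<and>
        (\<forall>x\<in>X (i,j,k). r (i,j,k) (j,j,k) x = c \<longrightarrow> r (i,j,k) (i,i,k) x = s (r (i,j,k) (i,j,l) x))"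
      using c c1 vv(1) by simp
  next
    fix c' assume c': "c' \<in> X (j,j,k) \<and> r (j,j,k) (j,j,l) c' = z \<and>
        (\<forall>x\<in>X (i,j,k). r (i,j,k) (j,j,k) x = c' \<longrightarrow> r (i,j,k) (i,i,k) x = s (r (i,j,k) (i,j,l) x))"
    let ?c1 = "r (j,j,k) (j,j,d) c'"
    have c'X: "?c1 \<in> X (j,j,d)" "r (j,j,d) (j,j,l) ?c1 = z"
      using ij kl c' by (simp_all add: res res_res)
    have "r (i,j,d) (i,i,d) e = r (i,i,k) (i,i,d) (s (r (i,j,d) (i,j,l) e))"
      if e: "e \<in> X (i,j,d)" "r (i,j,d) (j,j,d) e = ?c1" for e
    proof -
      obtain x where x: "x \<in> X (i,j,k)" "r (i,j,k) (j,j,k) x = c'" "r (i,j,k) (i,j,d) x = e"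
        using liftsD[OF L1 conjunct1[OF c'] e(1) e(2)[symmetric]] by blast
      then have "r (i,j,k) (i,i,k) x = s (r (i,j,d) (i,j,l) e)" using c' vv(1)[OF x(1)] by simp
      then show ?thesis using vv(4)[OF x(1)] x(3) by simp
    qed
    with c'X have "?P1 ?c1" by blast
    with ex1 c1 have "?c1 = c1" by blast
    then have "?P2 c'" using c' vv(1) by simp
    with ex2 c show "c' = c" by blast
  qed
qed

text \<open>If glueing at \<open>b\<close> is possible, then glueing at \<open>c\<close> reduces to one side of \<open>b\<close>: move the part of \<open>y\<close>
over \<open>[c,b]\<close> to \<open>x\<close> first, and glue the rest at \<open>b\<close>.\<close>

lemma glues_paste_left:
  assumes le: "a \<le> c" "c \<le> b" "b \<le> e" "e \<le> m" and k: "k \<le> n"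
    and G1: "glues X r a c b k" and G2: "glues X r a b e k" and G3: "glues X r c b e k"
  shows "glues X r a c e k"
  unfolding glues_def
proof (intro ballI impI)
  fix x y assume x: "x \<in> X (a,c,k)" and y: "y \<in> X (c,e,k)"
    and eq: "r (a,c,k) (c,c,k) x = r (c,e,k) (c,c,k) y"
  have y1: "r (c,e,k) (c,b,k) y \<in> X (c,b,k)" and y2: "r (c,e,k) (b,e,k) y \<in> X (b,e,k)"
    using le k y by (simp_all add: res)
  have "r (a,c,k) (c,c,k) x = r (c,b,k) (c,c,k) (r (c,e,k) (c,b,k) y)"
    using le k y eq by (simp add: res_res)
  from gluesD[OF G1 x y1 this] obtain z1 where z1: "z1 \<in> X (a,b,k)"
    "r (a,b,k) (a,c,k) z1 = x" "r (a,b,k) (c,b,k) z1 = r (c,e,k) (c,b,k) y" by blast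
  have "r (a,b,k) (b,b,k) z1 = r (c,b,k) (b,b,k) (r (a,b,k) (c,b,k) z1)"
    using le k z1(1) by (simp add: res_res)
  also have "\<dots> = r (b,e,k) (b,b,k) (r (c,e,k) (b,e,k) y)"
    using le k y unfolding z1(3) by (simp add: res_res)
  finally obtain z where z: "z \<in> X (a,e,k)" "r (a,e,k) (a,b,k) z = z1"
    "r (a,e,k) (b,e,k) z = r (c,e,k) (b,e,k) y"
    using gluesD[OF G2 z1(1) y2] by blast
  have vv: "r (a,b,k) (a,c,k) (r (a,e,k) (a,b,k) w) = r (a,e,k) (a,c,k) w"
    "r (c,e,k) (c,b,k) (r (a,e,k) (c,e,k) w) = r (a,b,k) (c,b,k) (r (a,e,k) (a,b,k) w)"
    "r (c,e,k) (b,e,k) (r (a,e,k) (c,e,k) w) = r (a,e,k) (b,e,k) w"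
    "r (a,e,k) (c,e,k) w \<in> X (c,e,k)" "r (a,e,k) (a,b,k) w \<in> X (a,b,k)"
    if "w \<in> X (a,e,k)" for w
    using le k that by (simp_all add: res_res res)
  show "\<exists>!z. z \<in> X (a,e,k) \<and> r (a,e,k) (a,c,k) z = x \<and> r (a,e,k) (c,e,k) z = y"
  proof (rule ex1I[of _ z])
    have "r (a,e,k) (c,e,k) z = y"
      by (rule glues_eqI[OF G3]) (use le k y z z1 vv[OF z(1)] in simp_all)
    then show "z \<in> X (a,e,k) \<and> r (a,e,k) (a,c,k) z = x \<and> r (a,e,k) (c,e,k) z = y"
      using z z1 vv(1)[OF z(1)] by simp
  next
    fix w assume w: "w \<in> X (a,e,k) \<and> r (a,e,k) (a,c,k) w = x \<and> r (a,e,k) (c,e,k) w = y"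
    then have wX: "w \<in> X (a,e,k)" by simp
    have "r (a,e,k) (a,b,k) w = z1"
      by (rule glues_eqI[OF G1]) (use le k z1 w vv[OF wX] in simp_all)
    then show "w = z"
      by - (rule glues_eqI[OF G2], use le k z w vv(3)[OF wX] in simp_all)
  qed
qed

lemma glues_paste_right:
  assumes le: "a \<le> b" "b \<le> c" "c \<le> e" "e \<le> m" and k: "k \<le> n"
    and G1: "glues X r b c e k" and G2: "glues X r a b e k" and G3: "glues X r a b c k"
  shows "glues X r a c e k"
  unfolding glues_def
proof (intro ballI impI)
  fix x y assume x: "x \<in> X (a,c,k)" and y: "y \<in> X (c,e,k)"
    and eq: "r (a,c,k) (c,c,k) x = r (c,e,k) (c,c,k) y"
  have x1: "r (a,c,k) (b,c,k) x \<in> X (b,c,k)" and x2: "r (a,c,k) (a,b,k) x \<in> X (a,b,k)"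
    using le k x by (simp_all add: res)
  have "r (b,c,k) (c,c,k) (r (a,c,k) (b,c,k) x) = r (c,e,k) (c,c,k) y"
    using le k x eq by (simp add: res_res)
  from gluesD[OF G1 x1 y this] obtain z1 where z1: "z1 \<in> X (b,e,k)"
    "r (b,e,k) (b,c,k) z1 = r (a,c,k) (b,c,k) x" "r (b,e,k) (c,e,k) z1 = y" by blast
  have "r (b,e,k) (b,b,k) z1 = r (b,c,k) (b,b,k) (r (b,e,k) (b,c,k) z1)"
    using le k z1(1) by (simp add: res_res)
  also have "\<dots> = r (a,b,k) (b,b,k) (r (a,c,k) (a,b,k) x)"
    using le k x unfolding z1(2) by (simp add: res_res)
  finally obtain z where z: "z \<in> X (a,e,k)" "r (a,e,k) (b,e,k) z = z1"
    "r (a,e,k) (a,b,k) z = r (a,c,k) (a,b,k) x"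
    using gluesD[OF G2 x2 z1(1)] by metis
  have vv: "r (b,e,k) (c,e,k) (r (a,e,k) (b,e,k) w) = r (a,e,k) (c,e,k) w"
    "r (a,c,k) (b,c,k) (r (a,e,k) (a,c,k) w) = r (b,e,k) (b,c,k) (r (a,e,k) (b,e,k) w)"
    "r (a,c,k) (a,b,k) (r (a,e,k) (a,c,k) w) = r (a,e,k) (a,b,k) w"
    "r (a,e,k) (a,c,k) w \<in> X (a,c,k)" "r (a,e,k) (b,e,k) w \<in> X (b,e,k)"
    if "w \<in> X (a,e,k)" for w
    using le k that by (simp_all add: res_res res)
  show "\<exists>!z. z \<in> X (a,e,k) \<and> r (a,e,k) (a,c,k) z = x \<and> r (a,e,k) (c,e,k) z = y"
  proof (rule ex1I[of _ z])
    have "r (a,e,k) (a,c,k) z = x"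
      by (rule glues_eqI[OF G3]) (use le k x z z1 vv[OF z(1)] in simp_all)
    then show "z \<in> X (a,e,k) \<and> r (a,e,k) (a,c,k) z = x \<and> r (a,e,k) (c,e,k) z = y"
      using z z1 vv(1)[OF z(1)] by simp
  next
    fix w assume w: "w \<in> X (a,e,k) \<and> r (a,e,k) (a,c,k) w = x \<and> r (a,e,k) (c,e,k) w = y"
    then have wX: "w \<in> X (a,e,k)" by simp
    have "r (a,e,k) (b,e,k) w = z1"
      by (rule glues_eqI[OF G1]) (use le k z1 w vv[OF wX] in simp_all)
    then show "w = z"
      by - (rule glues_eqI[OF G2], use le k z w vv(3)[OF wX] in simp_all)
  qed
qed

lemma lifts_horizontal_paste:
  assumes ij: "i \<le> b" "b \<le> j" "j \<le> m" and kl: "k \<le> l" "l \<le> n"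
    and L1: "lifts X r i b k l" and L2: "lifts X r b j k l"
    and Gk: "glues X r i b j k" and Gl: "glues X r i b j l"
  shows "lifts X r i j k l"
  unfolding lifts_def
proof (intro ballI impI)
  fix c y assume c: "c \<in> X (j,j,k)" and y: "y \<in> X (i,j,l)"
    and eq: "r (j,j,k) (j,j,l) c = r (i,j,l) (j,j,l) y"
  have y1: "r (i,j,l) (i,b,l) y \<in> X (i,b,l)" and y2: "r (i,j,l) (b,j,l) y \<in> X (b,j,l)"
    using ij kl y by (simp_all add: res)
  have "r (j,j,k) (j,j,l) c = r (b,j,l) (j,j,l) (r (i,j,l) (b,j,l) y)"
    using ij kl y eq by (simp add: res_res)
  from liftsD[OF L2 c y2 this] obtain e2 where e2: "e2 \<in> X (b,j,k)" "r (b,j,k) (j,j,k) e2 = c"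
    "r (b,j,k) (b,j,l) e2 = r (i,j,l) (b,j,l) y" by blast
  have e2b: "r (b,j,k) (b,b,k) e2 \<in> X (b,b,k)" using ij kl e2(1) by (simp add: res)
  have "r (b,b,k) (b,b,l) (r (b,j,k) (b,b,k) e2) = r (b,j,l) (b,b,l) (r (b,j,k) (b,j,l) e2)"
    using ij kl e2(1) by (simp add: res_res)
  also have "\<dots> = r (i,b,l) (b,b,l) (r (i,j,l) (i,b,l) y)"
    using ij kl y unfolding e2(3) by (simp add: res_res)
  finally obtain e1 where e1: "e1 \<in> X (i,b,k)" "r (i,b,k) (b,b,k) e1 = r (b,j,k) (b,b,k) e2"
    "r (i,b,k) (i,b,l) e1 = r (i,j,l) (i,b,l) y"
    using liftsD[OF L1 e2b y1] by blast
  from gluesD[OF Gk e1(1) e2(1) e1(2)] obtain e where e: "e \<in> X (i,j,k)"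
    "r (i,j,k) (i,b,k) e = e1" "r (i,j,k) (b,j,k) e = e2" by blast
  have vv: "r (i,j,l) (i,b,l) (r (i,j,k) (i,j,l) x) = r (i,b,k) (i,b,l) (r (i,j,k) (i,b,k) x)"
    "r (i,j,l) (b,j,l) (r (i,j,k) (i,j,l) x) = r (b,j,k) (b,j,l) (r (i,j,k) (b,j,k) x)"
    "r (b,j,k) (j,j,k) (r (i,j,k) (b,j,k) x) = r (i,j,k) (j,j,k) x"
    "r (i,b,k) (b,b,k) (r (i,j,k) (i,b,k) x) = r (b,j,k) (b,b,k) (r (i,j,k) (b,j,k) x)"
    "r (i,j,k) (i,j,l) x \<in> X (i,j,l)" "r (i,j,k) (i,b,k) x \<in> X (i,b,k)"
    "r (i,j,k) (b,j,k) x \<in> X (b,j,k)"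
    if "x \<in> X (i,j,k)" for x
    using ij kl that by (simp_all add: res_res res)
  show "\<exists>!x. x \<in> X (i,j,k) \<and> r (i,j,k) (j,j,k) x = c \<and> r (i,j,k) (i,j,l) x = y"
  proof (rule ex1I[of _ e])
    have "r (i,j,k) (i,j,l) e = y"
      by (rule glues_eqI[OF Gl]) (use ij kl y e e1 e2 vv[OF e(1)] in simp_all)
    then show "e \<in> X (i,j,k) \<and> r (i,j,k) (j,j,k) e = c \<and> r (i,j,k) (i,j,l) e = y"
      using e e2 vv(3)[OF e(1)] by simp
  next
    fix x assume x: "x \<in> X (i,j,k) \<and> r (i,j,k) (j,j,k) x = c \<and> r (i,j,k) (i,j,l) x = y"
    then have xX: "x \<in> X (i,j,k)" by simp
    have 2: "r (i,j,k) (b,j,k) x = e2"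
      by (rule lifts_eqI[OF L2]) (use ij kl e2 x vv[OF xX] in simp_all)
    have 1: "r (i,j,k) (i,b,k) x = e1"
      by (rule lifts_eqI[OF L1]) (use ij kl e1 x vv[OF xX] 2 in simp_all)
    show "x = e" by (rule glues_eqI[OF Gk]) (use ij kl e x 1 2 in simp_all)
  qed
qed

text \<open>A section over the composite of the spans \<open>[i,b]\<close> and \<open>[b,j]\<close> is a family of sections over \<open>[i,b]\<close>
indexed by the elements \<open>w\<close> of the second span.  Transposing each of them along \<open>[i,b]\<close> gives a section
\<open>t\<close> over \<open>[b,j]\<close>; the transpose of \<open>t\<close> is the transpose of the original section.\<close>

lemma transposes_horizontal_paste:
  assumes ij: "i \<le> b" "b \<le> j" "j \<le> m" and kl: "k \<le> l" "l \<le> n"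
    and T1: "transposes X r i b k l" and T2: "transposes X r b j k l"
    and Gk: "glues X r i b j k" and Gl: "glues X r i b j l"
  shows "transposes X r i j k l"
  unfolding transposes_def
proof (intro ballI allI impI)
  fix z s assume z: "z \<in> X (j,j,l)" and s: "\<forall>y\<in>X (i,j,l). r (i,j,l) (j,j,l) y = z \<longrightarrow>
    s y \<in> X (i,i,k) \<and> r (i,i,k) (i,i,l) (s y) = r (i,j,l) (i,i,l) y"
  \<comment> \<open>The element over \<open>[i,j]\<close> at level \<open>l\<close> with the given two halves.\<close>
  define join where "join u w = (THE y. y \<in> X (i,j,l) \<and> r (i,j,l) (i,b,l) y = u \<and> r (i,j,l) (b,j,l) y = w)" for u w
  have join: "join u w \<in> X (i,j,l) \<and> r (i,j,l) (i,b,l) (join u w) = u \<and> r (i,j,l) (b,j,l) (join u w) = w"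
    if "u \<in> X (i,b,l)" "w \<in> X (b,j,l)" "r (i,b,l) (b,b,l) u = r (b,j,l) (b,b,l) w" for u w
    unfolding join_def by (rule theI'[OF gluesD[OF Gl that]])
  have vl: "r (b,j,l) (j,j,l) (r (i,j,l) (b,j,l) y) = r (i,j,l) (j,j,l) y"
    "r (i,b,l) (i,i,l) (r (i,j,l) (i,b,l) y) = r (i,j,l) (i,i,l) y"
    "r (i,b,l) (b,b,l) (r (i,j,l) (i,b,l) y) = r (b,j,l) (b,b,l) (r (i,j,l) (b,j,l) y)"
    "r (i,j,l) (i,b,l) y \<in> X (i,b,l)" "r (i,j,l) (b,j,l) y \<in> X (b,j,l)"
    if "y \<in> X (i,j,l)" for y
    using ij kl that by (simp_all add: res_res res)
  have join_res: "join (r (i,j,l) (i,b,l) y) (r (i,j,l) (b,j,l) y) = y" if y: "y \<in> X (i,j,l)" for y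
    by (rule glues_eqI[OF Gl]) (use ij kl y join[OF vl(4)[OF y] vl(5)[OF y] vl(3)[OF y]] in simp_all)
  define P where "P w t \<longleftrightarrow> t \<in> X (b,b,k) \<and> r (b,b,k) (b,b,l) t = r (b,j,l) (b,b,l) w \<and>
        (\<forall>x\<in>X (i,b,k). r (i,b,k) (b,b,k) x = t \<longrightarrow>
           r (i,b,k) (i,i,k) x = s (join (r (i,b,k) (i,b,l) x) w))" for w t
  have ex_t: "\<exists>!t. P w t" if w: "w \<in> X (b,j,l)" "r (b,j,l) (j,j,l) w = z" for w
    unfolding P_def
  proof (rule transposesD[OF T1])
    show "r (b,j,l) (b,b,l) w \<in> X (b,b,l)" using ij kl w by (simp add: res)
    fix u assume u: "u \<in> X (i,b,l)" "r (i,b,l) (b,b,l) u = r (b,j,l) (b,b,l) w"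
    note jn = join[OF u(1) w(1) u(2)]
    have "r (i,j,l) (j,j,l) (join u w) = z" using vl(1)[of "join u w"] jn w by simp
    then show "s (join u w) \<in> X (i,i,k) \<and> r (i,i,k) (i,i,l) (s (join u w)) = r (i,b,l) (i,i,l) u"
      using s jn vl(2)[of "join u w"] by simp
  qed
  define t where "t w = (THE t. P w t)" for w
  have t: "P w (t w)" if "w \<in> X (b,j,l)" "r (b,j,l) (j,j,l) w = z" for w
    unfolding t_def by (rule theI'[OF ex_t[OF that]])
  have vk: "r (b,j,k) (j,j,k) (r (i,j,k) (b,j,k) x) = r (i,j,k) (j,j,k) x"
    "r (i,b,k) (i,i,k) (r (i,j,k) (i,b,k) x) = r (i,j,k) (i,i,k) x"
    "r (i,b,k) (b,b,k) (r (i,j,k) (i,b,k) x) = r (b,j,k) (b,b,k) (r (i,j,k) (b,j,k) x)"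
    "r (i,j,l) (i,b,l) (r (i,j,k) (i,j,l) x) = r (i,b,k) (i,b,l) (r (i,j,k) (i,b,k) x)"
    "r (i,j,l) (b,j,l) (r (i,j,k) (i,j,l) x) = r (b,j,k) (b,j,l) (r (i,j,k) (b,j,k) x)"
    "r (i,j,k) (i,j,l) x \<in> X (i,j,l)" "r (i,j,k) (i,b,k) x \<in> X (i,b,k)"
    "r (i,j,k) (b,j,k) x \<in> X (b,j,k)"
    if "x \<in> X (i,j,k)" for x
    using ij kl that by (simp_all add: res_res res)
  have ve: "r (b,j,k) (b,j,l) e \<in> X (b,j,l)" "r (b,j,k) (b,b,k) e \<in> X (b,b,k)"
    "r (b,j,l) (j,j,l) (r (b,j,k) (b,j,l) e) = r (j,j,k) (j,j,l) (r (b,j,k) (j,j,k) e)"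
    "r (b,b,k) (b,b,l) (r (b,j,k) (b,b,k) e) = r (b,j,l) (b,b,l) (r (b,j,k) (b,j,l) e)"
    if "e \<in> X (b,j,k)" for e
    using ij kl that by (simp_all add: res_res res)
  have ex_c: "\<exists>!c. c \<in> X (j,j,k) \<and> r (j,j,k) (j,j,l) c = z \<and>
        (\<forall>e\<in>X (b,j,k). r (b,j,k) (j,j,k) e = c \<longrightarrow> r (b,j,k) (b,b,k) e = t (r (b,j,k) (b,j,l) e))"
    by (rule transposesD[OF T2 z]) (use t in \<open>simp add: P_def\<close>)
  have "(\<forall>e\<in>X (b,j,k). r (b,j,k) (j,j,k) e = c \<longrightarrow> r (b,j,k) (b,b,k) e = t (r (b,j,k) (b,j,l) e)) \<longleftrightarrow>
      (\<forall>x\<in>X (i,j,k). r (i,j,k) (j,j,k) x = c \<longrightarrow> r (i,j,k) (i,i,k) x = s (r (i,j,k) (i,j,l) x))"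
    (is "?left \<longleftrightarrow> ?right") if c: "c \<in> X (j,j,k)" "r (j,j,k) (j,j,l) c = z" for c
  proof
    assume left: ?left
    show ?right
    proof (intro ballI impI)
      fix x assume x: "x \<in> X (i,j,k)" "r (i,j,k) (j,j,k) x = c"
      let ?e = "r (i,j,k) (b,j,k) x" and ?u = "r (i,j,k) (i,b,k) x"
      let ?w = "r (b,j,k) (b,j,l) ?e"
      have eX: "?e \<in> X (b,j,k)" "r (b,j,k) (j,j,k) ?e = c" using vk[OF x(1)] x(2) by simp_all
      have w: "?w \<in> X (b,j,l)" "r (b,j,l) (j,j,l) ?w = z" using ve[OF eX(1)] eX(2) c(2) by simp_all
      have "r (i,b,k) (b,b,k) ?u = t ?w" using left eX vk(3)[OF x(1)] by simp
      then have "r (i,b,k) (i,i,k) ?u = s (join (r (i,b,k) (i,b,l) ?u) ?w)"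
        using t[OF w] vk(7)[OF x(1)] unfolding P_def by blast
      moreover have "join (r (i,b,k) (i,b,l) ?u) ?w = r (i,j,k) (i,j,l) x"
        using join_res[OF vk(6)[OF x(1)]] unfolding vk(4)[OF x(1)] vk(5)[OF x(1)] .
      ultimately show "r (i,j,k) (i,i,k) x = s (r (i,j,k) (i,j,l) x)"
        using vk(2)[OF x(1)] by simp
    qed
  next
    assume right: ?right
    show ?left
    proof (intro ballI impI)
      fix e assume e: "e \<in> X (b,j,k)" "r (b,j,k) (j,j,k) e = c"
      let ?w = "r (b,j,k) (b,j,l) e"
      have w: "?w \<in> X (b,j,l)" "r (b,j,l) (j,j,l) ?w = z" using ve[OF e(1)] e(2) c(2) by simp_all
      have "r (i,b,k) (i,i,k) e1 = s (join (r (i,b,k) (i,b,l) e1) ?w)"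
        if e1: "e1 \<in> X (i,b,k)" "r (i,b,k) (b,b,k) e1 = r (b,j,k) (b,b,k) e" for e1
      proof -
        obtain x where x: "x \<in> X (i,j,k)" "r (i,j,k) (i,b,k) x = e1" "r (i,j,k) (b,j,k) x = e"
          using gluesD[OF Gk e1(1) e(1) e1(2)] by blast
        have "r (i,j,k) (j,j,k) x = c" using vk(1)[OF x(1)] x(3) e(2) by simp
        then have "r (i,b,k) (i,i,k) e1 = s (r (i,j,k) (i,j,l) x)"
          using right x(1) vk(2)[OF x(1)] x(2) by simp
        moreover have "join (r (i,b,k) (i,b,l) e1) ?w = r (i,j,k) (i,j,l) x"
          using join_res[OF vk(6)[OF x(1)]] unfolding vk(4)[OF x(1)] vk(5)[OF x(1)] x(2,3) .
        ultimately show ?thesis by simp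
      qed
      then have "P ?w (r (b,j,k) (b,b,k) e)"
        using ve[OF e(1)] by (simp add: P_def)
      then show "r (b,j,k) (b,b,k) e = t ?w" using ex_t[OF w] t[OF w] by blast
    qed
  qed
  then show "\<exists>!c. c \<in> X (j,j,k) \<and> r (j,j,k) (j,j,l) c = z \<and>
        (\<forall>x\<in>X (i,j,k). r (i,j,k) (j,j,k) x = c \<longrightarrow> r (i,j,k) (i,i,k) x = s (r (i,j,k) (i,j,l) x))"
    using ex_c by (simp cong: conj_cong)
qed

end

section \<open>Horns that are inner in the second direction\<close>

text \<open>Since the parts of the horn only omit levels other than \<open>d\<close>, an arrow of the horn stays in the horn
when level \<open>d\<close> is added to it.  The levels up to \<open>d\<close> avoid \<open>n\<close> and those from \<open>d\<close> on avoid \<open>0\<close>, so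
both halves of the grid belong to the horn.  An arrow that crosses level \<open>d\<close> has to be the composite
through level \<open>d\<close>, and on arrows of the horn this is what the given value already is.\<close>

lemma horn_fillable_vertical:
  assumes inf: "infinite (UNIV :: 'a set)" and d: "0 < d" "d < n"
  shows "horn_fillable TYPE('a) m n b d"
proof (rule horn_fillableI[where ?'b = 'a, OF inf])
  fix X and r :: "idx \<Rightarrow> idx \<Rightarrow> 'a \<Rightarrow> 'a"
  assume loc: "\<And>A B. (A, B) \<in> horn_cover m n b d \<Longrightarrow> locally_cromulent m n X r A B"
  have lo: "locally_cromulent m n X r {0..m} ({0..n} - {n})"
    and hi: "locally_cromulent m n X r {0..m} ({0..n} - {0})"
    using d by (auto intro!: loc simp: horn_cover_def)
  define g where "g = (\<lambda>(i,j,k) (i',j',l) x.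
    if k < d \<and> d < l then r (i,j,d) (i',j',l) (r (i,j,k) (i,j,d) x) else r (i,j,k) (i',j',l) x)"
  have g: "g (i,j,k) (i',j',l) x =
    (if k < d \<and> d < l then r (i,j,d) (i',j',l) (r (i,j,k) (i,j,d) x) else r (i,j,k) (i',j',l) x)"
    for i j k i' j' l x by (simp add: g_def)
  have fin: "finite (X (i,j,k))" if "i \<le> j" "j \<le> m" "k \<le> n" for i j k
    using that d local_fin[OF lo, of "(i,j,k)"] local_fin[OF hi, of "(i,j,k)"] by (cases "k = 0") auto
  have id: "r (i,j,k) (i,j,k) x = x" if "i \<le> j" "j \<le> m" "k \<le> n" "x \<in> X (i,j,k)" for i j k x
    using that d local_id[OF lo, of "(i,j,k)" x] local_id[OF hi, of "(i,j,k)" x] by (cases "k = 0") auto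
  have res: "r (i,j,k) (i',j',l) x \<in> X (i',j',l)"
    if "i \<le> i'" "i' \<le> j'" "j' \<le> j" "j \<le> m" "k \<le> l" "l \<le> n" "l \<le> d \<or> d \<le> k" "x \<in> X (i,j,k)" for i j k i' j' l x
  proof (cases "l \<le> d")
    case True
    then show ?thesis using that d by - (rule local_res[OF lo], simp_all)
  next
    case False
    then show ?thesis using that d by - (rule local_res[OF hi], simp_all)
  qed
  have rr: "r (i',j',l) (i'',j'',e) (r (i,j,k) (i',j',l) x) = r (i,j,k) (i'',j'',e) x"
    if "i \<le> i'" "i' \<le> i''" "i'' \<le> j''" "j'' \<le> j'" "j' \<le> j" "j \<le> m" "k \<le> l" "l \<le> e" "e \<le> n" "e \<le> d \<or> d \<le> k"
      "x \<in> X (i,j,k)" for i j k i' j' l i'' j'' e x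
  proof (cases "e \<le> d")
    case True
    then show ?thesis using that d by - (rule local_res_res[OF lo], simp_all)
  next
    case False
    then show ?thesis using that d by - (rule local_res_res[OF hi], simp_all)
  qed
  have "finset_diagram m n X g"
  proof
    fix p assume p: "p \<in> idx m n"
    obtain i j k where p': "p = (i,j,k)" by (cases p)
    show "finite (X p)" using p p' fin by simp
    fix x assume x: "x \<in> X p"
    show "g p p x = x" using p p' x id[of i j k x] by (auto simp: g)
    fix q assume q: "q \<in> idx m n" "p \<sqsubseteq> q"
    obtain i' j' l where q': "q = (i',j',l)" by (cases q)
    show "g p q x \<in> X q" using p p' q q' x by (auto simp: g intro!: res)
    fix s assume s: "s \<in> idx m n" "q \<sqsubseteq> s"
    obtain i'' j'' e where s': "s = (i'',j'',e)" by (cases s)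
    note le = p[unfolded p'] q[unfolded p' q'] s[unfolded q' s'] x[unfolded p']
    consider "e \<le> d \<or> d \<le> k" | "k < d" "d < e" "l \<le> d" | "k < d" "d < l" by linarith
    then show "g q s (g p q x) = g p s x"
    proof cases
      case 1
      then have "\<not> (k < d \<and> d < e)" "\<not> (k < d \<and> d < l)" "\<not> (l < d \<and> d < e)" using le by auto
      then show ?thesis
        unfolding p' q' s' g by (simp only: if_False) (rule rr, use 1 le in simp_all)
    next
      case 2
      have "r (i',j',d) (i'',j'',e) (r (i',j',l) (i',j',d) (r (i,j,k) (i',j',l) x)) =
          r (i',j',d) (i'',j'',e) (r (i,j,d) (i',j',d) (r (i,j,k) (i,j,d) x))"
        using 2 le by (simp add: rr)
      also have "\<dots> = r (i,j,d) (i'',j'',e) (r (i,j,k) (i,j,d) x)"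
        using 2 le by (intro rr res) auto
      finally have "r (i',j',d) (i'',j'',e) (r (i',j',l) (i',j',d) (r (i,j,k) (i',j',l) x)) =
          r (i,j,d) (i'',j'',e) (r (i,j,k) (i,j,d) x)" .
      moreover have "r (i',j',l) (i',j',d) (r (i,j,k) (i',j',l) x) = r (i,j,k) (i',j',l) x" if "l = d"
        using le that by (auto intro!: id res)
      ultimately show ?thesis using 2 le unfolding p' q' s' by (auto simp: g)
    next
      case 3
      have "r (i',j',l) (i'',j'',e) (r (i,j,d) (i',j',l) (r (i,j,k) (i,j,d) x)) =
          r (i,j,d) (i'',j'',e) (r (i,j,k) (i,j,d) x)"
        using 3 le by (intro rr res) auto
      then show ?thesis using 3 le unfolding p' q' s' by (auto simp: g)
    qed
  qed
  then interpret G: finset_diagram m n X g .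
  have half: "lifts X g i j k l \<and> transposes X g i j k l"
    if "i \<le> j" "j \<le> m" "k \<le> l" "l \<le> n" "l \<le> d \<or> d \<le> k" for i j k l
  proof -
    have "lifts X r i j k l \<and> transposes X r i j k l"
    proof (cases "l \<le> d")
      case True
      then show ?thesis using that d by - (intro conjI local_lift[OF lo] local_transpose[OF lo], simp_all)
    next
      case False
      then show ?thesis using that d by - (intro conjI local_lift[OF hi] local_transpose[OF hi], simp_all)
    qed
    moreover have "\<not> (k < d \<and> d < l)" "\<not> (l < d \<and> d < l)" "\<not> (k < d \<and> d < k)" using that by auto
    ultimately show ?thesis unfolding lifts_def transposes_def g by (simp only: if_False)
  qed
  have crom: "crom_diagram m n X g"
  proof
    fix a c e k assume *: "a \<le> c" "c \<le> e" "e \<le> m" "k \<le> n"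
    have "glues X r a c e k"
      using * d by (cases "k = 0") (auto intro: local_glue[OF lo] local_glue[OF hi])
    moreover have "\<not> (k < d \<and> d < k)" by auto
    ultimately show "glues X g a c e k" unfolding glues_def g by (simp only: if_False)
  next
    fix i j k l assume *: "i \<le> j" "j \<le> m" "k \<le> l" "l \<le> n"
    show "lifts X g i j k l" "transposes X g i j k l"
    proof -
      have "lifts X g i j k l \<and> transposes X g i j k l"
      proof (cases "l \<le> d \<or> d \<le> k")
        case False
        then show ?thesis
          using half[of i j k d] half[of i j d l] * d
          by (auto intro: G.lifts_vertical_paste[of i j k d l] G.transposes_vertical_paste[of i j k d l])
      qed (use half * in blast)
      then show "lifts X g i j k l" "transposes X g i j k l" by auto
    qed
  qed
  have r_eq: "r p q x = g p q x"
    if AB: "(A, B) \<in> horn_cover m n b d" and p: "p \<in> idx m n \<inter> within A B" and q: "q \<in> idx m n \<inter> within A B"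
      and pq: "p \<sqsubseteq> q" and x: "x \<in> X p" for A B p q x
  proof -
    obtain i j k i' j' l where p': "p = (i,j,k)" and q': "q = (i',j',l)" by (cases p; cases q)
    \<comment> \<open>Adding level \<open>d\<close> to the arrow does not leave the part \<open>(A, B)\<close>.\<close>
    have "d \<in> B" using AB d by (auto simp: horn_cover_def)
    then have "r (i,j,d) q (r p (i,j,d) x) = r p q x" if "k < d" "d < l"
      using p q pq x p' q' d that by (intro local_res_res[OF loc[OF AB]]) auto
    then show ?thesis by (simp add: p' q' g)
  qed
  have "diagram_iso (idx m n \<inter> within A B) X r X g (\<lambda>_ x. x)" if "(A, B) \<in> horn_cover m n b d" for A B
    using local_res[OF loc[OF that]] r_eq[OF that] by (intro diagram_iso.intro) (auto simp: bij_betw_def)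
  with crom show "\<exists>(G :: idx \<Rightarrow> 'a set) g \<kappa>. crom_diagram m n G g \<and>
    (\<forall>A B. (A, B) \<in> horn_cover m n b d \<longrightarrow> diagram_iso (idx m n \<inter> within A B) X r G g \<kappa>)"
    by (intro exI[of _ X] exI[of _ g] exI[of _ "\<lambda>_ x. x"]) blast
qed

section \<open>Horns that are inner in the first direction\<close>

lemma bij_betw_glues:
  assumes G: "glues X r a c e k"
    and maps: "\<And>z. z \<in> X (a,e,k) \<Longrightarrow> r (a,e,k) (a,c,k) z \<in> X (a,c,k) \<and> r (a,e,k) (c,e,k) z \<in> X (c,e,k) \<and>
      r (a,c,k) (c,c,k) (r (a,e,k) (a,c,k) z) = r (c,e,k) (c,c,k) (r (a,e,k) (c,e,k) z)"
  shows "bij_betw (\<lambda>z. (r (a,e,k) (a,c,k) z, r (a,e,k) (c,e,k) z)) (X (a,e,k))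
    {(x, y). x \<in> X (a,c,k) \<and> y \<in> X (c,e,k) \<and> r (a,c,k) (c,c,k) x = r (c,e,k) (c,c,k) y}"
proof (rule bij_betwI')
  fix z z' assume z: "z \<in> X (a,e,k)" and z': "z' \<in> X (a,e,k)"
  have "\<exists>!w. w \<in> X (a,e,k) \<and> r (a,e,k) (a,c,k) w = r (a,e,k) (a,c,k) z \<and>
      r (a,e,k) (c,e,k) w = r (a,e,k) (c,e,k) z"
    using maps[OF z] by (intro gluesD[OF G]) auto
  with z z' show "((r (a,e,k) (a,c,k) z, r (a,e,k) (c,e,k) z) =
      (r (a,e,k) (a,c,k) z', r (a,e,k) (c,e,k) z')) = (z = z')"
    unfolding prod.inject by metis
next
  fix z assume "z \<in> X (a,e,k)"
  from maps[OF this] show "(r (a,e,k) (a,c,k) z, r (a,e,k) (c,e,k) z) \<in>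
    {(x, y). x \<in> X (a,c,k) \<and> y \<in> X (c,e,k) \<and> r (a,c,k) (c,c,k) x = r (c,e,k) (c,c,k) y}"
    by simp
next
  fix w assume "w \<in> {(x, y). x \<in> X (a,c,k) \<and> y \<in> X (c,e,k) \<and> r (a,c,k) (c,c,k) x = r (c,e,k) (c,c,k) y}"
  then obtain x y where w: "w = (x, y)" "x \<in> X (a,c,k)" "y \<in> X (c,e,k)"
    "r (a,c,k) (c,c,k) x = r (c,e,k) (c,c,k) y" by blast
  from gluesD[OF G w(2-4)] show "\<exists>z\<in>X (a,e,k). w = (r (a,e,k) (a,c,k) z, r (a,e,k) (c,e,k) z)"
    unfolding w(1) by blast
qed

text \<open>Dually, an interval of the horn stays in the horn when \<open>b\<close> is added to its endpoints, and the intervals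
inside \<open>[0,b]\<close> and inside \<open>[b,m]\<close> all belong to the horn.  Over an interval that contains \<open>b\<close> take the set
of matching pairs of elements over its two halves.  Where the interval belongs to the horn, the given set
is canonically isomorphic to this set of pairs.\<close>

lemma horn_fillable_horizontal:
  assumes inf: "infinite (UNIV :: 'a set)" and b: "0 < b" "b < m"
  shows "horn_fillable TYPE('a) m n b d"
proof (rule horn_fillableI[where ?'b = "'a \<times> 'a", OF inf])
  fix X and r :: "idx \<Rightarrow> idx \<Rightarrow> 'a \<Rightarrow> 'a"
  assume loc: "\<And>A B. (A, B) \<in> horn_cover m n b d \<Longrightarrow> locally_cromulent m n X r A B"
  have lo: "locally_cromulent m n X r ({0..m} - {m}) {0..n}"
    and hi: "locally_cromulent m n X r ({0..m} - {0}) {0..n}"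
    using b by (auto intro!: loc simp: horn_cover_def)
  have fin: "finite (X (i,j,k))" if "i \<le> j" "j \<le> m" "k \<le> n" "j \<le> b \<or> b \<le> i" for i j k
  proof (cases "j \<le> b")
    case True
    then show ?thesis using that b by - (rule local_fin[OF lo], simp_all)
  next
    case False
    then show ?thesis using that b by - (rule local_fin[OF hi], simp_all)
  qed
  have id: "r (i,j,k) (i,j,k) x = x" if "i \<le> j" "j \<le> m" "k \<le> n" "j \<le> b \<or> b \<le> i" "x \<in> X (i,j,k)" for i j k x
  proof (cases "j \<le> b")
    case True
    then show ?thesis using that b by - (rule local_id[OF lo], simp_all)
  next
    case False
    then show ?thesis using that b by - (rule local_id[OF hi], simp_all)
  qed
  have res: "r (i,j,k) (i',j',l) x \<in> X (i',j',l)"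
    if "i \<le> i'" "i' \<le> j'" "j' \<le> j" "j \<le> m" "k \<le> l" "l \<le> n" "j \<le> b \<or> b \<le> i" "x \<in> X (i,j,k)" for i j k i' j' l x
  proof (cases "j \<le> b")
    case True
    then show ?thesis using that b by - (rule local_res[OF lo], simp_all)
  next
    case False
    then show ?thesis using that b by - (rule local_res[OF hi], simp_all)
  qed
  have rr: "r (i',j',l) (i'',j'',e) (r (i,j,k) (i',j',l) x) = r (i,j,k) (i'',j'',e) x"
    if "i \<le> i'" "i' \<le> i''" "i'' \<le> j''" "j'' \<le> j'" "j' \<le> j" "j \<le> m" "k \<le> l" "l \<le> e" "e \<le> n" "j \<le> b \<or> b \<le> i"
      "x \<in> X (i,j,k)" for i j k i' j' l i'' j'' e x
  proof (cases "j \<le> b")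
    case True
    then show ?thesis using that b by - (rule local_res_res[OF lo], simp_all)
  next
    case False
    then show ?thesis using that b by - (rule local_res_res[OF hi], simp_all)
  qed
  \<comment> \<open>Away from \<open>b\<close> an element is doubled, so that both kinds of intervals carry sets of pairs.\<close>
  define G where "G = (\<lambda>(i,j,k). if j < b \<or> b < i then (\<lambda>x. (x, x)) ` X (i,j,k)
    else {(x, y). x \<in> X (i,b,k) \<and> y \<in> X (b,j,k) \<and> r (i,b,k) (b,b,k) x = r (b,j,k) (b,b,k) y})"
  have G1: "G (i,j,k) = (\<lambda>x. (x, x)) ` X (i,j,k)" if "j < b \<or> b < i" for i j k
    using that by (simp add: G_def)
  have G2: "G (i,j,k) = {(x, y). x \<in> X (i,b,k) \<and> y \<in> X (b,j,k) \<and> r (i,b,k) (b,b,k) x = r (b,j,k) (b,b,k) y}"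
    if "i \<le> b" "b \<le> j" for i j k
    using that by (auto simp: G_def)
  \<comment> \<open>The first component lies over \<open>{i..min j b}\<close> if \<open>i \<le> b\<close>, the second over \<open>{max i b..j}\<close> if \<open>b \<le> j\<close>.\<close>
  define g where "g = (\<lambda>(i,j,k) (i',j',l) w.
    if j' < b then (\<lambda>u. (u, u)) (r (i, min j b, k) (i',j',l) (fst w))
    else if b < i' then (\<lambda>u. (u, u)) (r (max i b, j, k) (i',j',l) (snd w))
    else (r (i,b,k) (i',b,l) (fst w), r (b,j,k) (b,j',l) (snd w)))"
  have gL: "g (i,j,k) (i',j',l) w = (r (i, min j b, k) (i',j',l) (fst w), r (i, min j b, k) (i',j',l) (fst w))"
    if "j' < b" for i j k i' j' l w
    using that by (simp add: g_def)
  have gR: "g (i,j,k) (i',j',l) w = (r (max i b, j, k) (i',j',l) (snd w), r (max i b, j, k) (i',j',l) (snd w))"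
    if "b < i'" "i' \<le> j'" for i j k i' j' l w
    using that by (simp add: g_def)
  have gS: "g (i,j,k) (i',j',l) w = (r (i,b,k) (i',b,l) (fst w), r (b,j,k) (b,j',l) (snd w))"
    if "i' \<le> b" "b \<le> j'" for i j k i' j' l w
    using that by (simp add: g_def)
  have "finset_diagram m n G g"
  proof
    fix p assume p: "p \<in> idx m n"
    obtain i j k where p': "p = (i,j,k)" by (cases p)
    note ijk = p[unfolded p' idx_iff]
    show "finite (G p)"
    proof (cases "j < b \<or> b < i")
      case True
      then show ?thesis using ijk unfolding p' by (subst G1) (auto intro!: finite_imageI fin)
    next
      case False
      then have "finite (X (i,b,k) \<times> X (b,j,k))" using ijk b by (intro finite_cartesian_product fin) auto
      then show ?thesis unfolding p' using False by (subst G2) (auto elim!: rev_finite_subset)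
    qed
    fix w assume w: "w \<in> G p"
    have zone: "j < b \<and> (\<exists>x. x \<in> X (i,j,k) \<and> w = (x, x)) \<or> b < i \<and> (\<exists>x. x \<in> X (i,j,k) \<and> w = (x, x)) \<or>
      i \<le> b \<and> b \<le> j \<and> (\<exists>x y. w = (x, y) \<and> x \<in> X (i,b,k) \<and> y \<in> X (b,j,k) \<and>
        r (i,b,k) (b,b,k) x = r (b,j,k) (b,b,k) y)"
      using w unfolding p' by (auto simp: G_def split: if_splits)
    show "g p p w = w"
      using zone unfolding p'
    proof (elim disjE conjE exE)
      fix x assume "j < b" "x \<in> X (i,j,k)" "w = (x, x)"
      then show "g (i,j,k) (i,j,k) w = w" using ijk by (simp add: gL id)
    next
      fix x assume "b < i" "x \<in> X (i,j,k)" "w = (x, x)"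
      then show "g (i,j,k) (i,j,k) w = w" using ijk by (simp add: gR id max_absorb1 max_absorb2)
    next
      fix x y assume "i \<le> b" "b \<le> j" "w = (x, y)" "x \<in> X (i,b,k)" "y \<in> X (b,j,k)"
      then show "g (i,j,k) (i,j,k) w = w" using ijk b by (simp add: gS id)
    qed
    fix q assume q: "q \<in> idx m n" "p \<sqsubseteq> q"
    obtain i' j' l where q': "q = (i',j',l)" by (cases q)
    note le = q[unfolded p' q' idx_iff idx_le.simps]
    show "g p q w \<in> G q"
      using zone unfolding p' q'
    proof (elim disjE conjE exE)
      fix x assume x: "j < b" "x \<in> X (i,j,k)" "w = (x, x)"
      then have "j' < b" "r (i,j,k) (i',j',l) x \<in> X (i',j',l)" using ijk le by (auto intro: res)
      then show "g (i,j,k) (i',j',l) w \<in> G (i',j',l)" using x by (simp add: gL G1)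
    next
      fix x assume x: "b < i" "x \<in> X (i,j,k)" "w = (x, x)"
      then have "b < i'" "r (i,j,k) (i',j',l) x \<in> X (i',j',l)" using ijk le by (auto intro: res)
      then show "g (i,j,k) (i',j',l) w \<in> G (i',j',l)" using x le by (simp add: gR G1 max_absorb1 max_absorb2)
    next
      fix x y assume w: "i \<le> b" "b \<le> j" "w = (x, y)" "x \<in> X (i,b,k)" "y \<in> X (b,j,k)"
        and match: "r (i,b,k) (b,b,k) x = r (b,j,k) (b,b,k) y"
      consider "j' < b" | "b < i'" | "i' \<le> b" "b \<le> j'" by linarith
      then show "g (i,j,k) (i',j',l) w \<in> G (i',j',l)"
      proof cases
        case 1
        then have "r (i,b,k) (i',j',l) x \<in> X (i',j',l)" using w ijk le b by (intro res) auto
        then show ?thesis using w 1 by (simp add: gL G1 min_absorb1 min_absorb2)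
      next
        case 2
        then have "r (b,j,k) (i',j',l) y \<in> X (i',j',l)" using w ijk le b by (intro res) auto
        then show ?thesis using w le 2 by (simp add: gR G1 max_absorb1 max_absorb2)
      next
        case 3
        have "r (i',b,l) (b,b,l) (r (i,b,k) (i',b,l) x) = r (b,b,k) (b,b,l) (r (i,b,k) (b,b,k) x)"
          using w ijk le b 3 by (simp add: rr)
        also have "\<dots> = r (b,j',l) (b,b,l) (r (b,j,k) (b,j',l) y)"
          using w ijk le b 3 unfolding match by (simp add: rr)
        finally show ?thesis using w ijk le b 3 by (simp add: gS G2 res)
      qed
    qed
    fix s assume s: "s \<in> idx m n" "q \<sqsubseteq> s"
    obtain i'' j'' e where s': "s = (i'',j'',e)" by (cases s)
    note le' = s[unfolded s' q' idx_iff idx_le.simps]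
    show "g q s (g p q w) = g p s w"
      using zone unfolding p' q' s'
    proof (elim disjE conjE exE)
      fix x assume x: "j < b" "x \<in> X (i,j,k)" "w = (x, x)"
      then show "g (i',j',l) (i'',j'',e) (g (i,j,k) (i',j',l) w) = g (i,j,k) (i'',j'',e) w"
        using ijk le le' by (simp add: gL rr)
    next
      fix x assume x: "b < i" "x \<in> X (i,j,k)" "w = (x, x)"
      then show "g (i',j',l) (i'',j'',e) (g (i,j,k) (i',j',l) w) = g (i,j,k) (i'',j'',e) w"
        using ijk le le' by (simp add: gR rr max_absorb1 max_absorb2)
    next
      fix x y assume w: "i \<le> b" "b \<le> j" "w = (x, y)" "x \<in> X (i,b,k)" "y \<in> X (b,j,k)"
      note facts = w ijk le le' b
      consider "j' < b" | "b < i'" | "i' \<le> b" "b \<le> j'" "j'' < b" | "i' \<le> b" "b \<le> j'" "b < i''"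
        | "i' \<le> b" "b \<le> j'" "i'' \<le> b" "b \<le> j''" by linarith
      then show "g (i',j',l) (i'',j'',e) (g (i,j,k) (i',j',l) w) = g (i,j,k) (i'',j'',e) w"
      proof cases
        case 1
        then show ?thesis using facts by (simp add: gL rr min_absorb1 min_absorb2)
      next
        case 2
        then show ?thesis using facts by (simp add: gR rr max_absorb1 max_absorb2)
      next
        case 3
        then show ?thesis using facts by (simp add: gL gS rr min_absorb1 min_absorb2)
      next
        case 4
        then show ?thesis using facts by (simp add: gR gS rr max_absorb1 max_absorb2)
      next
        case 5
        then show ?thesis using facts by (simp add: gS rr)
      qed
    qed
  qed
  then interpret G: finset_diagram m n G g .
  \<comment> \<open>On one side of \<open>b\<close> one component of a pair determines the other, so the conditions there are inherited from \<open>X\<close>.\<close>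
  have iso_lo: "diagram_iso {(i,j,k). i \<le> j \<and> j \<le> b \<and> k \<le> n} G g X r (\<lambda>_. fst)"
  proof
    fix p assume "p \<in> {(i,j,k). i \<le> j \<and> j \<le> b \<and> k \<le> n}"
    then obtain i j k where p: "p = (i,j,k)" "i \<le> j" "j \<le> b" "k \<le> n" by auto
    show "bij_betw fst (G p) (X p)"
    proof (cases "j < b")
      case True
      then show ?thesis unfolding p(1) by (simp add: G1 bij_betw_def inj_on_def image_image)
    next
      case False
      then have j: "j = b" using p by simp
      have "r (b,b,k) (b,b,k) y = y" if "y \<in> X (b,b,k)" for y using that p b by (intro id) auto
      moreover have "r (i,b,k) (b,b,k) x \<in> X (b,b,k)" if "x \<in> X (i,b,k)" for x
        using that p j b by (intro res) auto
      ultimately have "G (i,b,k) = (\<lambda>x. (x, r (i,b,k) (b,b,k) x)) ` X (i,b,k)"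
        using p j by (subst G2) auto
      then show ?thesis unfolding p(1) j by (simp add: bij_betw_def inj_on_def image_image)
    qed
    fix q w assume "q \<in> {(i,j,k). i \<le> j \<and> j \<le> b \<and> k \<le> n}" and le: "p \<sqsubseteq> q" and w: "w \<in> G p"
    then obtain i' j' l where q: "q = (i',j',l)" "i' \<le> j'" "j' \<le> b" "l \<le> n" by auto
    show "g p q w \<in> G q" using p q le w b by (intro G.res) auto
    show "fst (g p q w) = r p q (fst w)"
      using p q le by (cases "j' < b") (auto simp: gL gS min_absorb1 min_absorb2)
  qed
  have iso_hi: "diagram_iso {(i,j,k). b \<le> i \<and> i \<le> j \<and> j \<le> m \<and> k \<le> n} G g X r (\<lambda>_. snd)"
  proof
    fix p assume "p \<in> {(i,j,k). b \<le> i \<and> i \<le> j \<and> j \<le> m \<and> k \<le> n}"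
    then obtain i j k where p: "p = (i,j,k)" "b \<le> i" "i \<le> j" "j \<le> m" "k \<le> n" by auto
    show "bij_betw snd (G p) (X p)"
    proof (cases "b < i")
      case True
      then show ?thesis unfolding p(1) by (simp add: G1 bij_betw_def inj_on_def image_image)
    next
      case False
      then have i: "i = b" using p by simp
      have "r (b,b,k) (b,b,k) x = x" if "x \<in> X (b,b,k)" for x using that p b by (intro id) auto
      moreover have "r (b,j,k) (b,b,k) y \<in> X (b,b,k)" if "y \<in> X (b,j,k)" for y
        using that p i b by (intro res) auto
      ultimately have "G (b,j,k) = (\<lambda>y. (r (b,j,k) (b,b,k) y, y)) ` X (b,j,k)"
        using p i by (subst G2) auto
      then show ?thesis unfolding p(1) i by (simp add: bij_betw_def inj_on_def image_image)
    qed
    fix q w assume "q \<in> {(i,j,k). b \<le> i \<and> i \<le> j \<and> j \<le> m \<and> k \<le> n}" and le: "p \<sqsubseteq> q" and w: "w \<in> G p"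
    then obtain i' j' l where q: "q = (i',j',l)" "b \<le> i'" "i' \<le> j'" "j' \<le> m" "l \<le> n" by auto
    show "g p q w \<in> G q" using p q le w b by (intro G.res) auto
    show "snd (g p q w) = r p q (snd w)"
      using p q le by (cases "b < i'") (auto simp: gR gS max_absorb1 max_absorb2)
  qed
  have glues_side: "glues G g a c e k" if "a \<le> c" "c \<le> e" "e \<le> m" "k \<le> n" "e \<le> b \<or> b \<le> a" for a c e k
    using that(5)
  proof
    assume "e \<le> b"
    then show ?thesis
      using that b by (intro diagram_iso.glues_transfer[OF iso_lo] local_glue[OF lo]) auto
  next
    assume "b \<le> a"
    then show ?thesis
      using that b by (intro diagram_iso.glues_transfer[OF iso_hi] local_glue[OF hi]) auto
  qed
  have ladder_side: "lifts G g i j k l \<and> transposes G g i j k l"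
    if "i \<le> j" "j \<le> m" "k \<le> l" "l \<le> n" "j \<le> b \<or> b \<le> i" for i j k l
    using that(5)
  proof
    assume "j \<le> b"
    then show ?thesis
      using that b
      by (intro conjI diagram_iso.lifts_transfer[OF iso_lo] local_lift[OF lo]
          diagram_iso.transposes_transfer[OF iso_lo] local_transpose[OF lo]) (auto simp: rr)
  next
    assume "b \<le> i"
    then show ?thesis
      using that b
      by (intro conjI diagram_iso.lifts_transfer[OF iso_hi] local_lift[OF hi]
          diagram_iso.transposes_transfer[OF iso_hi] local_transpose[OF hi]) (auto simp: rr)
  qed
  have glues_b: "glues G g a b e k" if le: "a \<le> b" "b \<le> e" "e \<le> m" "k \<le> n" for a e k
    unfolding glues_def
  proof (intro ballI impI)
    fix v w assume v: "v \<in> G (a,b,k)" and w: "w \<in> G (b,e,k)"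
      and eq: "g (a,b,k) (b,b,k) v = g (b,e,k) (b,b,k) w"
    have idb: "r (b,b,k) (b,b,k) y = y" if "y \<in> X (b,b,k)" for y
      using that le b by (intro id) auto
    obtain x u where v': "v = (x, u)" "x \<in> X (a,b,k)" "u \<in> X (b,b,k)" "r (a,b,k) (b,b,k) x = u"
      using v le by (auto simp: G2 idb)
    obtain t y where w': "w = (t, y)" "t \<in> X (b,b,k)" "y \<in> X (b,e,k)" "r (b,e,k) (b,b,k) y = t"
      using w le by (auto simp: G2 idb)
    have ut: "u = t" using eq v' w' by (simp add: gS idb)
    have idx: "r (a,b,k) (a,b,k) x' = x'" "r (b,e,k) (b,e,k) y' = y'"
      if "x' \<in> X (a,b,k)" "y' \<in> X (b,e,k)" for x' y'
      using that le by (auto intro!: id)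
    show "\<exists>!z. z \<in> G (a,e,k) \<and> g (a,e,k) (a,b,k) z = v \<and> g (a,e,k) (b,e,k) z = w"
    proof (rule ex1I[of _ "(x, y)"])
      show "(x, y) \<in> G (a,e,k) \<and> g (a,e,k) (a,b,k) (x, y) = v \<and> g (a,e,k) (b,e,k) (x, y) = w"
        using le v' w' ut idx[of x y] by (simp add: G2 gS)
    next
      fix z assume z: "z \<in> G (a,e,k) \<and> g (a,e,k) (a,b,k) z = v \<and> g (a,e,k) (b,e,k) z = w"
      then obtain x' y' where z': "z = (x', y')" "x' \<in> X (a,b,k)" "y' \<in> X (b,e,k)"
        using le by (auto simp: G2)
      show "z = (x, y)" using z le v' w' z' idx[of x' y'] by (simp add: gS)
    qed
  qed
  have crom: "crom_diagram m n G g"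
  proof
    fix a c e k assume *: "a \<le> c" "c \<le> e" "e \<le> m" "k \<le> n"
    consider "e \<le> b \<or> b \<le> a" | "a < b" "b < e" "c \<le> b" | "a < b" "b < e" "b \<le> c" by linarith
    then show "glues G g a c e k"
    proof cases
      case 1
      then show ?thesis using * by (intro glues_side)
    next
      case 2
      then show ?thesis
        using * by (intro G.glues_paste_left[of a c b e k] glues_side[of a c b k] glues_b glues_side[of c b e k])
          (auto intro: glues_b)
    next
      case 3
      then show ?thesis
        using * by (intro G.glues_paste_right[of a b c e k] glues_side[of b c e k] glues_b)
          (auto intro: glues_b)
    qed
  next
    fix i j k l assume *: "i \<le> j" "j \<le> m" "k \<le> l" "l \<le> n"
    have "lifts G g i j k l \<and> transposes G g i j k l"
    proof (cases "j \<le> b \<or> b \<le> i")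
      case False
      then show ?thesis
        using * ladder_side[of i b k l] ladder_side[of b j k l] glues_b[of i j k] glues_b[of i j l]
        by (auto intro: G.lifts_horizontal_paste[of i b j k l] G.transposes_horizontal_paste[of i b j k l])
    qed (use ladder_side * in blast)
    then show "lifts G g i j k l" "transposes G g i j k l" by auto
  qed
  define \<kappa> where "\<kappa> = (\<lambda>(i,j,k) x. if j < b \<or> b < i then (x, x) else (r (i,j,k) (i,b,k) x, r (i,j,k) (b,j,k) x))"
  have \<kappa>1: "\<kappa> (i,j,k) = (\<lambda>x. (x, x))" if "j < b \<or> b < i" for i j k
    using that by (auto simp: \<kappa>_def)
  have \<kappa>2: "\<kappa> (i,j,k) = (\<lambda>x. (r (i,j,k) (i,b,k) x, r (i,j,k) (b,j,k) x))" if "i \<le> b" "b \<le> j" for i j k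
    using that by (auto simp: \<kappa>_def)
  have "diagram_iso (idx m n \<inter> within A B) X r G g \<kappa>" if AB: "(A, B) \<in> horn_cover m n b d" for A B
  proof
    fix p assume p: "p \<in> idx m n \<inter> within A B"
    obtain i j k where p': "p = (i,j,k)" by (cases p)
    have ijk: "i \<le> j" "j \<le> m" "k \<le> n" "i \<in> A" "j \<in> A" "k \<in> B" using p p' by auto
    have bA: "b \<in> A" using AB b by (auto simp: horn_cover_def)
    note L = loc[OF AB]
    show "bij_betw (\<kappa> p) (X p) (G p)"
    proof (cases "j < b \<or> b < i")
      case True
      then show ?thesis unfolding p' by (simp add: G1 \<kappa>1 bij_betw_def inj_on_def)
    next
      case False
      then have ib: "i \<le> b" "b \<le> j" by auto
      show ?thesis unfolding p' \<kappa>2[OF ib] G2[OF ib]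
        using ijk bA ib
        by (intro bij_betw_glues local_glue[OF L] conjI local_res[OF L]) (simp_all add: local_res_res[OF L])
    qed
    fix q x assume q: "q \<in> idx m n \<inter> within A B" "p \<sqsubseteq> q" and x: "x \<in> X p"
    show "r p q x \<in> X q" using p q x by (intro local_res[OF L]) auto
    obtain i' j' l where q': "q = (i',j',l)" by (cases q)
    have le: "i \<le> i'" "i' \<le> j'" "j' \<le> j" "k \<le> l" "l \<le> n" "i' \<in> A" "j' \<in> A" "l \<in> B" using q p' q' by auto
    have x': "x \<in> X (i,j,k)" using x p' by simp
    note facts = ijk le bA x'
    consider "j < b" | "b < i" | "i \<le> b" "b \<le> j" "j' < b" | "i \<le> b" "b \<le> j" "b < i'" | "i \<le> b" "b \<le> j" "i' \<le> b" "b \<le> j'"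
      by linarith
    then show "\<kappa> q (r p q x) = g p q (\<kappa> p x)"
    proof cases
      case 1
      then show ?thesis using facts unfolding p' q' by (simp add: \<kappa>1 gL)
    next
      case 2
      then show ?thesis using facts unfolding p' q' by (simp add: \<kappa>1 gR max_absorb1 max_absorb2)
    next
      case 3
      then show ?thesis using facts unfolding p' q' by (simp add: \<kappa>1 \<kappa>2 gL min_absorb1 min_absorb2 local_res_res[OF L])
    next
      case 4
      then show ?thesis using facts unfolding p' q' by (simp add: \<kappa>1 \<kappa>2 gR max_absorb1 max_absorb2 local_res_res[OF L])
    next
      case 5
      then show ?thesis using facts unfolding p' q' by (simp add: \<kappa>2 gS local_res_res[OF L])
    qed
  qed
  with crom show "\<exists>(G :: idx \<Rightarrow> ('a \<times> 'a) set) g \<kappa>. crom_diagram m n G g \<and>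
    (\<forall>A B. (A, B) \<in> horn_cover m n b d \<longrightarrow> diagram_iso (idx m n \<inter> within A B) X r G g \<kappa>)"
    by blast
qed

section \<open>Horns that are outer in both directions\<close>

text \<open>For \<open>b = 0\<close> and \<open>d = n\<close> the horn contains the whole row at level \<open>n\<close> and the whole column over the vertex
\<open>0\<close>, and these determine everything else as dependent products.  One omitted level other than \<open>n\<close> and
one omitted vertex other than \<open>0\<close> are enough to know that row and that column.\<close>

locale row_column =
  fixes m n :: nat and X :: "idx \<Rightarrow> 'a set" and r :: "idx \<Rightarrow> idx \<Rightarrow> 'a \<Rightarrow> 'a" and A B :: "nat set"
  assumes row: "locally_cromulent m n X r {0..m} B" and n_in: "n \<in> B"
    and column: "locally_cromulent m n X r A {0..n}" and zero_in: "0 \<in> A"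
begin

lemma row_fin: "i \<le> j \<Longrightarrow> j \<le> m \<Longrightarrow> finite (X (i,j,n))"
  using n_in by (intro local_fin[OF row]) auto

lemma row_res: "i \<le> i' \<Longrightarrow> i' \<le> j' \<Longrightarrow> j' \<le> j \<Longrightarrow> j \<le> m \<Longrightarrow> w \<in> X (i,j,n) \<Longrightarrow>
    r (i,j,n) (i',j',n) w \<in> X (i',j',n)"
  using n_in by (intro local_res[OF row]) auto

lemma row_id: "i \<le> j \<Longrightarrow> j \<le> m \<Longrightarrow> w \<in> X (i,j,n) \<Longrightarrow> r (i,j,n) (i,j,n) w = w"
  using n_in by (intro local_id[OF row]) auto

lemma row_res_res: "i \<le> i' \<Longrightarrow> i' \<le> i'' \<Longrightarrow> i'' \<le> j'' \<Longrightarrow> j'' \<le> j' \<Longrightarrow> j' \<le> j \<Longrightarrow> j \<le> m \<Longrightarrow> w \<in> X (i,j,n) \<Longrightarrow>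
    r (i',j',n) (i'',j'',n) (r (i,j,n) (i',j',n) w) = r (i,j,n) (i'',j'',n) w"
  using n_in by (intro local_res_res[OF row]) auto

lemma row_glue: "a \<le> c \<Longrightarrow> c \<le> e \<Longrightarrow> e \<le> m \<Longrightarrow> glues X r a c e n"
  using n_in by (intro local_glue[OF row]) auto

lemma col_fin: "k \<le> n \<Longrightarrow> finite (X (0,0,k))"
  using zero_in by (intro local_fin[OF column]) auto

lemma col_res: "k \<le> l \<Longrightarrow> l \<le> n \<Longrightarrow> u \<in> X (0,0,k) \<Longrightarrow> r (0,0,k) (0,0,l) u \<in> X (0,0,l)"
  using zero_in by (intro local_res[OF column]) auto

lemma col_id: "k \<le> n \<Longrightarrow> u \<in> X (0,0,k) \<Longrightarrow> r (0,0,k) (0,0,k) u = u"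
  using zero_in by (intro local_id[OF column]) auto

lemma col_res_res: "k \<le> l \<Longrightarrow> l \<le> e \<Longrightarrow> e \<le> n \<Longrightarrow> u \<in> X (0,0,k) \<Longrightarrow>
    r (0,0,l) (0,0,e) (r (0,0,k) (0,0,l) u) = r (0,0,k) (0,0,e) u"
  using zero_in by (intro local_res_res[OF column]) auto

text \<open>An element of \<open>X (0,j,n)\<close> is thought of as a path from \<open>0\<close> to \<open>j\<close> in the sequence of spans at level
\<open>n\<close>, which ends at its image in \<open>X (j,j,n)\<close>.\<close>

definition paths :: "nat \<Rightarrow> 'a \<Rightarrow> 'a set" where
  "paths j z = {y \<in> X (0,j,n). r (0,j,n) (j,j,n) y = z}"

definition join :: "nat \<Rightarrow> nat \<Rightarrow> 'a \<Rightarrow> 'a \<Rightarrow> 'a" where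
  "join c e y w = (THE z. z \<in> X (0,e,n) \<and> r (0,e,n) (0,c,n) z = y \<and> r (0,e,n) (c,e,n) z = w)"

lemma join:
  assumes "c \<le> e" "e \<le> m" "w \<in> X (c,e,n)" "y \<in> paths c (r (c,e,n) (c,c,n) w)"
  shows "join c e y w \<in> X (0,e,n)" "r (0,e,n) (0,c,n) (join c e y w) = y"
    "r (0,e,n) (c,e,n) (join c e y w) = w"
proof -
  have "\<exists>!z. z \<in> X (0,e,n) \<and> r (0,e,n) (0,c,n) z = y \<and> r (0,e,n) (c,e,n) z = w"
    using assms by (intro gluesD[OF row_glue]) (auto simp: paths_def)
  from theI'[OF this] show "join c e y w \<in> X (0,e,n)" "r (0,e,n) (0,c,n) (join c e y w) = y"
    "r (0,e,n) (c,e,n) (join c e y w) = w"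
    by (auto simp: join_def)
qed

lemma join_res:
  assumes "c \<le> e" "e \<le> m" "z \<in> X (0,e,n)"
  shows "join c e (r (0,e,n) (0,c,n) z) (r (0,e,n) (c,e,n) z) = z"
proof -
  let ?y = "r (0,e,n) (0,c,n) z" and ?w = "r (0,e,n) (c,e,n) z"
  have "\<exists>!z'. z' \<in> X (0,e,n) \<and> r (0,e,n) (0,c,n) z' = ?y \<and> r (0,e,n) (c,e,n) z' = ?w"
    using assms by (intro gluesD[OF row_glue]) (simp_all add: row_res row_res_res)
  then show ?thesis unfolding join_def by (rule the1_equality) (use assms in simp)
qed

lemma join_in_paths:
  assumes "c \<le> e" "e \<le> m" "w \<in> X (c,e,n)" "y \<in> paths c (r (c,e,n) (c,c,n) w)"
  shows "join c e y w \<in> paths e (r (c,e,n) (e,e,n) w)"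
proof -
  have "r (0,e,n) (e,e,n) (join c e y w) = r (c,e,n) (e,e,n) (r (0,e,n) (c,e,n) (join c e y w))"
    using assms join(1)[OF assms] by (simp add: row_res_res)
  then show ?thesis using join[OF assms] by (simp add: paths_def)
qed

lemma join_start:
  assumes "c \<le> e" "e \<le> m" "w \<in> X (c,e,n)" "y \<in> paths c (r (c,e,n) (c,c,n) w)"
  shows "r (0,e,n) (0,0,n) (join c e y w) = r (0,c,n) (0,0,n) y"
proof -
  have "r (0,e,n) (0,0,n) (join c e y w) = r (0,c,n) (0,0,n) (r (0,e,n) (0,c,n) (join c e y w))"
    using assms join(1)[OF assms] by (simp add: row_res_res)
  then show ?thesis using join[OF assms] by simp
qed

lemma join_trivial:
  assumes "j \<le> m" "y \<in> paths j z" shows "join j j y z = y"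
  using join_res[of j j y] assms by (simp add: paths_def row_id)

text \<open>Following the initial part of \<open>w\<close> from \<open>c\<close> to \<open>d\<close> and then the rest amounts to following \<open>w\<close>.  This is
what makes the restriction maps of the product diagram compose.\<close>

lemma join_join:
  assumes le: "c \<le> d" "d \<le> e" "e \<le> m" and w: "w \<in> X (c,e,n)" and y: "y \<in> paths c (r (c,e,n) (c,c,n) w)"
  shows "join d e (join c d y (r (c,e,n) (c,d,n) w)) (r (c,e,n) (d,e,n) w) = join c e y w"
proof -
  let ?z = "join c e y w"
  have ce: "c \<le> e" using le by simp
  note z = join[OF ce le(3) w y]
  have "r (0,d,n) (0,c,n) (r (0,e,n) (0,d,n) ?z) = y"
    using z le by (simp add: row_res_res)
  moreover have "r (0,d,n) (c,d,n) (r (0,e,n) (0,d,n) ?z) = r (c,e,n) (c,d,n) w"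
  proof -
    have "r (0,d,n) (c,d,n) (r (0,e,n) (0,d,n) ?z) = r (c,e,n) (c,d,n) (r (0,e,n) (c,e,n) ?z)"
      using z(1) le by (simp add: row_res_res)
    then show ?thesis using z(3) by simp
  qed
  ultimately have "join c d y (r (c,e,n) (c,d,n) w) = r (0,e,n) (0,d,n) ?z"
    using join_res[of c d "r (0,e,n) (0,d,n) ?z"] z(1) le by (simp add: row_res)
  moreover have "r (c,e,n) (d,e,n) w = r (0,e,n) (d,e,n) ?z"
  proof -
    have "r (c,e,n) (d,e,n) (r (0,e,n) (c,e,n) ?z) = r (0,e,n) (d,e,n) ?z"
      using z(1) le by (simp add: row_res_res)
    then show ?thesis using z(3) by simp
  qed
  ultimately show ?thesis using join_res[of d e ?z] z(1) le by simp
qed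

text \<open>The product diagram.  An element over \<open>[i,j]\<close> at level \<open>k\<close> is an element \<open>w\<close> of the row together with a
section that chooses, for every path \<open>y\<close> from \<open>0\<close> to the end of \<open>w\<close>, an element of \<open>X (0,0,k)\<close> over the
start of \<open>y\<close>.  To restrict it to an interval that ends at \<open>j'\<close>, a path to the vertex \<open>j'\<close> of \<open>w\<close> is
continued along \<open>w\<close> to \<open>j\<close> before the section is evaluated.\<close>

definition sections :: "nat \<Rightarrow> 'a \<Rightarrow> nat \<Rightarrow> ('a \<Rightarrow> 'a) set" where
  "sections j z k = {s \<in> extensional (paths j z).
     \<forall>y\<in>paths j z. s y \<in> X (0,0,k) \<and> r (0,0,k) (0,0,n) (s y) = r (0,j,n) (0,0,n) y}"

definition prod_ob :: "idx \<Rightarrow> ('a \<times> ('a \<Rightarrow> 'a)) set" where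
  "prod_ob = (\<lambda>(i,j,k). {(w, s). w \<in> X (i,j,n) \<and> s \<in> sections j (r (i,j,n) (j,j,n) w) k})"

definition prod_res :: "idx \<Rightarrow> idx \<Rightarrow> 'a \<times> ('a \<Rightarrow> 'a) \<Rightarrow> 'a \<times> ('a \<Rightarrow> 'a)" where
  "prod_res = (\<lambda>(i,j,k) (i',j',l) (w, s). (r (i,j,n) (i',j',n) w,
     \<lambda>y\<in>paths j' (r (i,j,n) (j',j',n) w).
       r (0,0,k) (0,0,l) (s (join j' j y (r (i,j,n) (j',j,n) w)))))"

lemma prod_ob_iff: "(w, s) \<in> prod_ob (i,j,k) \<longleftrightarrow> w \<in> X (i,j,n) \<and> s \<in> sections j (r (i,j,n) (j,j,n) w) k"
  by (simp add: prod_ob_def)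

lemma sectionsD:
  assumes "s \<in> sections j z k" "y \<in> paths j z"
  shows "s y \<in> X (0,0,k)" "r (0,0,k) (0,0,n) (s y) = r (0,j,n) (0,0,n) y"
  using assms by (auto simp: sections_def)

lemma sections_eqI:
  assumes "s \<in> sections j z k" "s' \<in> sections j z k" "\<And>y. y \<in> paths j z \<Longrightarrow> s y = s' y"
  shows "s = s'"
  using assms by (intro extensionalityI[of s "paths j z" s']) (auto simp: sections_def)

lemma prod_res_eq: "prod_res (i,j,k) (i',j',l) (w, s) = (r (i,j,n) (i',j',n) w,
     \<lambda>y\<in>paths j' (r (i,j,n) (j',j',n) w).
       r (0,0,k) (0,0,l) (s (join j' j y (r (i,j,n) (j',j,n) w))))"
  by (simp add: prod_res_def)

lemma prod_res_same_end:
  assumes "i \<le> i'" "i' \<le> j" "j \<le> m" "(w, s) \<in> prod_ob (i,j,k)"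
  shows "prod_res (i,j,k) (i',j,l) (w, s) = (r (i,j,n) (i',j,n) w,
     \<lambda>y\<in>paths j (r (i,j,n) (j,j,n) w). r (0,0,k) (0,0,l) (s y))"
  using assms(3) by (auto simp: prod_res_eq join_trivial intro!: restrict_ext)

lemma prod_res_same_end_level:
  assumes "i \<le> i'" "i' \<le> j" "j \<le> m" "k \<le> n" "(w, s) \<in> prod_ob (i,j,k)"
  shows "prod_res (i,j,k) (i',j,k) (w, s) = (r (i,j,n) (i',j,n) w, s)"
proof -
  have s: "s \<in> sections j (r (i,j,n) (j,j,n) w) k" using assms by (simp add: prod_ob_iff)
  have "(\<lambda>y\<in>paths j (r (i,j,n) (j,j,n) w). r (0,0,k) (0,0,k) (s y)) = s"
    by (rule extensionalityI[of _ "paths j (r (i,j,n) (j,j,n) w)"])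
      (use s assms(4) sectionsD[OF s] in \<open>auto simp: col_id sections_def\<close>)
  then show ?thesis using prod_res_same_end[OF assms(1-3,5)] by simp
qed

lemma sections_pull:
  assumes j: "j' \<le> j" "j \<le> m" and k: "k \<le> l" "l \<le> n" and w: "w \<in> X (j',j,n)"
    and s: "s \<in> sections j (r (j',j,n) (j,j,n) w) k"
  shows "(\<lambda>y\<in>paths j' (r (j',j,n) (j',j',n) w). r (0,0,k) (0,0,l) (s (join j' j y w))) \<in>
    sections j' (r (j',j,n) (j',j',n) w) l"
proof -
  have "r (0,0,k) (0,0,l) (s (join j' j y w)) \<in> X (0,0,l) \<and>
      r (0,0,l) (0,0,n) (r (0,0,k) (0,0,l) (s (join j' j y w))) = r (0,j',n) (0,0,n) y"
    if y: "y \<in> paths j' (r (j',j,n) (j',j',n) w)" for y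
    using sectionsD[OF s join_in_paths[OF j w y]] join_start[OF j w y] k
    by (simp add: col_res col_res_res)
  then show ?thesis by (simp add: sections_def)
qed

lemma finset_diagram_prod: "finset_diagram m n prod_ob prod_res"
proof
  fix p assume p: "p \<in> idx m n"
  obtain i j k where p': "p = (i,j,k)" by (cases p)
  note ijk = p[unfolded p' idx_iff]
  show "finite (prod_ob p)"
  proof -
    have "finite (sections j z k)" for z
    proof (rule finite_subset)
      show "sections j z k \<subseteq> paths j z \<rightarrow>\<^sub>E X (0,0,k)" by (auto simp: sections_def PiE_iff extensional_def)
      have "finite (paths j z)" using row_fin[of 0 j] ijk by (simp add: paths_def)
      then show "finite (paths j z \<rightarrow>\<^sub>E X (0,0,k))" using ijk by (intro finite_PiE) (auto intro: col_fin)
    qed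
    then have "finite (SIGMA w:X (i,j,n). sections j (r (i,j,n) (j,j,n) w) k)"
      using ijk by (intro finite_SigmaI row_fin) auto
    moreover have "prod_ob p = (SIGMA w:X (i,j,n). sections j (r (i,j,n) (j,j,n) w) k)"
      by (auto simp: p' prod_ob_iff)
    ultimately show ?thesis by simp
  qed
  fix x assume x: "x \<in> prod_ob p"
  obtain w s where x': "x = (w, s)" by (cases x)
  have ws: "(w, s) \<in> prod_ob (i,j,k)" using x x' p' by simp
  then have w: "w \<in> X (i,j,n)" and s: "s \<in> sections j (r (i,j,n) (j,j,n) w) k" by (auto simp: prod_ob_iff)
  show "prod_res p p x = x" using prod_res_same_end_level[OF _ _ _ _ ws, of i] ijk w by (simp add: p' x' row_id)
  fix q assume q: "q \<in> idx m n" "p \<sqsubseteq> q"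
  obtain i' j' l where q': "q = (i',j',l)" by (cases q)
  note le = q[unfolded p' q' idx_iff idx_le.simps]
  let ?wj = "r (i,j,n) (j',j,n) w"
  have wj: "?wj \<in> X (j',j,n)" "r (j',j,n) (j',j',n) ?wj = r (i,j,n) (j',j',n) w"
    "r (j',j,n) (j,j,n) ?wj = r (i,j,n) (j,j,n) w"
    using ijk le w by (simp_all add: row_res row_res_res)
  show "prod_res p q x \<in> prod_ob q"
    using sections_pull[of j' j k l ?wj s] ijk le w s wj
    by (simp add: p' q' x' prod_res_eq prod_ob_iff row_res row_res_res)
  fix t assume t: "t \<in> idx m n" "q \<sqsubseteq> t"
  obtain i'' j'' e where t': "t = (i'',j'',e)" by (cases t)
  note le' = t[unfolded q' t' idx_iff idx_le.simps]
  have "r (0,0,l) (0,0,e)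
      ((\<lambda>y'\<in>paths j' (r (i,j,n) (j',j',n) w). r (0,0,k) (0,0,l) (s (join j' j y' ?wj)))
        (join j'' j' y (r (i,j,n) (j'',j',n) w))) =
      r (0,0,k) (0,0,e) (s (join j'' j y (r (i,j,n) (j'',j,n) w)))"
    if y: "y \<in> paths j'' (r (i,j,n) (j'',j'',n) w)" for y
  proof -
    let ?v = "r (i,j,n) (j'',j',n) w" and ?u = "r (i,j,n) (j'',j,n) w"
    have v: "?v \<in> X (j'',j',n)" "y \<in> paths j'' (r (j'',j',n) (j'',j'',n) ?v)"
      "r (j'',j',n) (j',j',n) ?v = r (i,j,n) (j',j',n) w"
      using ijk le le' w y by (simp_all add: row_res row_res_res)
    have u: "?u \<in> X (j'',j,n)" "y \<in> paths j'' (r (j'',j,n) (j'',j'',n) ?u)"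
      "r (j'',j,n) (j,j,n) ?u = r (i,j,n) (j,j,n) w" "r (j'',j,n) (j'',j',n) ?u = ?v"
      "r (j'',j,n) (j',j,n) ?u = ?wj"
      using ijk le le' w y by (simp_all add: row_res row_res_res)
    have "join j'' j' y ?v \<in> paths j' (r (i,j,n) (j',j',n) w)"
      using join_in_paths[OF _ _ v(1,2)] v(3) ijk le le' by simp
    moreover have "join j' j (join j'' j' y ?v) ?wj = join j'' j y ?u"
      using join_join[OF _ _ _ u(1,2), of j'] u(4,5) ijk le le' by simp
    moreover have "s (join j'' j y ?u) \<in> X (0,0,k)"
      using sectionsD(1)[OF s] join_in_paths[OF _ _ u(1,2)] u(3) ijk le le' by simp
    ultimately show ?thesis using ijk le le' by (simp add: col_res_res)
  qed
  note pt = this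
  show "prod_res q t (prod_res p q x) = prod_res p t x"
    using ijk le le' w pt
    by (auto simp: p' q' t' x' prod_res_eq row_res row_res_res intro!: restrict_ext)
qed

lemma glues_prod:
  assumes le: "a \<le> c" "c \<le> e" "e \<le> m" and k: "k \<le> n"
  shows "glues prod_ob prod_res a c e k"
  unfolding glues_def
proof (intro ballI impI)
  fix x x' assume x: "x \<in> prod_ob (a,c,k)" and x': "x' \<in> prod_ob (c,e,k)"
    and eq: "prod_res (a,c,k) (c,c,k) x = prod_res (c,e,k) (c,c,k) x'"
  obtain w s w' s' where xs: "x = (w, s)" "x' = (w', s')" by (cases x; cases x')
  have ws: "(w, s) \<in> prod_ob (a,c,k)" and ws': "(w', s') \<in> prod_ob (c,e,k)" using x x' xs by auto
  have w: "w \<in> X (a,c,n)" and w': "w' \<in> X (c,e,n)" and s': "s' \<in> sections e (r (c,e,n) (e,e,n) w') k"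
    using ws ws' by (auto simp: prod_ob_iff)
  have "(r (a,c,n) (c,c,n) w, s) = prod_res (c,e,k) (c,c,k) (w', s')"
    using eq prod_res_same_end_level[OF le(1) order_refl _ k ws] le by (simp add: xs)
  then have wc: "r (a,c,n) (c,c,n) w = r (c,e,n) (c,c,n) w'"
    and s: "s = (\<lambda>y\<in>paths c (r (c,e,n) (c,c,n) w'). r (0,0,k) (0,0,k) (s' (join c e y w')))"
    using le w' by (simp_all add: prod_res_eq row_id)
  have ex: "\<exists>!z. z \<in> X (a,e,n) \<and> r (a,e,n) (a,c,n) z = w \<and> r (a,e,n) (c,e,n) z = w'"
    using le by (intro gluesD[OF row_glue] w w' wc) auto
  then obtain W where W: "W \<in> X (a,e,n)" "r (a,e,n) (a,c,n) W = w" "r (a,e,n) (c,e,n) W = w'" by blast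
  have We: "r (c,e,n) (e,e,n) w' = r (a,e,n) (e,e,n) W" "r (c,e,n) (c,c,n) w' = r (a,e,n) (c,c,n) W"
    using W(1) le unfolding W(3)[symmetric] by (simp_all add: row_res_res)
  have WK: "(W, s') \<in> prod_ob (a,e,k)" using W(1) s' We(1) by (simp add: prod_ob_iff)
  show "\<exists>!z. z \<in> prod_ob (a,e,k) \<and> prod_res (a,e,k) (a,c,k) z = x \<and> prod_res (a,e,k) (c,e,k) z = x'"
  proof (rule ex1I[of _ "(W, s')"])
    show "(W, s') \<in> prod_ob (a,e,k) \<and> prod_res (a,e,k) (a,c,k) (W, s') = x \<and> prod_res (a,e,k) (c,e,k) (W, s') = x'"
      using WK prod_res_same_end_level[OF le(1,2,3) k WK] W s We by (simp add: xs prod_res_eq)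
  next
    fix z assume z: "z \<in> prod_ob (a,e,k) \<and> prod_res (a,e,k) (a,c,k) z = x \<and> prod_res (a,e,k) (c,e,k) z = x'"
    obtain W2 s2 where z': "z = (W2, s2)" by (cases z)
    have zK: "(W2, s2) \<in> prod_ob (a,e,k)" using z z' by simp
    have "r (a,e,n) (a,c,n) W2 = w" using z by (simp add: z' xs prod_res_eq)
    moreover have "r (a,e,n) (c,e,n) W2 = w'" "s2 = s'"
      using z prod_res_same_end_level[OF le(1,2,3) k zK] by (simp_all add: z' xs)
    moreover have "W2 \<in> X (a,e,n)" using zK by (simp add: prod_ob_iff)
    ultimately show "z = (W, s')" using ex W z' by blast
  qed
qed

lemma lifts_prod:
  assumes le: "i \<le> j" "j \<le> m" and kl: "k \<le> l" "l \<le> n"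
  shows "lifts prod_ob prod_res i j k l"
  unfolding lifts_def
proof (intro ballI impI)
  fix c x assume c: "c \<in> prod_ob (j,j,k)" and x: "x \<in> prod_ob (i,j,l)"
    and eq: "prod_res (j,j,k) (j,j,l) c = prod_res (i,j,l) (j,j,l) x"
  obtain z s w t where cx: "c = (z, s)" "x = (w, t)" by (cases c; cases x)
  have zs: "(z, s) \<in> prod_ob (j,j,k)" and wt: "(w, t) \<in> prod_ob (i,j,l)" using c x cx by auto
  have z: "z \<in> X (j,j,n)" "r (j,j,n) (j,j,n) z = z" and w: "w \<in> X (i,j,n)" "r (i,j,n) (i,j,n) w = w"
    using zs wt le by (auto simp: prod_ob_iff row_id)
  have zw: "z = r (i,j,n) (j,j,n) w" and t: "t = (\<lambda>y\<in>paths j z. r (0,0,k) (0,0,l) (s y))"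
    using eq prod_res_same_end[OF order_refl order_refl le(2) zs] prod_res_same_end_level[OF le(1) order_refl le(2) kl(2) wt] z
    by (auto simp: cx)
  have ws: "(w, s) \<in> prod_ob (i,j,k)" using zs w(1) z by (simp add: prod_ob_iff zw[symmetric])
  have kn: "k \<le> n" using kl by simp
  show "\<exists>!v. v \<in> prod_ob (i,j,k) \<and> prod_res (i,j,k) (j,j,k) v = c \<and> prod_res (i,j,k) (i,j,l) v = x"
  proof (rule ex1I[of _ "(w, s)"])
    show "(w, s) \<in> prod_ob (i,j,k) \<and> prod_res (i,j,k) (j,j,k) (w, s) = c \<and> prod_res (i,j,k) (i,j,l) (w, s) = x"
      using ws prod_res_same_end_level[OF le(1) order_refl le(2) kn ws] prod_res_same_end[OF order_refl le ws, of l] w t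
      by (simp add: cx zw)
  next
    fix v assume v: "v \<in> prod_ob (i,j,k) \<and> prod_res (i,j,k) (j,j,k) v = c \<and> prod_res (i,j,k) (i,j,l) v = x"
    obtain w2 s2 where v': "v = (w2, s2)" by (cases v)
    have vK: "(w2, s2) \<in> prod_ob (i,j,k)" using v v' by simp
    then have w2: "w2 \<in> X (i,j,n)" by (simp add: prod_ob_iff)
    have "s2 = s" using v prod_res_same_end_level[OF le(1) order_refl le(2) kn vK] by (simp add: v' cx)
    moreover have "w2 = w" using v le w2 by (simp add: v' cx prod_res_eq row_id)
    ultimately show "v = (w, s)" using v' by simp
  qed
qed

text \<open>The currying of sections.  A path \<open>y\<close> from \<open>0\<close> to \<open>j\<close> consists of a path from \<open>0\<close> to \<open>i\<close> and an element
\<open>w\<close> over \<open>[i,j]\<close>.  The given \<open>S\<close> assigns to \<open>w\<close> a section over the paths to \<open>i\<close>, and \<open>\<sigma> y\<close> is the value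
of that section at the initial part of \<open>y\<close>.\<close>

lemma transposes_prod:
  assumes le: "i \<le> j" "j \<le> m" and kl: "k \<le> l" "l \<le> n"
  shows "transposes prod_ob prod_res i j k l"
  unfolding transposes_def
proof (intro ballI allI impI)
  fix zt S
  assume zt: "zt \<in> prod_ob (j,j,l)"
    and S: "\<forall>x\<in>prod_ob (i,j,l). prod_res (i,j,l) (j,j,l) x = zt \<longrightarrow>
      S x \<in> prod_ob (i,i,k) \<and> prod_res (i,i,k) (i,i,l) (S x) = prod_res (i,j,l) (i,i,l) x"
  obtain z t where zt': "zt = (z, t)" by (cases zt)
  have kn: "k \<le> n" and im: "i \<le> m" using kl le by auto
  have z: "z \<in> X (j,j,n)" "r (j,j,n) (j,j,n) z = z" and t: "t \<in> sections j z l"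
    using zt le by (auto simp: zt' prod_ob_iff row_id)
  have S_props: "fst (S (w, t)) = r (i,j,n) (i,i,n) w"
      "snd (S (w, t)) \<in> sections i (r (i,j,n) (i,i,n) w) k"
      "\<And>y. y \<in> paths i (r (i,j,n) (i,i,n) w) \<Longrightarrow> r (0,0,k) (0,0,l) (snd (S (w, t)) y) = t (join i j y w)"
    if w: "w \<in> X (i,j,n)" "r (i,j,n) (j,j,n) w = z" for w
  proof -
    have wt: "(w, t) \<in> prod_ob (i,j,l)" using w t by (simp add: prod_ob_iff)
    have "prod_res (i,j,l) (j,j,l) (w, t) = zt"
      using prod_res_same_end_level[OF le(1) order_refl le(2) kl(2) wt] w by (simp add: zt')
    with S wt have SK: "S (w, t) \<in> prod_ob (i,i,k)"
      and Seq: "prod_res (i,i,k) (i,i,l) (S (w, t)) = prod_res (i,j,l) (i,i,l) (w, t)" by auto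
    obtain v u where S': "S (w, t) = (v, u)" by (cases "S (w, t)")
    have vu: "(v, u) \<in> prod_ob (i,i,k)" using SK S' by simp
    then have v: "v \<in> X (i,i,n)" "r (i,i,n) (i,i,n) v = v" using im by (auto simp: prod_ob_iff row_id)
    have *: "(v, \<lambda>y\<in>paths i v. r (0,0,k) (0,0,l) (u y)) = prod_res (i,j,l) (i,i,l) (w, t)"
      using Seq prod_res_same_end[OF order_refl order_refl im vu, of l] v by (simp add: S')
    then have v_eq: "v = r (i,j,n) (i,i,n) w" by (simp add: prod_res_eq)
    then show "fst (S (w, t)) = r (i,j,n) (i,i,n) w" by (simp add: S')
    show "snd (S (w, t)) \<in> sections i (r (i,j,n) (i,i,n) w) k"
      using vu v(2) by (simp add: S' prod_ob_iff v_eq)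
    fix y assume y: "y \<in> paths i (r (i,j,n) (i,i,n) w)"
    have "t (join i j y w) \<in> X (0,0,l)"
      using sectionsD(1)[OF t] join_in_paths[OF le w(1) y] w(2) by simp
    moreover have "r (0,0,k) (0,0,l) (u y) = r (0,0,l) (0,0,l) (t (join i j y w))"
      using fun_cong[OF arg_cong[OF *, of snd], of y] y w le by (simp add: prod_res_eq v_eq row_id)
    ultimately show "r (0,0,k) (0,0,l) (snd (S (w, t)) y) = t (join i j y w)"
      using kl by (simp add: S' col_id)
  qed
  have split: "r (0,j,n) (i,j,n) y \<in> X (i,j,n)" "r (i,j,n) (j,j,n) (r (0,j,n) (i,j,n) y) = z"
      "r (0,j,n) (0,i,n) y \<in> paths i (r (i,j,n) (i,i,n) (r (0,j,n) (i,j,n) y))"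
      "r (0,i,n) (0,0,n) (r (0,j,n) (0,i,n) y) = r (0,j,n) (0,0,n) y"
      "join i j (r (0,j,n) (0,i,n) y) (r (0,j,n) (i,j,n) y) = y"
    if "y \<in> paths j z" for y
    using that le join_res[OF le, of y] by (auto simp: paths_def row_res row_res_res)
  \<comment> \<open>A path over \<open>z\<close> is cut at \<open>i\<close>; its two parts are the arguments of \<open>S\<close> and of the resulting section.\<close>
  define \<sigma> where "\<sigma> = (\<lambda>y\<in>paths j z. snd (S (r (0,j,n) (i,j,n) y, t)) (r (0,j,n) (0,i,n) y))"
  have \<sigma>: "\<sigma> \<in> sections j z k"
    using sectionsD[OF S_props(2)[OF split(1,2)] split(3)] split(4)
    by (auto simp: sections_def \<sigma>_def)
  have \<sigma>_join: "\<sigma> (join i j y w) = snd (S (w, t)) y"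
    if w: "w \<in> X (i,j,n)" "r (i,j,n) (j,j,n) w = z" and y: "y \<in> paths i (r (i,j,n) (i,i,n) w)" for w y
    using join_in_paths[OF le w(1) y] join[OF le w(1) y] w(2) by (simp add: \<sigma>_def)
  have z\<sigma>: "(z, \<sigma>) \<in> prod_ob (j,j,k)" using z \<sigma> by (simp add: prod_ob_iff)
  have \<sigma>_t: "(\<lambda>y\<in>paths j z. r (0,0,k) (0,0,l) (\<sigma> y)) = t"
  proof (rule extensionalityI[of _ "paths j z"])
    show "t \<in> extensional (paths j z)" using t by (simp add: sections_def)
    fix y assume y: "y \<in> paths j z"
    show "(\<lambda>y\<in>paths j z. r (0,0,k) (0,0,l) (\<sigma> y)) y = t y"
      using y S_props(3)[OF split(1)[OF y] split(2)[OF y] split(3)[OF y]] split(5)[OF y] by (simp add: \<sigma>_def)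
  qed simp
  show "\<exists>!c. c \<in> prod_ob (j,j,k) \<and> prod_res (j,j,k) (j,j,l) c = zt \<and>
    (\<forall>x\<in>prod_ob (i,j,k). prod_res (i,j,k) (j,j,k) x = c \<longrightarrow> prod_res (i,j,k) (i,i,k) x = S (prod_res (i,j,k) (i,j,l) x))"
  proof (rule ex1I[of _ "(z, \<sigma>)"], intro conjI ballI impI)
    show "(z, \<sigma>) \<in> prod_ob (j,j,k)" by (rule z\<sigma>)
    show "prod_res (j,j,k) (j,j,l) (z, \<sigma>) = zt"
      using prod_res_same_end[OF order_refl order_refl le(2) z\<sigma>, of l] z \<sigma>_t by (simp add: zt')
    fix x assume x: "x \<in> prod_ob (i,j,k)" and xc: "prod_res (i,j,k) (j,j,k) x = (z, \<sigma>)"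
    obtain w s where x': "x = (w, s)" by (cases x)
    have ws: "(w, s) \<in> prod_ob (i,j,k)" using x x' by simp
    then have w: "w \<in> X (i,j,n)" "r (i,j,n) (i,j,n) w = w" using le by (auto simp: prod_ob_iff row_id)
    have wz: "r (i,j,n) (j,j,n) w = z" "s = \<sigma>"
      using xc prod_res_same_end_level[OF le(1) order_refl le(2) kn ws] by (simp_all add: x')
    have "prod_res (i,j,k) (i,j,l) x = (w, t)"
      using prod_res_same_end[OF order_refl le ws, of l] w wz \<sigma>_t by (simp add: x')
    moreover have "prod_res (i,j,k) (i,i,k) x = S (w, t)"
    proof (rule prod_eqI)
      show "fst (prod_res (i,j,k) (i,i,k) x) = fst (S (w, t))"
        using S_props(1)[OF w(1) wz(1)] by (simp add: x' prod_res_eq)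
      have "(\<lambda>y\<in>paths i (r (i,j,n) (i,i,n) w). r (0,0,k) (0,0,k) (s (join i j y w))) = snd (S (w, t))"
      proof (rule extensionalityI[of _ "paths i (r (i,j,n) (i,i,n) w)"])
        show "snd (S (w, t)) \<in> extensional (paths i (r (i,j,n) (i,i,n) w))"
          using S_props(2)[OF w(1) wz(1)] by (simp add: sections_def)
        fix y assume y: "y \<in> paths i (r (i,j,n) (i,i,n) w)"
        show "(\<lambda>y\<in>paths i (r (i,j,n) (i,i,n) w). r (0,0,k) (0,0,k) (s (join i j y w))) y = snd (S (w, t)) y"
          using y \<sigma>_join[OF w(1) wz(1) y] sectionsD(1)[OF S_props(2)[OF w(1) wz(1)] y] kn
          by (simp add: wz(2) col_id)
      qed simp
      then show "snd (prod_res (i,j,k) (i,i,k) x) = snd (S (w, t))" using w by (simp add: x' prod_res_eq)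
    qed
    ultimately show "prod_res (i,j,k) (i,i,k) x = S (prod_res (i,j,k) (i,j,l) x)" by simp
  next
    fix c assume c: "c \<in> prod_ob (j,j,k) \<and> prod_res (j,j,k) (j,j,l) c = zt \<and>
      (\<forall>x\<in>prod_ob (i,j,k). prod_res (i,j,k) (j,j,k) x = c \<longrightarrow> prod_res (i,j,k) (i,i,k) x = S (prod_res (i,j,k) (i,j,l) x))"
    obtain z' s where c': "c = (z', s)" by (cases c)
    have zs: "(z', s) \<in> prod_ob (j,j,k)" using c c' by simp
    then have "z' \<in> X (j,j,n)" "r (j,j,n) (j,j,n) z' = z'" using le by (auto simp: prod_ob_iff row_id)
    then have z': "z' = z" and st: "(\<lambda>y\<in>paths j z. r (0,0,k) (0,0,l) (s y)) = t"
      using c prod_res_same_end[OF order_refl order_refl le(2) zs, of l] by (auto simp: c' zt')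
    have s: "s \<in> sections j z k" using zs z z' by (simp add: prod_ob_iff)
    have "s = \<sigma>"
    proof (rule sections_eqI[OF s \<sigma>])
      fix y assume y: "y \<in> paths j z"
      let ?w = "r (0,j,n) (i,j,n) y" and ?y = "r (0,j,n) (0,i,n) y"
      note w = split[OF y]
      have ww: "r (i,j,n) (i,j,n) ?w = ?w" using le w(1) by (simp add: row_id)
      have ws: "(?w, s) \<in> prod_ob (i,j,k)" using w(1,2) s by (simp add: prod_ob_iff)
      have "prod_res (i,j,k) (j,j,k) (?w, s) = c"
        using prod_res_same_end_level[OF le(1) order_refl le(2) kn ws] w(2) by (simp add: c' z')
      moreover have "prod_res (i,j,k) (i,j,l) (?w, s) = (?w, t)"
        using prod_res_same_end[OF order_refl le ws, of l] ww w(2) st by simp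
      ultimately have "prod_res (i,j,k) (i,i,k) (?w, s) = S (?w, t)" using c ws by auto
      from fun_cong[OF arg_cong[OF this, of snd], of ?y]
      have "r (0,0,k) (0,0,k) (s (join i j ?y ?w)) = snd (S (?w, t)) ?y"
        using w(3) ww by (simp add: prod_res_eq)
      then show "s y = \<sigma> y" using w(5) y sectionsD(1)[OF s y] kn by (simp add: \<sigma>_def col_id)
    qed
    then show "c = (z, \<sigma>)" using c' z' by simp
  qed
qed

lemma crom_diagram_prod: "crom_diagram m n prod_ob prod_res"
  by (intro crom_diagram.intro crom_diagram_axioms.intro finset_diagram_prod glues_prod lifts_prod transposes_prod)

text \<open>The comparison with a given cromulent diagram: an element \<open>x\<close> yields its image \<open>w\<close> at level \<open>n\<close>, and a
path \<open>y\<close> to the end of \<open>w\<close> lifts uniquely to level \<open>k\<close> so that it ends at the end of \<open>x\<close>; the section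
takes \<open>y\<close> to the start of the lifted path.\<close>

definition lifting :: "nat \<Rightarrow> nat \<Rightarrow> 'a \<Rightarrow> 'a \<Rightarrow> 'a" where
  "lifting j k c y = (THE e. e \<in> X (0,j,k) \<and> r (0,j,k) (j,j,k) e = c \<and> r (0,j,k) (0,j,n) e = y)"

definition to_prod :: "idx \<Rightarrow> 'a \<Rightarrow> 'a \<times> ('a \<Rightarrow> 'a)" where
  "to_prod = (\<lambda>(i,j,k) x. (r (i,j,k) (i,j,n) x,
     \<lambda>y\<in>paths j (r (i,j,k) (j,j,n) x).
       r (0,j,k) (0,0,k) (lifting j k (r (i,j,k) (j,j,k) x) y)))"

lemma to_prod_eq: "to_prod (i,j,k) x = (r (i,j,k) (i,j,n) x,
     \<lambda>y\<in>paths j (r (i,j,k) (j,j,n) x).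
       r (0,j,k) (0,0,k) (lifting j k (r (i,j,k) (j,j,k) x) y))"
  by (simp add: to_prod_def)

text \<open>The comparison at \<open>(i,j,k)\<close> uses only the endpoints \<open>0\<close>, \<open>i\<close>, \<open>j\<close> and the levels \<open>k\<close>, \<open>n\<close>.  So it is an
isomorphism on every part of the horn that contains the vertex \<open>0\<close> and the level \<open>n\<close>.\<close>

context
  fixes A' B'
  assumes L: "locally_cromulent m n X r A' B'" and zero_in_A: "0 \<in> A'" and n_in_B: "n \<in> B'"
begin

lemma lifting:
  assumes "j \<le> m" "j \<in> A'" "k \<le> n" "k \<in> B'" "c \<in> X (j,j,k)" "y \<in> paths j (r (j,j,k) (j,j,n) c)"
  shows "lifting j k c y \<in> X (0,j,k)" "r (0,j,k) (j,j,k) (lifting j k c y) = c"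
    "r (0,j,k) (0,j,n) (lifting j k c y) = y"
proof -
  have "\<exists>!e. e \<in> X (0,j,k) \<and> r (0,j,k) (j,j,k) e = c \<and> r (0,j,k) (0,j,n) e = y"
    using assms zero_in_A n_in_B by (intro liftsD[OF local_lift[OF L]]) (auto simp: paths_def)
  from theI'[OF this] show "lifting j k c y \<in> X (0,j,k)" "r (0,j,k) (j,j,k) (lifting j k c y) = c"
    "r (0,j,k) (0,j,n) (lifting j k c y) = y"
    by (auto simp: lifting_def)
qed

lemma lifting_res:
  assumes "j \<le> m" "j \<in> A'" "k \<le> n" "k \<in> B'" "e \<in> X (0,j,k)"
  shows "lifting j k (r (0,j,k) (j,j,k) e) (r (0,j,k) (0,j,n) e) = e"
proof -
  let ?c = "r (0,j,k) (j,j,k) e" and ?y = "r (0,j,k) (0,j,n) e"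
  have "\<exists>!e'. e' \<in> X (0,j,k) \<and> r (0,j,k) (j,j,k) e' = ?c \<and> r (0,j,k) (0,j,n) e' = ?y"
    using assms zero_in_A n_in_B
    by (intro liftsD[OF local_lift[OF L]]) (simp_all add: local_res[OF L] local_res_res[OF L])
  then show ?thesis unfolding lifting_def by (rule the1_equality) (use assms in simp)
qed

lemma to_prod_in:
  assumes "i \<le> j" "j \<le> m" "i \<in> A'" "j \<in> A'" "k \<le> n" "k \<in> B'" and x: "x \<in> X (i,j,k)"
  shows "to_prod (i,j,k) x \<in> prod_ob (i,j,k)"
proof -
  let ?c = "r (i,j,k) (j,j,k) x"
  have c: "?c \<in> X (j,j,k)" "r (j,j,k) (j,j,n) ?c = r (i,j,k) (j,j,n) x"
    and w: "r (i,j,k) (i,j,n) x \<in> X (i,j,n)"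
    and wj: "r (i,j,n) (j,j,n) (r (i,j,k) (i,j,n) x) = r (i,j,k) (j,j,n) x"
    using assms zero_in_A n_in_B by (simp_all add: local_res[OF L] local_res_res[OF L])
  have "r (0,j,k) (0,0,k) (lifting j k ?c y) \<in> X (0,0,k) \<and>
      r (0,0,k) (0,0,n) (r (0,j,k) (0,0,k) (lifting j k ?c y)) = r (0,j,n) (0,0,n) y"
    if y: "y \<in> paths j (r (i,j,k) (j,j,n) x)" for y
  proof -
    note e = lifting[OF assms(2,4,5,6) c(1), of y, unfolded c(2), OF y]
    have "r (0,0,k) (0,0,n) (r (0,j,k) (0,0,k) (lifting j k ?c y)) =
        r (0,j,n) (0,0,n) (r (0,j,k) (0,j,n) (lifting j k ?c y))"
      using e(1) assms zero_in_A n_in_B by (simp add: local_res_res[OF L])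
    then show ?thesis using e assms zero_in_A n_in_B by (simp add: local_res[OF L])
  qed
  then show ?thesis using w by (simp add: to_prod_eq prod_ob_iff sections_def wj)
qed

lemma to_prod_iff:
  assumes "i \<le> j" "j \<le> m" "i \<in> A'" "j \<in> A'" "k \<le> n" "k \<in> B'" and x: "x \<in> X (i,j,k)"
    and ws: "(w, s) \<in> prod_ob (i,j,k)"
  shows "to_prod (i,j,k) x = (w, s) \<longleftrightarrow> r (i,j,k) (i,j,n) x = w \<and>
    (\<forall>e\<in>X (0,j,k). r (0,j,k) (j,j,k) e = r (i,j,k) (j,j,k) x \<longrightarrow>
       r (0,j,k) (0,0,k) e = s (r (0,j,k) (0,j,n) e))" (is "_ \<longleftrightarrow> _ \<and> ?ev")
proof (cases "r (i,j,k) (i,j,n) x = w")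
  case False
  then show ?thesis by (simp add: to_prod_eq)
next
  case True
  let ?c = "r (i,j,k) (j,j,k) x" and ?z = "r (i,j,k) (j,j,n) x"
  have c: "?c \<in> X (j,j,k)" "r (j,j,k) (j,j,n) ?c = ?z"
    and wj: "r (i,j,n) (j,j,n) (r (i,j,k) (i,j,n) x) = ?z"
    using assms(1-7) zero_in_A n_in_B by (simp_all add: local_res[OF L] local_res_res[OF L])
  have s: "s \<in> sections j ?z k" using ws True wj by (auto simp: prod_ob_iff)
  have "to_prod (i,j,k) x = (w, s) \<longleftrightarrow>
      (\<forall>y\<in>paths j ?z. r (0,j,k) (0,0,k) (lifting j k ?c y) = s y)"
  proof -
    have "(\<lambda>y\<in>paths j ?z. r (0,j,k) (0,0,k) (lifting j k ?c y)) = s \<longleftrightarrow>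
      (\<forall>y\<in>paths j ?z. r (0,j,k) (0,0,k) (lifting j k ?c y) = s y)" (is "?f = s \<longleftrightarrow> ?all")
    proof
      assume eq: "?f = s"
      show ?all
      proof
        fix y assume "y \<in> paths j ?z"
        then show "r (0,j,k) (0,0,k) (lifting j k ?c y) = s y" using fun_cong[OF eq, of y] by simp
      qed
    next
      assume ?all
      then show "?f = s"
        using s by (intro extensionalityI[of _ "paths j ?z"]) (auto simp: sections_def)
    qed
    then show ?thesis using True by (simp add: to_prod_eq)
  qed
  also have "\<dots> \<longleftrightarrow> ?ev"
  proof
    assume all: "\<forall>y\<in>paths j ?z. r (0,j,k) (0,0,k) (lifting j k ?c y) = s y"
    show ?ev
    proof (intro ballI impI)
      fix e assume e: "e \<in> X (0,j,k)" "r (0,j,k) (j,j,k) e = ?c"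
      have "r (0,j,n) (j,j,n) (r (0,j,k) (0,j,n) e) = r (j,j,k) (j,j,n) (r (0,j,k) (j,j,k) e)"
        using e(1) assms(1-7) zero_in_A n_in_B by (simp add: local_res_res[OF L])
      then have "r (0,j,k) (0,j,n) e \<in> paths j ?z"
        using e c assms(1-7) zero_in_A n_in_B by (simp add: paths_def local_res[OF L])
      with all have "r (0,j,k) (0,0,k) (lifting j k ?c (r (0,j,k) (0,j,n) e)) = s (r (0,j,k) (0,j,n) e)"
        by blast
      then show "r (0,j,k) (0,0,k) e = s (r (0,j,k) (0,j,n) e)"
        using lifting_res[OF assms(2,4,5,6) e(1)] e(2) by simp
    qed
  next
    assume ev: ?ev
    show "\<forall>y\<in>paths j ?z. r (0,j,k) (0,0,k) (lifting j k ?c y) = s y"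
    proof
      fix y assume y: "y \<in> paths j ?z"
      show "r (0,j,k) (0,0,k) (lifting j k ?c y) = s y"
        using ev lifting[OF assms(2,4,5,6) c(1), of y, unfolded c(2), OF y] by simp
    qed
  qed
  finally show ?thesis using True by simp
qed

text \<open>For given \<open>(w, s)\<close> the transpose of \<open>s\<close> is the only possible end \<open>c\<close> of \<open>x\<close> at level \<open>k\<close>, and \<open>x\<close> is
then the unique element over \<open>[i,j]\<close> with end \<open>c\<close> and image \<open>w\<close>.\<close>

lemma bij_betw_to_prod:
  assumes *: "i \<le> j" "j \<le> m" "i \<in> A'" "j \<in> A'" "k \<le> n" "k \<in> B'"
  shows "bij_betw (to_prod (i,j,k)) (X (i,j,k)) (prod_ob (i,j,k))"
proof -
  have ex: "\<exists>!x. x \<in> X (i,j,k) \<and> to_prod (i,j,k) x = (w, s)" if ws: "(w, s) \<in> prod_ob (i,j,k)" for w s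
  proof -
    let ?z = "r (i,j,n) (j,j,n) w"
    have w: "w \<in> X (i,j,n)" and s: "s \<in> sections j ?z k" using ws by (auto simp: prod_ob_iff)
    have z: "?z \<in> X (j,j,n)" using w * by (simp add: row_res)
    have "\<exists>!c. c \<in> X (j,j,k) \<and> r (j,j,k) (j,j,n) c = ?z \<and>
      (\<forall>e\<in>X (0,j,k). r (0,j,k) (j,j,k) e = c \<longrightarrow> r (0,j,k) (0,0,k) e = s (r (0,j,k) (0,j,n) e))"
      (is "\<exists>!c. ?P c")
    proof (rule transposesD[OF local_transpose[OF L] z])
      fix y assume "y \<in> X (0,j,n)" "r (0,j,n) (j,j,n) y = ?z"
      then have "y \<in> paths j ?z" by (simp add: paths_def)
      from sectionsD[OF s this] show "s y \<in> X (0,0,k) \<and> r (0,0,k) (0,0,n) (s y) = r (0,j,n) (0,0,n) y"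
        by simp
    qed (use * zero_in_A n_in_B in simp_all)
    then obtain c where c: "?P c" and c_unique: "\<And>c'. ?P c' \<Longrightarrow> c' = c" by blast
    have "\<exists>!x. x \<in> X (i,j,k) \<and> r (i,j,k) (j,j,k) x = c \<and> r (i,j,k) (i,j,n) x = w"
      using c w * zero_in_A n_in_B by (intro liftsD[OF local_lift[OF L]]) simp_all
    moreover have "to_prod (i,j,k) x = (w, s) \<longleftrightarrow> r (i,j,k) (j,j,k) x = c \<and> r (i,j,k) (i,j,n) x = w"
      if x: "x \<in> X (i,j,k)" for x
    proof -
      have "r (j,j,k) (j,j,n) (r (i,j,k) (j,j,k) x) = r (i,j,n) (j,j,n) (r (i,j,k) (i,j,n) x)"
        "r (i,j,k) (j,j,k) x \<in> X (j,j,k)"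
        using x * zero_in_A n_in_B by (simp_all add: local_res[OF L] local_res_res[OF L])
      then have "?P (r (i,j,k) (j,j,k) x)" if "to_prod (i,j,k) x = (w, s)"
        using that[unfolded to_prod_iff[OF * x ws]] by simp
      then show ?thesis using c c_unique unfolding to_prod_iff[OF * x ws] by metis
    qed
    ultimately show ?thesis by (simp cong: conj_cong)
  qed
  show ?thesis
  proof (rule bij_betwI')
    fix x x' assume x: "x \<in> X (i,j,k)" "x' \<in> X (i,j,k)"
    have "(fst (to_prod (i,j,k) x), snd (to_prod (i,j,k) x)) \<in> prod_ob (i,j,k)" using to_prod_in[OF * x(1)] by simp
    from ex[OF this] show "(to_prod (i,j,k) x = to_prod (i,j,k) x') = (x = x')" using x by auto
  next
    fix x assume "x \<in> X (i,j,k)"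
    then show "to_prod (i,j,k) x \<in> prod_ob (i,j,k)" by (rule to_prod_in[OF *])
  next
    fix v assume "v \<in> prod_ob (i,j,k)"
    then show "\<exists>x\<in>X (i,j,k). v = to_prod (i,j,k) x" using ex[of "fst v" "snd v"] by auto
  qed
qed

text \<open>Let \<open>e\<close> be the lift to level \<open>k\<close> of the path \<open>y\<close> continued along \<open>w\<close>.  By uniqueness of lifts it runs
along \<open>x\<close> from \<open>j'\<close> to \<open>j\<close>, so its initial part, moved to level \<open>l\<close>, is the lift of \<open>y\<close> at level \<open>l\<close>.  Both
have the same start.\<close>

lemma to_prod_natural:
  assumes le: "i \<le> i'" "i' \<le> j'" "j' \<le> j" "j \<le> m" "k \<le> l" "l \<le> n"
    and A: "i \<in> A'" "j \<in> A'" "i' \<in> A'" "j' \<in> A'" and B: "k \<in> B'" "l \<in> B'" and x: "x \<in> X (i,j,k)"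
  shows "to_prod (i',j',l) (r (i,j,k) (i',j',l) x) = prod_res (i,j,k) (i',j',l) (to_prod (i,j,k) x)"
proof -
  note facts = le A B x zero_in_A n_in_B
  let ?c = "r (i,j,k) (j,j,k) x" and ?z = "r (i,j,k) (j,j,n) x" and ?w = "r (i,j,k) (j',j,n) x"
  have c: "?c \<in> X (j,j,k)" "r (j,j,k) (j,j,n) ?c = ?z"
    using facts by (simp_all add: local_res[OF L] local_res_res[OF L])
  have "r (0,j',l) (0,0,l) (lifting j' l (r (i,j,k) (j',j',l) x) y) =
      r (0,0,k) (0,0,l) ((\<lambda>y\<in>paths j ?z. r (0,j,k) (0,0,k) (lifting j k ?c y)) (join j' j y ?w))"
    if y: "y \<in> paths j' (r (i,j,k) (j',j',n) x)" for y
  proof -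
    have w: "?w \<in> X (j',j,n)" "r (j',j,n) (j',j',n) ?w = r (i,j,k) (j',j',n) x"
      "r (j',j,n) (j,j,n) ?w = ?z"
      using facts by (simp_all add: local_res[OF L] local_res_res[OF L])
    have y': "y \<in> paths j' (r (j',j,n) (j',j',n) ?w)" using y w(2) by simp
    let ?Y = "join j' j y ?w"
    have Y: "?Y \<in> paths j ?z" using join_in_paths[OF le(3,4) w(1) y'] w(3) by simp
    note J = join[OF le(3,4) w(1) y']
    let ?e = "lifting j k ?c ?Y"
    have e: "?e \<in> X (0,j,k)" "r (0,j,k) (j,j,k) ?e = ?c" "r (0,j,k) (0,j,n) ?e = ?Y"
      using lifting[of j k ?c ?Y] facts c Y by simp_all
    \<comment> \<open>Both sides lie over \<open>[j',j]\<close> at level \<open>k\<close> and have the same end and the same image at level \<open>n\<close>.\<close>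
    have same: "r (0,j,k) (j',j,k) ?e = r (i,j,k) (j',j,k) x"
    proof -
      have "\<exists>!v. v \<in> X (j',j,k) \<and> r (j',j,k) (j,j,k) v = ?c \<and> r (j',j,k) (j',j,n) v = ?w"
        using facts c w by (intro liftsD[OF local_lift[OF L]]) simp_all
      moreover have "r (0,j,k) (j',j,k) ?e \<in> X (j',j,k)" "r (i,j,k) (j',j,k) x \<in> X (j',j,k)"
        "r (j',j,k) (j,j,k) (r (i,j,k) (j',j,k) x) = ?c"
        "r (j',j,k) (j',j,n) (r (i,j,k) (j',j,k) x) = ?w"
        using facts e(1) by (simp_all add: local_res[OF L] local_res_res[OF L])
      moreover have "r (j',j,k) (j,j,k) (r (0,j,k) (j',j,k) ?e) = ?c"
        using facts e(1,2) by (simp add: local_res_res[OF L])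
      moreover have "r (j',j,k) (j',j,n) (r (0,j,k) (j',j,k) ?e) = ?w"
      proof -
        have "r (j',j,k) (j',j,n) (r (0,j,k) (j',j,k) ?e) = r (0,j,n) (j',j,n) (r (0,j,k) (0,j,n) ?e)"
          using facts e(1) by (simp add: local_res_res[OF L])
        then show ?thesis using e(3) J(3) by simp
      qed
      ultimately show ?thesis by blast
    qed
    let ?e' = "r (0,j,k) (0,j',l) ?e"
    have "r (0,j',l) (j',j',l) ?e' = r (j',j,k) (j',j',l) (r (0,j,k) (j',j,k) ?e)"
      using facts e(1) by (simp add: local_res_res[OF L])
    also have "\<dots> = r (i,j,k) (j',j',l) x"
      using facts unfolding same by (simp add: local_res_res[OF L])
    finally have e'1: "r (0,j',l) (j',j',l) ?e' = r (i,j,k) (j',j',l) x" .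
    have "r (0,j',l) (0,j',n) ?e' = r (0,j,n) (0,j',n) (r (0,j,k) (0,j,n) ?e)"
      using facts e(1) by (simp add: local_res_res[OF L])
    then have e'2: "r (0,j',l) (0,j',n) ?e' = y" using e(3) J(2) by simp
    have "lifting j' l (r (i,j,k) (j',j',l) x) y = ?e'"
      using lifting_res[of j' l ?e'] facts e(1) e'1 e'2 by (simp add: local_res[OF L])
    moreover have "r (0,j',l) (0,0,l) ?e' = r (0,0,k) (0,0,l) (r (0,j,k) (0,0,k) ?e)"
      using facts e(1) by (simp add: local_res_res[OF L])
    ultimately show ?thesis using Y by simp
  qed
  then show ?thesis
    using facts by (auto simp: to_prod_eq prod_res_eq local_res[OF L] local_res_res[OF L] intro!: restrict_ext)
qed

lemma diagram_iso_to_prod: "diagram_iso (idx m n \<inter> within A' B') X r prod_ob prod_res to_prod"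
proof
  fix p assume p: "p \<in> idx m n \<inter> within A' B'"
  obtain i j k where p': "p = (i,j,k)" by (cases p)
  show "bij_betw (to_prod p) (X p) (prod_ob p)" using bij_betw_to_prod p by (simp add: p')
  fix q x assume q: "q \<in> idx m n \<inter> within A' B'" "p \<sqsubseteq> q" and x: "x \<in> X p"
  obtain i' j' l where q': "q = (i',j',l)" by (cases q)
  show "r p q x \<in> X q" using p q x by (intro local_res[OF L]) auto
  show "to_prod q (r p q x) = prod_res p q (to_prod p x)"
    using p q x unfolding p' q' by (intro to_prod_natural) auto
qed

end

end

lemma horn_fillable_outer:
  assumes inf: "infinite (UNIV :: 'a set)" and "1 \<le> m" "1 \<le> n"
  shows "horn_fillable TYPE('a) m n 0 n"
proof (rule horn_fillableI[where ?'b = "'a \<times> ('a \<Rightarrow> 'a)", OF inf])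
  fix X and r :: "idx \<Rightarrow> idx \<Rightarrow> 'a \<Rightarrow> 'a"
  assume loc: "\<And>A B. (A, B) \<in> horn_cover m n 0 n \<Longrightarrow> locally_cromulent m n X r A B"
  have "row_column m n X r ({0..m} - {1}) ({0..n} - {0})"
    using assms by unfold_locales (auto intro!: loc simp: horn_cover_def)
  then interpret row_column m n X r "{0..m} - {1}" "{0..n} - {0}" .
  have "diagram_iso (idx m n \<inter> within A B) X r prod_ob prod_res to_prod" if AB: "(A, B) \<in> horn_cover m n 0 n" for A B
    using AB by (intro diagram_iso_to_prod loc) (auto simp: horn_cover_def)
  then show "\<exists>(G :: idx \<Rightarrow> ('a \<times> ('a \<Rightarrow> 'a)) set) g \<kappa>. crom_diagram m n G g \<and>
    (\<forall>A B. (A, B) \<in> horn_cover m n 0 n \<longrightarrow> diagram_iso (idx m n \<inter> within A B) X r G g \<kappa>)"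
    using crom_diagram_prod by blast
qed

section \<open>The distributive law\<close>

theorem theorem6p9:
  assumes "infinite (UNIV :: 'a set)"
  shows "distributive_law (D_times_plus :: 'a fin_diagram bisset)"
  unfolding distributive_law_def
  using bisimplicial_set_D_times_plus
    all_maps_extend_if_horn_fillable[OF horn_fillable_outer[OF assms]]
    all_maps_extend_if_horn_fillable[OF horn_fillable_vertical[OF assms]]
    all_maps_extend_if_horn_fillable[OF horn_fillable_horizontal[OF assms]]
  by auto

end
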